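(* Let $\Omega:=\mathbb{R}^2\times(0,+\infty)\subset\mathbb{R}^3$. There exists an autonomous vector field $u:\Omega\to\mathbb{R}^3$ such that $\operatorname{div}u=0$, $u\in L^\infty(\Omega)\cap BV_{\rm loc}(\Omega)$, $\mathrm{Tr}_n(u;\partial\Omega)\equiv u_n^{\partial\Omega}\equiv-1$ (i.e. both the outward distributional normal trace and the outward normal Lebesgue trace of $u$ on $\partial\Omega$ exist and are identically $-1$), and the initial-boundary value problem $$\partial_t\rho+u\cdot\nabla\rho=0\ \text{ in }\Omega\times(0,1),\qquad \rho=0\ \text{ on }\partial\Omega\times(0,1),\qquad\rho(\cdot,0)=0\ \text{ in }\Omega$$ admits infinitely many weak solutions $\rho\in L^\infty(\Omega\times(0,1))$.
   Context: Distributional normal trace: for a vector field $u\in L^\infty(\Omega)$ with $\operatorname{div}u=0$, $\langle\mathrm{Tr}_n(u;\partial\Omega),\varphi\rangle=\int_\Omega u\cdot\nabla\varphi\,dy$ for $\varphi\in C^\infty_c(\mathbb{R}^3)$; it is represented by a function in $L^\infty(\partial\Omega)$. Normal Lebesgue trace: with $d_{\partial\Omega}$ the distance to $\partial\Omega$, the inward normal Lebesgue trace is the (unique) function $f=u_{-n}^{\partial\Omega}\in L^1_{\rm loc}(\partial\Omega;\mathcal{H}^2)$, if it exists, such that for every sequence $r_k\to0^+$, $\frac1{r_k^3}\int_{B_{r_k}(x)\cap\Omega}|(u\cdot\nabla d_{\partial\Omega})(y)-f(x)|\,dy\to0$ for $\mathcal{H}^2$-a.e. $x\in\partial\Omega$;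 the outward one is $u_n^{\partial\Omega}=-u_{-n}^{\partial\Omega}$. Weak solution: since $\operatorname{div}u=0$ the equation is read as $\partial_t\rho+\operatorname{div}(\rho u)=0$. If $\rho\in L^\infty(\Omega\times(0,1))$ solves it in $\mathcal{D}'(\Omega\times(0,1))$, then the space-time field $\rho(u,1)$ is bounded with zero space-time divergence and has a space-time outward distributional normal trace on $\partial(\Omega\times(0,1))$, given by $\varphi\mapsto\int_0^1\int_\Omega\rho(\partial_t\varphi+u\cdot\nabla\varphi)\,dx\,dt$ and represented by a bounded function; $\mathrm{Tr}_n(\rho u)$ denotes its restriction to $\partial\Omega\times(0,1)$. Such $\rho$ is a weak solution of the problem if for all $\varphi\in C^1_c(\overline\Omega\times[0,1))$, $\int_0^1\int_\Omega\rho(\partial_t\varphi+u\cdot\nabla\varphi)\,dx\,dt=\int_0^1\int_{\partial\Omega}\mathrm{Tr}_n(\rho u)\varphi\,d\mathcal{H}^{2}dt$ (zero initial datum) and $\mathrm{Tr}_n(\rho u)=0\cdot\mathrm{Tr}_n(u)=0$ a.e. on the part of the boundary where characteristics enter, which here (the normal trace being $-1$) is all of $\partial\Omega\times(0,1)$. *)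

theory Defs
  imports "HOL-Analysis.Analysis"
begin

section \<open>Hausdorff measure and surface measure\<close>

text \<open>
  The normalisation \<open>unit_ball_vol n * (diam / 2) ^ n\<close> makes the \<open>n\<close>-dimensional Hausdorff measure
  agree with Lebesgue measure on \<open>n\<close>-planes. Intended for \<open>n \<ge> 1\<close>, where empty members of a cover
  contribute nothing. Boundedness is required because \<^const>\<open>diameter\<close> is unspecified on
  unbounded sets.
\<close>

definition hausdorff_pre :: "nat \<Rightarrow> real \<Rightarrow> 'a::metric_space set \<Rightarrow> ennreal" where
  "hausdorff_pre n \<delta> A =
     (INF C \<in> {C :: nat \<Rightarrow> 'a set. A \<subseteq> (\<Union>i. C i) \<and> (\<forall>i. bounded (C i) \<and> diameter (C i) \<le> \<delta>)}.
        \<Sum>i. ennreal (unit_ball_vol (real n) * (diameter (C i) / 2) ^ n))"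

definition hausdorff_outer :: "nat \<Rightarrow> 'a::metric_space set \<Rightarrow> ennreal" where
  "hausdorff_outer n A = (SUP \<delta> \<in> {0<..}. hausdorff_pre n \<delta> A)"

text \<open>
  \<^const>\<open>hausdorff_outer\<close> is a metric outer measure, hence countably additive on the Borel sets, so
  \<^const>\<open>measure_of\<close> assigns to a Borel set its outer measure.
\<close>

definition hausdorff_measure :: "nat \<Rightarrow> 'a::metric_space measure" where
  "hausdorff_measure n = measure_of UNIV (sets borel) (hausdorff_outer n)"

definition surface_measure :: "'a::euclidean_space set \<Rightarrow> 'a measure" where
  "surface_measure \<Omega> = restrict_space (hausdorff_measure (DIM('a) - 1)) (frontier \<Omega>)"


section \<open>Function spaces\<close>

text \<open>
  Functions on an open set or on a boundary are represented by total functions, of which only the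
  values on the space of the measure in question matter.
\<close>

definition Linfty :: "'a measure \<Rightarrow> ('a \<Rightarrow> 'b::euclidean_space) set" where
  "Linfty M = {f \<in> borel_measurable M. \<exists>C. AE x in M. norm (f x) \<le> C}"

definition L1_loc :: "'a::topological_space measure \<Rightarrow> ('a \<Rightarrow> real) set" where
  "L1_loc M = {f \<in> borel_measurable M. \<forall>K. compact K \<and> K \<subseteq> space M \<longrightarrow> set_integrable M K f}"

definition grad :: "('a::real_inner \<Rightarrow> real) \<Rightarrow> 'a \<Rightarrow> 'a" where
  "grad f x = (THE D. GDERIV f x :> D)"

fun times_differentiable :: "nat \<Rightarrow> ('a::euclidean_space \<Rightarrow> real) \<Rightarrow> bool" where
  "times_differentiable 0 f = continuous_on UNIV f"
| "times_differentiable (Suc k) f =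
     ((\<forall>x. f differentiable (at x)) \<and>
      (\<forall>v. times_differentiable k (\<lambda>x. frechet_derivative f (at x) v)))"

text \<open>\<open>C\<^sub>c\<^sup>\<infinity>(W)\<close> for open \<open>W\<close>, each function being extended by zero to the whole space.\<close>

definition test_function :: "'a::euclidean_space set \<Rightarrow> ('a \<Rightarrow> real) \<Rightarrow> bool" where
  "test_function W \<phi> \<longleftrightarrow>
     (\<forall>k. times_differentiable k \<phi>) \<and>
     compact (closure {x. \<phi> x \<noteq> 0}) \<and> closure {x. \<phi> x \<noteq> 0} \<subseteq> W"

text \<open>
  \<open>C\<^sub>c\<^sup>1(S)\<close>, where \<open>S\<close> need not be open: at points of \<open>S\<close> outside its interior, differentiability
  is understood relative to \<open>S\<close>, and the gradient \<open>D\<close> is continuous up to these points. The support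
  is a compact subset of \<open>S\<close>, so it may meet that part of the boundary of \<open>S\<close> which belongs to \<open>S\<close>.
\<close>

definition C1c :: "'a::euclidean_space set \<Rightarrow> ('a \<Rightarrow> real) set" where
  "C1c S = {\<phi>.
     (\<exists>D. continuous_on S D \<and> (\<forall>z\<in>S. (\<phi> has_derivative (\<lambda>h. h \<bullet> D z)) (at z within S))) \<and>
     (\<exists>K. compact K \<and> K \<subseteq> S \<and> (\<forall>z\<in>S - K. \<phi> z = 0))}"

definition divergence :: "('a::euclidean_space \<Rightarrow> 'a) \<Rightarrow> 'a \<Rightarrow> real" where
  "divergence \<Phi> x = (\<Sum>b\<in>Basis. grad (\<lambda>y. \<Phi> y \<bullet> b) x \<bullet> b)"

text \<open>
  \<open>BV\<^sub>l\<^sub>o\<^sub>c\<close> by finiteness of the total variation on every relatively compact open subset; a vector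
  field is in \<open>BV\<^sub>l\<^sub>o\<^sub>c\<close> if its components are.
\<close>

definition BV_loc :: "'a::euclidean_space set \<Rightarrow> ('a \<Rightarrow> real) set" where
  "BV_loc \<Omega> = {f \<in> L1_loc (lebesgue_on \<Omega>).
     \<forall>V. open V \<and> compact (closure V) \<and> closure V \<subseteq> \<Omega> \<longrightarrow>
       bdd_above {LINT x|lebesgue_on V. f x * divergence \<Phi> x |\<Phi>.
         (\<forall>b\<in>Basis. (\<lambda>x. \<Phi> x \<bullet> b) \<in> C1c V) \<and> (\<forall>x\<in>V. norm (\<Phi> x) \<le> 1)}}"

definition BV_loc_field :: "'a::euclidean_space set \<Rightarrow> ('a \<Rightarrow> 'b::euclidean_space) set" where
  "BV_loc_field \<Omega> = {u. \<forall>b\<in>Basis. (\<lambda>x. u x \<bullet> b) \<in> BV_loc \<Omega>}"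


section \<open>Divergence and normal traces\<close>

definition weakly_divergence_free :: "'a::euclidean_space set \<Rightarrow> ('a \<Rightarrow> 'a) \<Rightarrow> bool" where
  "weakly_divergence_free U v \<longleftrightarrow>
     (\<forall>\<phi>. test_function U \<phi> \<longrightarrow> (LINT y|lebesgue_on U. v y \<bullet> grad \<phi> y) = 0)"

text \<open>
  Outward distributional normal trace of a bounded divergence-free field \<open>v\<close> on the boundary of \<open>U\<close>.
\<close>

definition normal_trace :: "'a::euclidean_space set \<Rightarrow> ('a \<Rightarrow> 'a) \<Rightarrow> ('a \<Rightarrow> real) \<Rightarrow> real" where
  "normal_trace U v \<phi> = (LINT y|lebesgue_on U. v y \<bullet> grad \<phi> y)"

definition has_normal_trace :: "'a::euclidean_space set \<Rightarrow> ('a \<Rightarrow> 'a) \<Rightarrow> ('a \<Rightarrow> real) \<Rightarrow> bool" where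
  "has_normal_trace \<Omega> u g \<longleftrightarrow>
     g \<in> Linfty (surface_measure \<Omega>) \<and>
     (\<forall>\<phi>. test_function UNIV \<phi> \<longrightarrow>
        normal_trace \<Omega> u \<phi> = (LINT x|surface_measure \<Omega>. g x * \<phi> x))"

definition has_inward_Lebesgue_trace ::
    "'a::euclidean_space set \<Rightarrow> ('a \<Rightarrow> 'a) \<Rightarrow> ('a \<Rightarrow> real) \<Rightarrow> bool" where
  "has_inward_Lebesgue_trace \<Omega> u f \<longleftrightarrow>
     f \<in> L1_loc (surface_measure \<Omega>) \<and>
     (\<forall>r :: nat \<Rightarrow> real. (\<forall>k. r k > 0) \<and> r \<longlonglongrightarrow> 0 \<longrightarrow>
        (AE x in surface_measure \<Omega>.
           (\<lambda>k. (1 / r k ^ DIM('a)) *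
              (LINT y|lebesgue_on (ball x (r k) \<inter> \<Omega>).
                 \<bar>u y \<bullet> grad (\<lambda>z. infdist z (frontier \<Omega>)) y - f x\<bar>)) \<longlonglongrightarrow> 0))"

definition has_outward_Lebesgue_trace ::
    "'a::euclidean_space set \<Rightarrow> ('a \<Rightarrow> 'a) \<Rightarrow> ('a \<Rightarrow> real) \<Rightarrow> bool" where
  "has_outward_Lebesgue_trace \<Omega> u g \<longleftrightarrow> has_inward_Lebesgue_trace \<Omega> u (\<lambda>x. - g x)"


section \<open>The initial-boundary value problem\<close>

text \<open>
  The space-time field \<open>\<rho>(u, 1)\<close>; its inner product with the space-time gradient of \<open>\<phi>\<close> is
  \<open>\<rho>(\<partial>\<^sub>t\<phi> + u \<cdot> \<nabla>\<phi>)\<close>.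
\<close>

definition spacetime_field ::
    "('a::euclidean_space \<Rightarrow> 'a) \<Rightarrow> ('a \<times> real \<Rightarrow> real) \<Rightarrow> 'a \<times> real \<Rightarrow> 'a \<times> real" where
  "spacetime_field u \<rho> = (\<lambda>(y, t). \<rho> (y, t) *\<^sub>R (u y, 1))"

definition cylinder :: "'a::euclidean_space set \<Rightarrow> ('a \<times> real) set" where
  "cylinder \<Omega> = \<Omega> \<times> {0<..<1}"

definition lateral_measure :: "'a::euclidean_space set \<Rightarrow> ('a \<times> real) measure" where
  "lateral_measure \<Omega> = surface_measure \<Omega> \<Otimes>\<^sub>M restrict_space lborel {0<..<1}"

text \<open>
  \<open>h\<close> represents the restriction to \<open>\<partial>\<Omega> \<times> (0,1)\<close> of the space-time normal trace of \<open>\<rho>(u, 1)\<close> on the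
  boundary of the cylinder: restricting a distribution on that boundary to its relatively open
  lateral part means testing with functions supported in the open slab \<open>0 < t < 1\<close>.
\<close>

definition has_lateral_trace ::
    "'a::euclidean_space set \<Rightarrow> ('a \<Rightarrow> 'a) \<Rightarrow> ('a \<times> real \<Rightarrow> real) \<Rightarrow> ('a \<times> real \<Rightarrow> real) \<Rightarrow> bool" where
  "has_lateral_trace \<Omega> u \<rho> h \<longleftrightarrow>
     h \<in> Linfty (lateral_measure \<Omega>) \<and>
     (\<forall>\<phi>. test_function (UNIV \<times> {0<..<1}) \<phi> \<longrightarrow>
        normal_trace (cylinder \<Omega>) (spacetime_field u \<rho>) \<phi> = (LINT z|lateral_measure \<Omega>. h z * \<phi> z))"

text \<open>
  Weak solutions with zero initial datum and zero boundary datum. The boundary datum is imposed only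
  where characteristics enter, i.e. where the outward normal trace \<open>g\<close> of \<open>u\<close> is negative; there it
  reads \<open>h = 0 \<cdot> g = 0\<close>. Both \<open>g\<close> and \<open>h\<close> are unique up to null sets.
\<close>

definition weak_solution ::
    "'a::euclidean_space set \<Rightarrow> ('a \<Rightarrow> 'a) \<Rightarrow> ('a \<times> real \<Rightarrow> real) \<Rightarrow> bool" where
  "weak_solution \<Omega> u \<rho> \<longleftrightarrow>
     \<rho> \<in> Linfty (lebesgue_on (cylinder \<Omega>)) \<and>
     weakly_divergence_free (cylinder \<Omega>) (spacetime_field u \<rho>) \<and>
     (\<exists>g h. has_normal_trace \<Omega> u g \<and> has_lateral_trace \<Omega> u \<rho> h \<and>
        (\<forall>\<phi> \<in> C1c (closure \<Omega> \<times> {0..<1}).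
           (LINT z|lebesgue_on (cylinder \<Omega>). spacetime_field u \<rho> z \<bullet> grad \<phi> z) =
           (LINT z|lateral_measure \<Omega>. h z * \<phi> z)) \<and>
        (AE z in lateral_measure \<Omega>. g (fst z) < 0 \<longrightarrow> h z = 0 * g (fst z)))"

definition ae_equal :: "'a measure \<Rightarrow> (('a \<Rightarrow> real) \<times> ('a \<Rightarrow> real)) set" where
  "ae_equal M = {(\<rho>, \<sigma>). AE z in M. \<rho> z = \<sigma> z}"

end

(*
The vertical coordinate plays the role of time: u = (b, 1), where b is a bounded planar field that
undoes mixing (a variant of Depauw's construction). The slab 2^-(n+1) <= x3 < 2^-n is crossed in
time 2^-(n+1). There b is a discontinuous shear, parallel to one of the two horizontal axes and
alternating between them, with speed 0 or 1: it translates some of the strips of width 2^-(n+2)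
by 2^-(n+1), which flips the sign of a square wave of that half-period. Choosing the strips suitably,
it transforms a checkerboard density with values 1 and -1 and cells of size 2^-(n+1) x 2^-(n+2) into
one with cells of size 2^-(n+1) x 2^-n. The resulting density is transported by u in the half-space,
has modulus 1, and tends weakly to 0 at the boundary, because its cells shrink. Cutting it off at the front
x3 = t gives a nonzero solution with zero data, and so do all its multiples.

The field is piecewise constant on cubes of fixed size away from the boundary, hence locally BV. For
the distributional normal trace the Hausdorff measure of the boundary plane has to be identified with
Lebesgue measure, with the exact constant: one inequality is the isodiametric inequality, the other
one follows from Vitali's covering theorem.
*)
theory Submission
  imports Defs
begin

text \<open>The scales are matched so that a bounded speed is enough: the crossing time of a layer
  equals the half-period that has to be flipped. The strips that move are those where the fine wave
  to be removed and the coarse wave to be created have opposite signs; flipping the transverse wave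
  there exchanges one factor for the other. Every layer contributes a comparable amount of variation
  per unit area, so the variation diverges at the boundary, and this leaves room for a density of
  modulus 1 whose weak limit at the boundary is 0.

  All conditions on a solution follow from one identity: the weak formulation vanishes for test
  functions that may be nonzero on the boundary and at time 0. Integration along characteristics
  turns the contribution of a layer into a difference of two pairings of a checkerboard with a slice
  of the test function, and these differences telescope. The top pairing is zero because the front
  cannot reach height 1 before time 1; the bottom one tends to zero by cancellation between
  neighbouring cells.\<close>

section \<open>Hausdorff measure on Borel sets\<close>

text \<open>Every second annulus is taken, so that the chosen ones are at positive distance from each other.\<close>
lemma metric_outer_measure_annuli:
  fixes \<mu> :: "'a::metric_space set \<Rightarrow> ennreal" and D :: "nat \<Rightarrow> 'a set"
  assumes \<mu>: "outer_measure_space UNIV \<mu>"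
    and sep: "\<And>A B \<eta>. \<lbrakk>\<eta> > 0; \<And>x y. x \<in> A \<Longrightarrow> y \<in> B \<Longrightarrow> \<eta> \<le> dist x y\<rbrakk> \<Longrightarrow> \<mu> A + \<mu> B \<le> \<mu> (A \<union> B)"
    and D: "\<And>k x. x \<in> D k \<Longrightarrow> x \<in> E \<and> 1 / real (k + 2) \<le> infdist x F \<and> infdist x F < 1 / real (k + 1)"
  shows "(\<Sum>i<N. \<mu> (D (2 * i + c))) \<le> \<mu> (\<Union>i<N. D (2 * i + c))"
proof (induction N)
  case 0
  show ?case by simp
next
  case (Suc N)
  let ?U = "\<Union>i<N. D (2 * i + c)"
  have "\<mu> ?U + \<mu> (D (2 * N + c)) \<le> \<mu> (?U \<union> D (2 * N + c))"
  \<comment> \<open>For \<open>N = 0\<close> and \<open>c = 0\<close> the gap \<open>\<eta>\<close>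
    below would contain \<open>1 / 0 = 0\<close> and be negative.\<close>
  proof (cases "N = 0")
    case True
    then show ?thesis
      using \<mu> by (simp add: outer_measure_space_def positive_def)
  next
    case False
    define \<eta> where "\<eta> = 1 / real (2 * N + c) - 1 / real (2 * N + c + 1)"
    have "\<eta> > 0"
      using False unfolding \<eta>_def by (simp add: divide_strict_left_mono)
    moreover have "\<eta> \<le> dist x y" if "x \<in> ?U" "y \<in> D (2 * N + c)" for x y
    proof -
      obtain i where i: "i < N" "x \<in> D (2 * i + c)" using \<open>x \<in> ?U\<close> by auto
      have "1 / real (2 * N + c) \<le> 1 / real (2 * i + c + 2)"
        using i by (intro divide_left_mono) auto
      also have "\<dots> \<le> infdist x F" using D[OF i(2)] by simp
      finally have "1 / real (2 * N + c) \<le> infdist x F" .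
      moreover have "infdist y F < 1 / real (2 * N + c + 1)" using D[OF that(2)] by simp
      moreover have "infdist x F \<le> infdist y F + dist x y" by (rule infdist_triangle)
      ultimately show ?thesis unfolding \<eta>_def by linarith
    qed
    ultimately show ?thesis by (rule sep)
  qed
  then have "(\<Sum>i<N. \<mu> (D (2 * i + c))) + \<mu> (D (2 * N + c)) \<le> \<mu> (?U \<union> D (2 * N + c))"
    by (rule order_trans[OF add_right_mono[OF Suc]])
  moreover have "(\<Union>i<Suc N. D (2 * i + c)) = ?U \<union> D (2 * N + c)"
    by (auto simp: lessThan_Suc)
  ultimately show ?case by simp
qed

text \<open>Caratheodory's criterion for metric outer measures. The points of \<open>E\<close> at
  distance at least \<open>1 / (k + 1)\<close> from \<open>F\<close> are separated from
  \<open>F\<close>, so additivity could fail only through points of \<open>E - F\<close> close to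
  \<open>F\<close>. These lie in annuli whose measures have a finite sum, the even and the odd ones
  contributing at most \<open>\<mu> E\<close> each; hence the tail is negligible.\<close>

lemma closed_in_lambda_system:
  fixes \<mu> :: "'a::metric_space set \<Rightarrow> ennreal"
  assumes \<mu>: "outer_measure_space UNIV \<mu>"
    and sep: "\<And>A B \<eta>. \<lbrakk>\<eta> > 0; \<And>x y. x \<in> A \<Longrightarrow> y \<in> B \<Longrightarrow> \<eta> \<le> dist x y\<rbrakk> \<Longrightarrow> \<mu> A + \<mu> B \<le> \<mu> (A \<union> B)"
    and F: "closed F"
  shows "F \<in> lambda_system UNIV UNIV \<mu>"
proof -
  have pos: "\<mu> {} = 0" and mono: "\<And>A B. A \<subseteq> B \<Longrightarrow> \<mu> A \<le> \<mu> B"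
    and csub: "countably_subadditive UNIV \<mu>"
    using \<mu> by (auto simp: outer_measure_space_def positive_def increasing_def)
  have csub': "\<mu> (\<Union>i. A i) \<le> (\<Sum>i. \<mu> (A i))" for A :: "nat \<Rightarrow> 'a set"
  proof -
    have "(\<Union>i. A i) = (\<Union>i. disjointed A i)" by (simp add: UN_disjointed_eq)
    also have "\<mu> \<dots> \<le> (\<Sum>i. \<mu> (disjointed A i))"
      using csub disjoint_family_disjointed[of A] by (auto simp: countably_subadditive_def)
    also have "\<dots> \<le> (\<Sum>i. \<mu> (A i))"
      by (intro suminf_le mono disjointed_subset summableI)
    finally show ?thesis .
  qed
  have sub: "\<mu> (A \<union> B) \<le> \<mu> A + \<mu> B" for A B
    using csub'[of "binaryset A B"] binaryset_sums[of \<mu> A B] pos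
    by (simp add: UN_binaryset_eq sums_iff)
  have "\<mu> (F \<inter> E) + \<mu> (E - F) \<le> \<mu> E" for E
  \<comment> \<open>\<open>infdist\<close> to the empty set is 0 by convention, so an empty
    \<open>F\<close> would defeat the distance argument.\<close>
  proof (cases "F = {} \<or> \<mu> E = \<infinity>")
    case True
    then show ?thesis using pos by auto
  next
    case False
    then have Fne: "F \<noteq> {}" and fin: "\<mu> E < \<infinity>" by (auto simp: less_top)
    define G where "G k = {x \<in> E. 1 / real (k + 1) \<le> infdist x F}" for k
    define D where "D k = {x \<in> E. 1 / real (k + 2) \<le> infdist x F \<and> infdist x F < 1 / real (k + 1)}" for k
    have ann: "(\<Sum>i<N. \<mu> (D (2 * i + c))) \<le> \<mu> E" for N c
    proof -
      have "(\<Sum>i<N. \<mu> (D (2 * i + c))) \<le> \<mu> (\<Union>i<N. D (2 * i + c))"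
        by (rule metric_outer_measure_annuli[OF \<mu> sep, where F = F and E = E]) (auto simp: D_def)
      also have "\<dots> \<le> \<mu> E" by (rule mono) (auto simp: D_def)
      finally show ?thesis .
    qed
    have split: "(\<Sum>k<2 * N. \<mu> (D k)) = (\<Sum>i<N. \<mu> (D (2 * i + 0))) + (\<Sum>i<N. \<mu> (D (2 * i + 1)))" for N
      by (induction N) (auto simp: algebra_simps)
    have "(\<Sum>k<N. \<mu> (D k)) \<le> \<mu> E + \<mu> E" for N
    proof -
      have "(\<Sum>k<N. \<mu> (D k)) \<le> (\<Sum>k<2 * N. \<mu> (D k))" by (intro sum_mono2) auto
      also have "\<dots> \<le> \<mu> E + \<mu> E" unfolding split by (intro add_mono ann)
      finally show ?thesis .
    qed
    then have "(\<Sum>k. \<mu> (D k)) \<le> \<mu> E + \<mu> E" by (intro suminf_le_const summableI)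
    then have sfin: "(\<Sum>k. \<mu> (D k)) < \<infinity>" by (rule le_less_trans) (use fin in \<open>simp add: less_top\<close>)
    have "E - F \<subseteq> G k \<union> (\<Union>j. D (j + k))" for k
    proof
      fix x assume x: "x \<in> E - F"
      then have p: "infdist x F > 0"
        using in_closed_iff_infdist_zero[OF F Fne, of x] infdist_nonneg[of x F] by simp
      show "x \<in> G k \<union> (\<Union>j. D (j + k))"
      proof (cases "x \<in> G k")
        case False
        \<comment> \<open>The annulus containing \<open>x\<close> has index \<open>m - 1\<close>:
          the lower bound on the distance holds for the first time at \<open>m\<close>, so the
          reverse strict bound holds at \<open>m - 1\<close>.\<close>
        define m where "m = (LEAST m. 1 / real (m + 1) \<le> infdist x F)"
        obtain m0 where "1 / real (Suc m0) < infdist x F" using p nat_approx_posE by blast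
        then have m: "1 / real (m + 1) \<le> infdist x F"
          unfolding m_def by (intro LeastI[of "\<lambda>m. 1 / real (m + 1) \<le> infdist x F" m0]) simp
        have "m > k"
        proof (rule ccontr)
          assume "\<not> m > k"
          then have "1 / real (k + 1) \<le> 1 / real (m + 1)" by (intro divide_left_mono) auto
          then show False using m False x by (auto simp: G_def)
        qed
        moreover have "infdist x F < 1 / real (m - 1 + 1)"
        proof -
          have "\<not> (1 / real (m - 1 + 1) \<le> infdist x F)"
            using \<open>m > k\<close> unfolding m_def by (intro not_less_Least) simp
          then show ?thesis by simp
        qed
        ultimately have "x \<in> D (m - 1)" using m x \<open>m > k\<close> by (auto simp: D_def numeral_2_eq_2)
        moreover have "m - 1 = (m - 1 - k) + k" using \<open>m > k\<close> by simp
        ultimately have "x \<in> D ((m - 1 - k) + k)" by (simp only:)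
        then show ?thesis by blast
      qed simp
    qed
    then have "\<mu> (E - F) \<le> \<mu> (G k \<union> (\<Union>j. D (j + k)))" for k by (rule mono)
    then have tail: "\<mu> (E - F) \<le> \<mu> (G k) + (\<Sum>j. \<mu> (D (j + k)))" for k
      by (rule order_trans) (rule order_trans[OF sub add_left_mono[OF csub']])
    have main: "\<mu> (F \<inter> E) + \<mu> (G k) \<le> \<mu> E" for k
    proof -
      have "\<mu> (F \<inter> E) + \<mu> (G k) \<le> \<mu> (F \<inter> E \<union> G k)"
      proof (rule sep[where \<eta> = "1 / real (k + 1)"])
        fix x y assume "x \<in> F \<inter> E" "y \<in> G k"
        then show "1 / real (k + 1) \<le> dist x y"
          using infdist_le[of x F y] by (auto simp: G_def dist_commute)
      qed simp
      also have "\<dots> \<le> \<mu> E" by (rule mono) (auto simp: G_def)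
      finally show ?thesis .
    qed
    show ?thesis
    proof (rule ennreal_le_epsilon)
      fix e :: real assume e: "e > 0"
      let ?S = "\<Sum>k. \<mu> (D k)"
      \<comment> \<open>Comparison with partial sums avoids subtraction in \<open>ennreal\<close>;
        finiteness of the sum is what allows the cancellation.\<close>
      have "\<exists>k. ?S < (\<Sum>j<k. \<mu> (D j)) + ennreal e"
      proof (rule ccontr)
        assume "\<not> ?thesis"
        then have "(\<Sum>j<k. \<mu> (D j)) + ennreal e \<le> ?S" for k by (simp add: not_less)
        then have "(SUP k. (\<Sum>j<k. \<mu> (D j)) + ennreal e) \<le> ?S" by (rule SUP_least)
        then have "?S + ennreal e \<le> ?S"
          by (simp add: suminf_eq_SUP ennreal_SUP_add_left)
        then have "?S + ennreal e \<le> ?S + 0" by simp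
        then show False using e sfin by (simp only: ennreal_add_left_cancel_le) auto
      qed
      then obtain k where k: "?S < (\<Sum>j<k. \<mu> (D j)) + ennreal e" by blast
      have "(\<Sum>j<k. \<mu> (D j)) + (\<Sum>j. \<mu> (D (j + k))) = ?S"
        using suminf_offset[OF summableI, of "\<lambda>k. \<mu> (D k)" k] by (simp only: add.commute)
      with k have "(\<Sum>j<k. \<mu> (D j)) + (\<Sum>j. \<mu> (D (j + k))) < (\<Sum>j<k. \<mu> (D j)) + ennreal e" by simp
      then have te: "(\<Sum>j. \<mu> (D (j + k))) \<le> ennreal e"
        unfolding ennreal_add_left_cancel_less by (blast intro: less_imp_le)
      have "\<mu> (F \<inter> E) + \<mu> (E - F) \<le> \<mu> (F \<inter> E) + (\<mu> (G k) + (\<Sum>j. \<mu> (D (j + k))))"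
        by (intro add_left_mono tail)
      also have "\<dots> \<le> \<mu> E + ennreal e"
        unfolding add.assoc[symmetric] by (intro add_mono main te)
      finally show "\<mu> (F \<inter> E) + \<mu> (E - F) \<le> \<mu> E + ennreal e" .
    qed
  qed
  moreover have "\<mu> E \<le> \<mu> (F \<inter> E) + \<mu> (E - F)" for E
    using sub[of "F \<inter> E" "E - F"] by (simp add: Int_commute Int_Diff_Un)
  ultimately have "\<mu> (F \<inter> E) + \<mu> (E - F) = \<mu> E" for E by (rule antisym)
  moreover have "(UNIV - F) \<inter> E = E - F" for E by blast
  ultimately show ?thesis by (simp add: lambda_system_def)
qed

section \<open>Hausdorff measure as a metric outer measure\<close>

abbreviation hausdorff_gauge :: "nat \<Rightarrow> 'a::metric_space set \<Rightarrow> ennreal" where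
  "hausdorff_gauge n S \<equiv> ennreal (unit_ball_vol (real n) * (diameter S / 2) ^ n)"

lemma hausdorff_pre_le:
  assumes "A \<subseteq> (\<Union>i. C i)" "\<And>i. bounded (C i)" "\<And>i. diameter (C i) \<le> \<delta>"
  shows "hausdorff_pre n \<delta> A \<le> (\<Sum>i. hausdorff_gauge n (C i))"
  unfolding hausdorff_pre_def using assms by (intro INF_lower) auto

lemma hausdorff_pre_mono: "A \<subseteq> B \<Longrightarrow> hausdorff_pre n \<delta> A \<le> hausdorff_pre n \<delta> B"
  unfolding hausdorff_pre_def by (rule INF_superset_mono) auto

lemma hausdorff_pre_antimono: "\<delta> \<le> \<delta>' \<Longrightarrow> hausdorff_pre n \<delta>' A \<le> hausdorff_pre n \<delta> A"
  unfolding hausdorff_pre_def by (rule INF_superset_mono) (auto intro: order_trans)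

lemma hausdorff_pre_le_outer: "\<delta> > 0 \<Longrightarrow> hausdorff_pre n \<delta> A \<le> hausdorff_outer n A"
  unfolding hausdorff_outer_def by (rule SUP_upper) auto

text \<open>Covers of the \<open>A i\<close> that are optimal up to \<open>e / 2 ^ (i + 1)\<close>
  are merged into a single sequence by the pairing bijection \<open>prod_decode\<close>.\<close>

lemma hausdorff_pre_UN:
  "hausdorff_pre n \<delta> (\<Union>i. A i) \<le> (\<Sum>i. hausdorff_pre n \<delta> (A i))"
proof (rule ennreal_le_epsilon)
  fix e :: real assume e: "e > 0" and fin: "(\<Sum>i. hausdorff_pre n \<delta> (A i)) < top"
  have "\<exists>C. A i \<subseteq> (\<Union>j. C j) \<and> (\<forall>j. bounded (C j) \<and> diameter (C j) \<le> \<delta>) \<and>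
      (\<Sum>j. hausdorff_gauge n (C j)) < hausdorff_pre n \<delta> (A i) + ennreal (e * (1/2) ^ Suc i)" for i
  proof -
    have "hausdorff_pre n \<delta> (A i) < top" using fin by (auto dest: ennreal_suminf_lessD)
    then have "hausdorff_pre n \<delta> (A i) < hausdorff_pre n \<delta> (A i) + ennreal (e * (1/2) ^ Suc i)"
      using e by (auto simp: ennreal_zero_less_mult_iff)
    then show ?thesis
      by (subst (asm) (1) hausdorff_pre_def) (auto simp: INF_less_iff)
  qed
  then obtain C where C: "\<And>i. A i \<subseteq> (\<Union>j. C i j)" "\<And>i j. bounded (C i j)" "\<And>i j. diameter (C i j) \<le> \<delta>"
     "\<And>i. (\<Sum>j. hausdorff_gauge n (C i j)) < hausdorff_pre n \<delta> (A i) + ennreal (e * (1/2) ^ Suc i)"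
    by metis
  have "hausdorff_pre n \<delta> (\<Union>i. A i) \<le> (\<Sum>k. hausdorff_gauge n (case_prod C (prod_decode k)))"
  proof (rule hausdorff_pre_le)
    show "(\<Union>i. A i) \<subseteq> (\<Union>k. case_prod C (prod_decode k))"
    proof
      fix x assume "x \<in> (\<Union>i. A i)"
      then obtain i j where "x \<in> C i j" using C(1) by blast
      then show "x \<in> (\<Union>k. case_prod C (prod_decode k))"
        by (intro UN_I[of "prod_encode (i, j)"]) auto
    qed
  qed (use C in \<open>auto simp: split_def\<close>)
  also have "\<dots> = (\<Sum>i. \<Sum>j. hausdorff_gauge n (C i j))"
    by (rule suminf_ennreal_2dimen[where f = "\<lambda>p. hausdorff_gauge n (case_prod C p)"]) simp
  also have "\<dots> \<le> (\<Sum>i. hausdorff_pre n \<delta> (A i) + ennreal (e * (1/2) ^ Suc i))"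
    using C(4) by (intro suminf_le summableI) (simp add: less_imp_le)
  also have "\<dots> = (\<Sum>i. hausdorff_pre n \<delta> (A i)) + (\<Sum>i. ennreal e * ennreal ((1/2) ^ Suc i))"
    using e by (subst suminf_add[symmetric])
       (auto simp del: ennreal_suminf_cmult simp add: ennreal_mult[symmetric])
  also have "\<dots> = (\<Sum>i. hausdorff_pre n \<delta> (A i)) + ennreal e"
    unfolding ennreal_suminf_cmult
    by (subst suminf_ennreal_eq[OF zero_le_power power_half_series]) auto
  finally show "hausdorff_pre n \<delta> (\<Union>i. A i) \<le> (\<Sum>i. hausdorff_pre n \<delta> (A i)) + ennreal e" .
qed

lemma hausdorff_pre_empty:
  assumes "n > 0" "\<delta> > 0"
  shows "hausdorff_pre n \<delta> ({} :: 'a::metric_space set) = 0"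
proof -
  have "hausdorff_pre n \<delta> ({} :: 'a set) \<le> (\<Sum>i::nat. hausdorff_gauge n ({} :: 'a set))"
    by (rule hausdorff_pre_le) (use assms in auto)
  then show ?thesis using assms by (simp add: zero_power)
qed

lemma outer_measure_space_hausdorff:
  assumes "n > 0"
  shows "outer_measure_space (UNIV :: 'a::metric_space set set) (hausdorff_outer n)"
proof -
  note e0 = hausdorff_pre_empty[OF assms, where ?'a = 'a]
  have "(SUP \<delta>\<in>{0<..}. hausdorff_pre n \<delta> ({} :: 'a set)) = (SUP \<delta>::real\<in>{0<..}. 0)"
    by (intro SUP_cong) (simp_all add: e0)
  then have "hausdorff_outer n ({} :: 'a set) = 0"
    by (simp add: hausdorff_outer_def)
  moreover have "hausdorff_outer n A \<le> hausdorff_outer n B" if "A \<subseteq> B" for A B :: "'a set"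
    unfolding hausdorff_outer_def by (rule SUP_subset_mono[OF subset_refl hausdorff_pre_mono[OF that]])
  moreover have "hausdorff_outer n (\<Union>i. A i) \<le> (\<Sum>i. hausdorff_outer n (A i))" for A :: "nat \<Rightarrow> 'a set"
  proof -
    have "hausdorff_pre n \<delta> (\<Union>i. A i) \<le> (\<Sum>i. hausdorff_outer n (A i))" if "\<delta> > 0" for \<delta>
      using that by (intro order_trans[OF hausdorff_pre_UN[of n \<delta> A]] suminf_le summableI hausdorff_pre_le_outer)
    then show ?thesis
      unfolding hausdorff_outer_def[of n "\<Union>i. A i"] by (intro SUP_least) auto
  qed
  ultimately show ?thesis
    by (auto simp: outer_measure_space_def positive_def increasing_def countably_subadditive_def)
qed

text \<open>A set of diameter below \<open>\<eta>\<close> cannot meet both \<open>A\<close> and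
  \<open>B\<close>, so a fine cover of the union splits into a cover of \<open>A\<close> and a cover
  of \<open>B\<close>.\<close>

lemma hausdorff_outer_separated:
  fixes A B :: "'a::metric_space set"
  assumes n: "n > 0" and \<eta>: "\<eta> > 0" and sep: "\<And>x y. x \<in> A \<Longrightarrow> y \<in> B \<Longrightarrow> \<eta> \<le> dist x y"
  shows "hausdorff_outer n A + hausdorff_outer n B \<le> hausdorff_outer n (A \<union> B)"
proof -
  have pre: "hausdorff_pre n \<delta> A + hausdorff_pre n \<delta> B \<le> hausdorff_pre n \<delta> (A \<union> B)"
    if \<delta>: "0 < \<delta>" "\<delta> < \<eta>" for \<delta>
    unfolding hausdorff_pre_def[of n \<delta> "A \<union> B"]
  proof (rule INF_greatest)
    fix C :: "nat \<Rightarrow> 'a set"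
    assume "C \<in> {C. A \<union> B \<subseteq> (\<Union>i. C i) \<and> (\<forall>i. bounded (C i) \<and> diameter (C i) \<le> \<delta>)}"
    then have C: "A \<union> B \<subseteq> (\<Union>i. C i)" "\<And>i. bounded (C i)" "\<And>i. diameter (C i) \<le> \<delta>" by auto
    \<comment> \<open>Members that miss \<open>X\<close> become empty instead of being dropped; this
      keeps the indexing by naturals, and the empty set has gauge 0 because
      \<open>n > 0\<close>.\<close>
    define P where "P X i = (if C i \<inter> X = {} then {} else C i)" for X i
    have P: "hausdorff_pre n \<delta> X \<le> (\<Sum>i. hausdorff_gauge n (P X i))" if "X \<subseteq> A \<union> B" for X
    proof (rule hausdorff_pre_le)
      show "X \<subseteq> (\<Union>i. P X i)"
      proof
        fix x assume "x \<in> X"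
        moreover from this obtain i where "x \<in> C i" using C(1) \<open>X \<subseteq> A \<union> B\<close> by blast
        ultimately show "x \<in> (\<Union>i. P X i)" by (intro UN_I[of i]) (auto simp: P_def)
      qed
    qed (use C \<delta> in \<open>auto simp: P_def\<close>)
    have "hausdorff_gauge n (P A i) + hausdorff_gauge n (P B i) \<le> hausdorff_gauge n (C i)" for i
    proof -
      have "C i \<inter> A = {} \<or> C i \<inter> B = {}"
      proof (rule ccontr)
        assume "\<not> ?thesis"
        then obtain x y where xy: "x \<in> C i" "x \<in> A" "y \<in> C i" "y \<in> B" by auto
        then have "dist x y \<le> \<delta>"
          using diameter_bounded_bound[OF C(2)] C(3) order_trans by blast
        then show False using sep[OF xy(2,4)] \<delta> by simp
      qed
      then show ?thesis using n by (auto simp: P_def zero_power)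
    qed
    then have "(\<Sum>i. hausdorff_gauge n (P A i) + hausdorff_gauge n (P B i)) \<le> (\<Sum>i. hausdorff_gauge n (C i))"
      by (intro suminf_le summableI)
    moreover have "hausdorff_pre n \<delta> A + hausdorff_pre n \<delta> B
        \<le> (\<Sum>i. hausdorff_gauge n (P A i)) + (\<Sum>i. hausdorff_gauge n (P B i))"
      by (intro add_mono P) auto
    ultimately show "hausdorff_pre n \<delta> A + hausdorff_pre n \<delta> B \<le> (\<Sum>i. hausdorff_gauge n (C i))"
      unfolding suminf_add[OF summableI summableI] by (rule order_trans[rotated])
  qed
  show ?thesis
    unfolding hausdorff_outer_def[of n A] hausdorff_outer_def[of n B]
  proof -
    \<comment> \<open>The two suprema range over their scales independently; both scales are refined
      to a common one below \<open>\<eta>\<close>.\<close>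
    have "hausdorff_pre n \<delta>1 A + hausdorff_pre n \<delta>2 B \<le> hausdorff_outer n (A \<union> B)"
      if "\<delta>1 > 0" "\<delta>2 > 0" for \<delta>1 \<delta>2
    proof -
      define \<delta> where "\<delta> = min (min \<delta>1 \<delta>2) (\<eta> / 2)"
      have \<delta>: "0 < \<delta>" "\<delta> < \<eta>" "\<delta> \<le> \<delta>1" "\<delta> \<le> \<delta>2" using that \<eta> by (auto simp: \<delta>_def)
      have "hausdorff_pre n \<delta>1 A + hausdorff_pre n \<delta>2 B \<le> hausdorff_pre n \<delta> A + hausdorff_pre n \<delta> B"
        by (intro add_mono hausdorff_pre_antimono \<delta>)
      also have "\<dots> \<le> hausdorff_pre n \<delta> (A \<union> B)" by (rule pre[OF \<delta>(1,2)])
      also have "\<dots> \<le> hausdorff_outer n (A \<union> B)" by (rule hausdorff_pre_le_outer[OF \<delta>(1)])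
      finally show ?thesis .
    qed
    then show "(SUP \<delta>\<in>{0<..}. hausdorff_pre n \<delta> A) + (SUP \<delta>\<in>{0<..}. hausdorff_pre n \<delta> B)
        \<le> hausdorff_outer n (A \<union> B)"
    proof -
      assume *: "\<And>\<delta>1 \<delta>2. \<lbrakk>\<delta>1 > 0; \<delta>2 > 0\<rbrakk> \<Longrightarrow>
        hausdorff_pre n \<delta>1 A + hausdorff_pre n \<delta>2 B \<le> hausdorff_outer n (A \<union> B)"
      have "hausdorff_pre n \<delta>1 A + (SUP \<delta>\<in>{0<..}. hausdorff_pre n \<delta> B) \<le> hausdorff_outer n (A \<union> B)"
        if "\<delta>1 > 0" for \<delta>1
        by (subst ennreal_SUP_add_right) (use * that in \<open>auto intro!: SUP_least\<close>)
      then show ?thesis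
        by (subst ennreal_SUP_add_left[symmetric]) (auto intro!: SUP_least)
    qed
  qed
qed

text \<open>\<open>measure_of\<close> yields the zero measure unless the given function is a measure
  on the generated algebra. This lemma is therefore what gives \<open>hausdorff_measure\<close> its
  intended values.\<close>

lemma measure_space_hausdorff:
  assumes "n > 0"
  shows "measure_space UNIV (sets borel) (hausdorff_outer n :: 'a::metric_space set \<Rightarrow> ennreal)"
proof -
  let ?\<mu> = "hausdorff_outer n :: 'a set \<Rightarrow> ennreal"
  interpret sigma_algebra UNIV "UNIV :: 'a set set"
    using sigma_algebra_Pow[of "UNIV :: 'a set"] by simp
  have ms: "measure_space UNIV (lambda_system UNIV UNIV ?\<mu>) ?\<mu>"
    by (rule caratheodory_lemma[OF outer_measure_space_hausdorff[OF assms]])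
  moreover have "sets borel \<subseteq> lambda_system UNIV UNIV ?\<mu>"
  proof -
    interpret L: sigma_algebra UNIV "lambda_system UNIV UNIV ?\<mu>"
      using ms by (simp add: measure_space_def)
    have "{F :: 'a set. closed F} \<subseteq> lambda_system UNIV UNIV ?\<mu>"
    proof (rule subsetI, drule CollectD)
      fix F :: "'a set" assume "closed F"
      then show "F \<in> lambda_system UNIV UNIV ?\<mu>"
        by (rule closed_in_lambda_system[OF outer_measure_space_hausdorff[OF assms], rotated])
           (rule hausdorff_outer_separated[OF assms])
    qed
    then show ?thesis
      by (simp add: borel_eq_closed L.sigma_sets_subset)
  qed
  ultimately show ?thesis
    by (intro measure_down[of UNIV _ _ "sets borel"]) (use sets.sigma_algebra_axioms[of borel] in simp_all)
qed

lemma sets_hausdorff_measure [simp, measurable_cong]: "sets (hausdorff_measure n) = sets borel"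
  using sets.sigma_sets_eq[of borel] by (simp add: hausdorff_measure_def)

lemma space_hausdorff_measure [simp]: "space (hausdorff_measure n) = UNIV"
  by (simp add: hausdorff_measure_def)

lemma emeasure_hausdorff_measure:
  fixes A :: "'a::metric_space set"
  assumes "n > 0" "A \<in> sets borel"
  shows "emeasure (hausdorff_measure n) A = hausdorff_outer n A"
  unfolding hausdorff_measure_def
  using measure_space_hausdorff[OF assms(1), where ?'a = 'a] assms(2)
  by (subst emeasure_measure_of_sigma) (auto simp: measure_space_def)

section \<open>Hausdorff measure on a plane\<close>

text \<open>The one-dimensional estimate behind Steiner symmetrization. \<open>P\<close> and
  \<open>Q\<close> lie between their infima and suprema, and the extreme cross distances
  \<open>Sup P - Inf Q\<close> and \<open>Sup Q - Inf P\<close> add up to the lengths of these two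
  intervals.\<close>

lemma measure_sum_le_of_dist_le:
  fixes P Q :: "real set"
  assumes P: "P \<in> sets borel" "P \<noteq> {}" and Q: "Q \<in> sets borel" "Q \<noteq> {}"
    and e: "\<And>a b. a \<in> P \<Longrightarrow> b \<in> Q \<Longrightarrow> \<bar>a - b\<bar> \<le> e"
  shows "measure lborel P + measure lborel Q \<le> 2 * e"
proof -
  obtain a b where ab: "a \<in> P" "b \<in> Q" using P Q by auto
  have bdd: "bdd_above P" "bdd_below P" "bdd_above Q" "bdd_below Q"
  proof -
    have "P \<subseteq> {b - e..b + e}" "Q \<subseteq> {a - e..a + e}"
      using e[OF ab(1)] e[OF _ ab(2)] by (force simp: abs_le_iff)+
    then show "bdd_above P" "bdd_below P" "bdd_above Q" "bdd_below Q"
      by (meson bdd_above_mono bdd_below_mono bdd_above_Icc bdd_below_Icc)+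
  qed
  have meas: "measure lborel X \<le> Sup X - Inf X" if "X \<noteq> {}" "bdd_above X" "bdd_below X" for X :: "real set"
  proof -
    have "Inf X \<le> Sup X" using that by (meson cInf_lower cSup_upper ex_in_conv order_trans)
    moreover have "X \<subseteq> {Inf X..Sup X}" using that by (auto intro: cInf_lower cSup_upper)
    then have "emeasure lborel X \<le> emeasure lborel {Inf X..Sup X}"
      by (rule emeasure_mono) simp
    ultimately show ?thesis
      by (simp add: measure_def enn2real_leI)
  qed
  have "Sup P - Inf Q \<le> e"
  proof -
    have "Sup P \<le> y + e" if "y \<in> Q" for y
      using e[OF _ that] P(2) by (intro cSup_least) (auto simp: abs_le_iff, smt (verit))
    then have "Sup P - e \<le> Inf Q" using Q(2) by (intro cInf_greatest) (auto simp: algebra_simps)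
    then show ?thesis by simp
  qed
  moreover have "Sup Q - Inf P \<le> e"
  proof -
    have "Sup Q \<le> x + e" if "x \<in> P" for x
      using e[OF that] Q(2) by (intro cSup_least) (auto simp: abs_le_iff, smt (verit))
    then have "Sup Q - e \<le> Inf P" using P(2) by (intro cInf_greatest) (auto simp: algebra_simps)
    then show ?thesis by simp
  qed
  ultimately show ?thesis using meas[OF P(2) bdd(1,2)] meas[OF Q(2) bdd(3,4)] by linarith
qed

text \<open>Steiner symmetrization about the horizontal axis: every vertical slice becomes a centred
  interval of the same length. The strict inequality removes null slices, so a point of
  \<open>steiner A\<close> always lies over a nonempty slice of \<open>A\<close>.\<close>

definition steiner :: "(real \<times> real) set \<Rightarrow> (real \<times> real) set" where
  "steiner A = {(x, y). 2 * \<bar>y\<bar> < measure lborel (Pair x -` A)}"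

text \<open>The measure is preserved by Fubini. For the diameter, two slices over \<open>x\<close>
  and \<open>x'\<close> have cross distances at most
  \<open>sqrt (d\<^sup>2 - (x - x')\<^sup>2)\<close>, and the one-dimensional estimate carries this
  bound over to the centred intervals.\<close>

lemma
  fixes A :: "(real \<times> real) set"
  assumes A: "A \<in> sets borel" and d: "\<And>p q. p \<in> A \<Longrightarrow> q \<in> A \<Longrightarrow> dist p q \<le> d"
  shows sets_steiner: "steiner A \<in> sets borel"
    and emeasure_steiner: "emeasure lborel (steiner A) = emeasure lborel A"
    and dist_steiner: "p \<in> steiner A \<Longrightarrow> q \<in> steiner A \<Longrightarrow> dist p q \<le> d"
proof -
  have A2: "A \<in> sets (lborel \<Otimes>\<^sub>M lborel)" using A unfolding lborel_prod by simp
  have slice: "Pair x -` A \<in> sets borel" for x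
    using sets_Pair1[OF A2, of x] by simp
  have ddiff: "\<bar>a - b\<bar> \<le> d" if "a \<in> Pair x -` A" "b \<in> Pair x -` A" for a b x
    using d[of "(x, a)" "(x, b)"] that by (auto simp: dist_Pair_Pair dist_real_def)
  \<comment> \<open>\<open>measure\<close> is 0 on sets of infinite measure, so the slices have to
    be known to be finite; they are, by the bound on distances.\<close>
  have fin: "emeasure lborel (Pair x -` A) = ennreal (measure lborel (Pair x -` A))" for x
  proof (cases "Pair x -` A = {}")
    case False
    then obtain a where a: "a \<in> Pair x -` A" by blast
    have "Pair x -` A \<subseteq> {a - d..a + d}"
      using ddiff[OF a] by (auto simp: abs_le_iff) (smt (verit))+
    then have "emeasure lborel (Pair x -` A) \<le> emeasure lborel {a - d..a + d}"
      by (rule emeasure_mono) simp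
    also have "\<dots> < \<infinity>" by (simp add: emeasure_lborel_Icc_eq)
    finally show ?thesis by (intro emeasure_eq_ennreal_measure) auto
  qed simp
  have [measurable]: "(\<lambda>x. measure lborel (Pair x -` A)) \<in> borel_measurable borel"
    using lborel.measurable_emeasure_Pair[OF A2] by (simp add: measure_def)
  show S: "steiner A \<in> sets borel"
  proof -
    have "(\<lambda>z. measure lborel (Pair (fst z) -` A)) \<in> borel_measurable (borel :: (real \<times> real) measure)"
      by (rule measurable_compose[of fst, OF borel_measurable_continuous_onI]) (auto intro: continuous_intros)
    moreover have "(\<lambda>z. 2 * \<bar>snd z\<bar>) \<in> borel_measurable (borel :: (real \<times> real) measure)"
      by (intro borel_measurable_continuous_onI continuous_intros)
    ultimately have "{z \<in> space (borel :: (real \<times> real) measure). 2 * \<bar>snd z\<bar> < measure lborel (Pair (fst z) -` A)} \<in> sets borel"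
      by measurable
    then show ?thesis by (simp add: steiner_def case_prod_unfold)
  qed
  then have S2: "steiner A \<in> sets (lborel \<Otimes>\<^sub>M lborel)" unfolding lborel_prod by simp
  have "emeasure lborel (Pair x -` steiner A) = emeasure lborel (Pair x -` A)" for x
  proof -
    let ?m = "measure lborel (Pair x -` A)"
    have "Pair x -` steiner A = {- (?m / 2)<..<?m / 2}"
      by (auto simp: steiner_def abs_less_iff)
    then show ?thesis by (simp add: fin)
  qed
  then show "emeasure lborel (steiner A) = emeasure lborel A"
    using lborel.emeasure_pair_measure_alt[OF A2] lborel.emeasure_pair_measure_alt[OF S2]
    by (simp add: lborel_prod)
  show "dist p q \<le> d" if "p \<in> steiner A" "q \<in> steiner A"
  proof -
    obtain x y x' y' where pq: "p = (x, y)" "q = (x', y')" by (metis surj_pair)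
    let ?P = "Pair x -` A" and ?Q = "Pair x' -` A"
    have m: "2 * \<bar>y\<bar> < measure lborel ?P" "2 * \<bar>y'\<bar> < measure lborel ?Q"
      using that by (auto simp: steiner_def pq)
    then have ne: "?P \<noteq> {}" "?Q \<noteq> {}" by (auto intro: ccontr)
    define e where "e = sqrt (d\<^sup>2 - (x - x')\<^sup>2)"
    have le: "(x - x')\<^sup>2 + (a - b)\<^sup>2 \<le> d\<^sup>2" if "a \<in> ?P" "b \<in> ?Q" for a b
    proof -
      have "dist (x, a) (x', b) \<le> d" using that by (intro d) auto
      then have "(dist (x, a) (x', b))\<^sup>2 \<le> d\<^sup>2" by (rule power_mono) simp
      then show ?thesis by (simp add: dist_Pair_Pair dist_real_def)
    qed
    have "measure lborel ?P + measure lborel ?Q \<le> 2 * e"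
      using slice ne unfolding e_def
      by (intro measure_sum_le_of_dist_le real_le_rsqrt) (use le in \<open>auto simp: algebra_simps\<close>)
    then have "\<bar>y - y'\<bar> \<le> e" using m by linarith
    then have "(y - y')\<^sup>2 \<le> e\<^sup>2" by (metis abs_ge_zero power2_abs power_mono)
    moreover have "0 \<le> d\<^sup>2 - (x - x')\<^sup>2"
    proof -
      obtain a b where "a \<in> ?P" "b \<in> ?Q" using ne by blast
      from le[OF this] show ?thesis by (smt (verit) zero_le_power2)
    qed
    then have "e\<^sup>2 = d\<^sup>2 - (x - x')\<^sup>2" by (simp add: e_def)
    ultimately have "(x - x')\<^sup>2 + (y - y')\<^sup>2 \<le> d\<^sup>2" by simp
    moreover have "d \<ge> 0"
    proof -
      obtain a where "a \<in> ?P" using ne by blast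
      then show ?thesis using ddiff[of a x a] by simp
    qed
    ultimately show ?thesis by (simp add: pq dist_Pair_Pair dist_real_def real_le_lsqrt)
  qed
qed

lemma emeasure_lborel_swap:
  fixes A :: "(real \<times> real) set"
  assumes "A \<in> sets borel"
  shows "emeasure lborel (prod.swap -` A) = emeasure lborel A" "prod.swap -` A \<in> sets borel"
proof -
  have m: "prod.swap \<in> borel_measurable (borel :: (real \<times> real) measure)"
    by (intro borel_measurable_continuous_onI continuous_intros)
  then show "prod.swap -` A \<in> sets borel"
    using measurable_sets[OF m assms] by simp
  have "lborel = distr lborel lborel (prod.swap :: real \<times> real \<Rightarrow> _)"
    using lborel_pair.distr_pair_swap[where ?'a = real and ?'b = real]
    by (simp add: lborel_prod case_prod_unfold fun_eq_iff prod.swap_def[abs_def])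
  then have "emeasure lborel A = emeasure (distr lborel lborel prod.swap) A" by simp
  also have "\<dots> = emeasure lborel (prod.swap -` A)"
    using m assms by (subst emeasure_distr) auto
  finally show "emeasure lborel (prod.swap -` A) = emeasure lborel A" ..
qed

text \<open>After two Steiner symmetrizations the set is symmetric about the origin, so that it is
  contained in the ball of radius \<open>d / 2\<close>.\<close>
lemma isodiametric:
  fixes A :: "(real \<times> real) set"
  assumes A: "A \<in> sets borel" and d: "\<And>p q. p \<in> A \<Longrightarrow> q \<in> A \<Longrightarrow> dist p q \<le> d"
  shows "emeasure lborel A \<le> ennreal (unit_ball_vol 2 * (d / 2) ^ 2)"
proof (cases "A = {}")
  case False
  then have d0: "d \<ge> 0" using d by (metis all_not_in_conv dist_self)
  \<comment> \<open>The swap lets the second symmetrization act on the other coordinate.\<close>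
  define B where "B = prod.swap -` steiner A"
  define C where "C = steiner B"
  note S = sets_steiner[OF A d] emeasure_steiner[OF A d] dist_steiner[OF A d]
  have B: "B \<in> sets borel" "emeasure lborel B = emeasure lborel A"
    using emeasure_lborel_swap[OF S(1)] S(2) by (auto simp: B_def)
  have dB: "dist p q \<le> d" if "p \<in> B" "q \<in> B" for p q
    using that S(3)[of "prod.swap p" "prod.swap q"]
    by (simp add: B_def dist_prod_def add.commute)
  note T = sets_steiner[OF B(1) dB] emeasure_steiner[OF B(1) dB] dist_steiner[OF B(1) dB]
  \<comment> \<open>The symmetry gained in the first pass survives the second, because equal slices
    are replaced by equal intervals.\<close>
  have "Pair (- y) -` B = Pair y -` B" for y
    by (auto simp: B_def steiner_def)
  then have sym: "- p \<in> C" if "p \<in> C" for p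
    using that by (auto simp: C_def steiner_def)
  have "C \<subseteq> cball 0 (d / 2)"
  proof
    fix p assume p: "p \<in> C"
    then have "dist p (- p) \<le> d" using T(3) sym unfolding C_def by blast
    then have "norm (2 *\<^sub>R p) \<le> d" by (simp add: dist_norm scaleR_2)
    then show "p \<in> cball 0 (d / 2)" by simp
  qed
  then have "emeasure lborel C \<le> emeasure lborel (cball (0 :: real \<times> real) (d / 2))"
    by (rule emeasure_mono) simp
  also have "\<dots> = ennreal (unit_ball_vol 2 * (d / 2) ^ 2)"
    using d0 emeasure_cball[of "d / 2" "0 :: real \<times> real"] by (simp add: power2_eq_square)
  finally show ?thesis using T(2) B(2) by (simp add: C_def)
qed simp

section \<open>Comparison of Hausdorff and Lebesgue measure on the boundary plane\<close>

definition plane :: "real \<times> real \<Rightarrow> real ^ 3" where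
  "plane p = vector [fst p, snd p, 0]"

lemma dist_plane [simp]: "dist (plane p) (plane q) = dist p q"
  by (simp add: plane_def dist_vec_def L2_set_def sum_3 dist_prod_def)

lemma continuous_on_plane: "continuous_on S plane"
  unfolding continuous_on_iff by auto

lemma measurable_plane [measurable]: "plane \<in> borel_measurable borel"
  by (intro borel_measurable_continuous_onI continuous_on_plane)

lemma range_plane: "range plane = {x. x $ 3 = 0}"
proof -
  have "x = plane (x $ 1, x $ 2)" if "x $ 3 = 0" for x
    using that by (simp add: plane_def vec_eq_iff forall_3)
  moreover have "plane p $ 3 = 0" for p by (simp add: plane_def)
  ultimately show ?thesis by blast
qed

text \<open>Members of a cover are arbitrary sets. The closures of their preimages are Borel and
  have no larger diameter, so the isodiametric inequality bounds each of them by its gauge. This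
  works for every cover, hence any fixed scale, here 1, will do.\<close>

lemma emeasure_le_hausdorff_outer:
  assumes B: "B \<in> sets borel"
  shows "emeasure lborel B \<le> hausdorff_outer 2 (plane ` B)"
proof -
  have "emeasure lborel B \<le> hausdorff_pre 2 1 (plane ` B)"
    unfolding hausdorff_pre_def
  proof (rule INF_greatest, clarify)
    fix C :: "nat \<Rightarrow> (real ^ 3) set"
    assume C: "plane ` B \<subseteq> (\<Union>i. C i)" "\<forall>i. bounded (C i) \<and> diameter (C i) \<le> 1"
    define D where "D i = closure (plane -` C i)" for i
    have "dist p q \<le> diameter (C i)" if "p \<in> D i" "q \<in> D i" for p q i
    proof -
      have d: "dist p q \<le> diameter (C i)" if "p \<in> plane -` C i" "q \<in> plane -` C i" for p q
        using diameter_bounded_bound[of "C i" "plane p" "plane q"] C(2) that by auto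
      have b: "bounded (plane -` C i)"
        unfolding bounded_two_points by (intro exI[of _ "diameter (C i)"] ballI d)
      have "0 \<le> diameter (C i)" using C(2) by (simp add: diameter_ge_0)
      then have "diameter (plane -` C i) \<le> diameter (C i)"
        by (intro diameter_le disjI2) (simp_all add: d flip: dist_norm)
      moreover have "dist p q \<le> diameter (D i)"
        using b \<open>p \<in> D i\<close> \<open>q \<in> D i\<close> by (intro diameter_bounded_bound) (auto simp: D_def)
      ultimately show ?thesis using diameter_closure[OF b] by (simp add: D_def)
    qed
    then have "emeasure lborel (D i) \<le> ennreal (unit_ball_vol 2 * (diameter (C i) / 2) ^ 2)" for i
      by (intro isodiametric) (simp_all add: D_def)
    then have "(\<Sum>i. emeasure lborel (D i)) \<le> (\<Sum>i. hausdorff_gauge 2 (C i))"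
      by (intro suminf_le summableI) simp
    moreover have "emeasure lborel B \<le> (\<Sum>i. emeasure lborel (D i))"
    proof -
      have "B \<subseteq> (\<Union>i. plane -` C i)" using C(1) by blast
      also have "\<dots> \<subseteq> (\<Union>i. D i)" unfolding D_def by (rule UN_mono[OF subset_refl closure_subset])
      finally have "emeasure lborel B \<le> emeasure lborel (\<Union>i. D i)"
        by (rule emeasure_mono) (simp add: D_def)
      also have "\<dots> \<le> (\<Sum>i. emeasure lborel (D i))"
        by (rule emeasure_subadditive_countably) (simp add: D_def image_subset_iff)
      finally show ?thesis .
    qed
    ultimately show "emeasure lborel B \<le> (\<Sum>i. hausdorff_gauge 2 (C i))"
      by (rule order_trans[rotated])
  qed
  then show ?thesis by (rule order_trans) (rule hausdorff_pre_le_outer, simp)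
qed

text \<open>Disjoint balls, with a dilation factor \<open>l\<close>, so that one estimate serves
  both covering results: \<open>l = 5\<close> is the factor of Vitali's covering lemma, and
  \<open>l = 1\<close> fits the covering theorem, where disjoint balls already fill the set up to a
  null set.\<close>

lemma hausdorff_pre_plane_cballs:
  fixes a :: "'i \<Rightarrow> real \<times> real"
  assumes C: "countable C" and disj: "pairwise (\<lambda>i j. disjnt (cball (a i) (r i)) (cball (a j) (r j))) C"
    and r: "\<And>i. i \<in> C \<Longrightarrow> 0 \<le> r i \<and> 2 * l * r i \<le> \<delta>" and l: "l \<ge> 0" and \<delta>: "\<delta> > 0"
  shows "hausdorff_pre 2 \<delta> (plane ` (\<Union>i\<in>C. cball (a i) (l * r i)))
    \<le> ennreal (l ^ 2) * emeasure lborel (\<Union>i\<in>C. cball (a i) (r i))"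
proof -
  \<comment> \<open>The countable index set is re-indexed by naturals, with empty sets at the
    indices outside \<open>J\<close>.\<close>
  define J where "J = to_nat_on C ` C"
  define f where "f = from_nat_into C"
  have fJ: "f k \<in> C" "to_nat_on C (f k) = k" if "k \<in> J" for k
    using that C by (auto simp: J_def f_def)
  have CJ: "\<exists>k\<in>J. f k = i" if "i \<in> C" for i
    using that C by (auto simp: J_def f_def intro!: bexI[of _ "to_nat_on C i"])
  define E where "E k = (if k \<in> J then plane ` cball (a (f k)) (l * r (f k)) else {})" for k
  define E' where "E' k = (if k \<in> J then cball (a (f k)) (r (f k)) else {})" for k
  have E: "bounded (E k)" "diameter (E k) \<le> \<delta>"
     "hausdorff_gauge 2 (E k) \<le> ennreal (l ^ 2) * emeasure lborel (E' k)" for k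
  proof -
    show b: "bounded (E k)"
      by (auto simp: E_def intro!: compact_imp_bounded compact_continuous_image continuous_on_plane)
    show "diameter (E k) \<le> \<delta>" "hausdorff_gauge 2 (E k) \<le> ennreal (l ^ 2) * emeasure lborel (E' k)"
    proof (atomize (full), cases "k \<in> J")
      case True
      define R where "R = l * r (f k)"
      have R: "R \<ge> 0" "2 * R \<le> \<delta>" using r[OF fJ(1)[OF True]] l by (auto simp: R_def algebra_simps)
      have dE: "diameter (E k) \<le> 2 * R"
      proof (rule diameter_le)
        fix x y assume "x \<in> E k" "y \<in> E k"
        then obtain p q where "x = plane p" "y = plane q" "p \<in> cball (a (f k)) R" "q \<in> cball (a (f k)) R"
          using True by (auto simp: E_def R_def)
        then show "norm (x - y) \<le> 2 * R"
          using dist_triangle3[of p q "a (f k)"] by (simp flip: dist_norm)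
      qed (use R in simp)
      have "hausdorff_gauge 2 (E k) \<le> ennreal (unit_ball_vol 2 * R ^ 2)"
        using dE diameter_ge_0[OF b] by (intro ennreal_leI) (auto intro!: mult_left_mono power_mono)
      also have "\<dots> = ennreal (l ^ 2) * ennreal (unit_ball_vol 2 * r (f k) ^ 2)"
        unfolding R_def by (subst ennreal_mult''[symmetric]) (auto simp: power_mult_distrib mult_ac)
      also have "\<dots> = ennreal (l ^ 2) * emeasure lborel (E' k)"
        using True r[OF fJ(1)[OF True]] emeasure_cball[of "r (f k)" "a (f k)"] by (simp add: E'_def power2_eq_square)
      finally show "diameter (E k) \<le> \<delta> \<and> hausdorff_gauge 2 (E k) \<le> ennreal (l ^ 2) * emeasure lborel (E' k)"
        using dE R by simp
    qed (use \<delta> in \<open>simp add: E_def E'_def\<close>)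
  qed
  have "plane ` (\<Union>i\<in>C. cball (a i) (l * r i)) \<subseteq> (\<Union>k. E k)"
    using CJ unfolding E_def by (fastforce split: if_splits)
  then have "hausdorff_pre 2 \<delta> (plane ` (\<Union>i\<in>C. cball (a i) (l * r i))) \<le> (\<Sum>k. hausdorff_gauge 2 (E k))"
    by (rule hausdorff_pre_le) (rule E)+
  also have "\<dots> \<le> (\<Sum>k. ennreal (l ^ 2) * emeasure lborel (E' k))"
    by (intro suminf_le E summableI)
  also have "\<dots> = ennreal (l ^ 2) * (\<Sum>k. emeasure lborel (E' k))" by simp
  also have "(\<Sum>k. emeasure lborel (E' k)) = emeasure lborel (\<Union>k. E' k)"
  proof (rule suminf_emeasure)
    have "disjnt (E' j) (E' k)" if "j \<noteq> k" for j k
    proof (cases "j \<in> J \<and> k \<in> J")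
      case True
      then have "f j \<noteq> f k" using fJ(2) that by metis
      then show ?thesis using pairwiseD[OF disj] fJ(1) True by (simp add: E'_def)
    qed (auto simp: E'_def disjnt_def)
    then show "disjoint_family E'" by (auto simp: disjoint_family_on_def disjnt_def)
  qed (auto simp: E'_def)
  also have "(\<Union>k. E' k) = (\<Union>i\<in>C. cball (a i) (r i))"
    using CJ fJ unfolding E'_def by (fastforce split: if_splits)
  finally show ?thesis .
qed

lemma hausdorff_pre_Un:
  assumes "n > 0" "\<delta> > 0"
  shows "hausdorff_pre n \<delta> (A \<union> B) \<le> hausdorff_pre n \<delta> A + hausdorff_pre n \<delta> B"
  using hausdorff_pre_UN[of n \<delta> "binaryset A B"]
  unfolding UN_binaryset_eq
    sums_unique[OF binaryset_sums[of "hausdorff_pre n \<delta>" A B, OF hausdorff_pre_empty[OF assms]], symmetric]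
  by simp

text \<open>Takes care of the set that Vitali's covering theorem leaves over: it is Lebesgue null,
  which does not yet say anything about its Hausdorff measure.\<close>

lemma hausdorff_pre_plane_null:
  assumes N: "N \<in> sets borel" "emeasure lborel N = 0" and \<delta>: "\<delta> > 0"
  shows "hausdorff_pre 2 \<delta> (plane ` N) = 0"
proof -
  have le: "hausdorff_pre 2 \<delta> (plane ` N) \<le> ennreal e" if e: "e > 0" for e
  proof -
    \<comment> \<open>\<open>25 = 5 ^ 2\<close> is the factor by which the 5-fold dilation increases
      area; \<open>10 * r\<close> in \<open>K\<close> is the diameter of a dilated ball.\<close>
    obtain U where U: "open U" "N \<subseteq> U" "emeasure lborel (U - N) < ennreal (e / 25)"
      using outer_regular_lborel[OF N(1), of "e / 25"] e by auto
    have "emeasure lborel U \<le> emeasure lborel (U - N) + emeasure lborel N"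
      using emeasure_subadditive[of "U - N" lborel N] U N
      by (simp add: Un_absorb2)
    then have U': "emeasure lborel U \<le> ennreal (e / 25)" using U(3) N(2) by simp
    define K where "K = {(x, r). x \<in> N \<and> 0 < r \<and> cball x r \<subseteq> U \<and> 10 * r \<le> \<delta>}"
    have K: "0 < snd i" "cball (fst i) (snd i) \<subseteq> U" "10 * snd i \<le> \<delta>" if "i \<in> K" for i
      using that by (simp_all add: K_def case_prod_unfold)
    have NK: "N \<subseteq> (\<Union>i\<in>K. cball (fst i) (snd i))"
    proof
      fix x assume x: "x \<in> N"
      then obtain \<rho> where \<rho>: "\<rho> > 0" "cball x \<rho> \<subseteq> U" using U open_contains_cball by blast
      have "cball x (min \<rho> (\<delta> / 10)) \<subseteq> U" using \<rho> by (meson min.cobounded1 order_trans subset_cball)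
      then have "(x, min \<rho> (\<delta> / 10)) \<in> K" using x \<rho> \<delta> by (simp add: K_def)
      moreover have "x \<in> cball x (min \<rho> (\<delta> / 10))" using \<rho> \<delta> by simp
      ultimately show "x \<in> (\<Union>i\<in>K. cball (fst i) (snd i))" by (intro UN_I[of "(x, min \<rho> (\<delta> / 10))"]) simp_all
    qed
    have rK: "0 < snd i \<and> snd i \<le> \<delta>" if "i \<in> K" for i using K[OF that] by simp
    obtain C where C: "countable C" "C \<subseteq> K"
      "pairwise (\<lambda>i j. disjnt (cball (fst i) (snd i)) (cball (fst j) (snd j))) C"
      "N \<subseteq> (\<Union>i\<in>C. cball (fst i) (5 * snd i))"
      by (rule Vitali_covering_lemma_cballs[OF NK rK])
    have CK: "0 < snd i" "cball (fst i) (snd i) \<subseteq> U" "10 * snd i \<le> \<delta>" if "i \<in> C" for i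
      using K[of i] C(2) that by auto
    have "hausdorff_pre 2 \<delta> (plane ` N) \<le> hausdorff_pre 2 \<delta> (plane ` (\<Union>i\<in>C. cball (fst i) (5 * snd i)))"
      using C(4) by (intro hausdorff_pre_mono image_mono)
    also have "\<dots> \<le> ennreal (5 ^ 2) * emeasure lborel (\<Union>i\<in>C. cball (fst i) (snd i))"
      by (rule hausdorff_pre_plane_cballs[OF C(1,3)]) (use CK \<delta> in \<open>auto intro: less_imp_le\<close>)
    also have "\<dots> \<le> ennreal 25 * emeasure lborel U"
    proof (intro mult_mono emeasure_mono)
      show "(\<Union>i\<in>C. cball (fst i) (snd i)) \<subseteq> U" using CK(2) by (rule UN_least)
    qed (use U in auto)
    also have "\<dots> \<le> ennreal 25 * ennreal (e / 25)" using U' by (intro mult_left_mono) auto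
    also have "\<dots> = ennreal e" by (subst ennreal_mult''[symmetric]) (use e in auto)
    finally show ?thesis .
  qed
  have "hausdorff_pre 2 \<delta> (plane ` N) \<le> 0"
    by (rule ennreal_le_epsilon) (simp add: le)
  then show ?thesis by simp
qed

text \<open>Small disjoint balls fill \<open>G\<close> up to a null set, and a ball has gauge equal
  to its area: it is the case of equality in the isodiametric inequality. So no constant is
  lost.\<close>

lemma hausdorff_pre_plane_open:
  assumes G: "open G" and \<delta>: "\<delta> > 0"
  shows "hausdorff_pre 2 \<delta> (plane ` G) \<le> emeasure lborel G"
proof -
  define K where "K = {(x, r). 0 < r \<and> cball x r \<subseteq> G \<and> 2 * r \<le> \<delta>}"
  have K: "0 < snd i" "cball (fst i) (snd i) \<subseteq> G" "2 * snd i \<le> \<delta>" if "i \<in> K" for i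
    using that by (simp_all add: K_def case_prod_unfold)
  have GK: "\<exists>i. i \<in> K \<and> x \<in> cball (fst i) (snd i) \<and> snd i < d" if x: "x \<in> G" "d > 0" for x d
  proof -
    obtain \<rho> where \<rho>: "\<rho> > 0" "cball x \<rho> \<subseteq> G" using G x(1) open_contains_cball by blast
    define r where "r = min \<rho> (min (\<delta> / 2) (d / 2))"
    have r: "0 < r" "r \<le> \<rho>" "2 * r \<le> \<delta>" "r < d" using \<rho> \<delta> x by (auto simp: r_def)
    have "cball x r \<subseteq> G" using \<rho>(2) r(2) by (meson order_trans subset_cball)
    then have "(x, r) \<in> K" using r by (simp add: K_def)
    then show ?thesis using r by (intro exI[of _ "(x, r)"]) simp
  qed
  obtain C where C: "countable C" "C \<subseteq> K"
      "pairwise (\<lambda>i j. disjnt (cball (fst i) (snd i)) (cball (fst j) (snd j))) C"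
      "negligible (G - (\<Union>i\<in>C. cball (fst i) (snd i)))"
    by (rule Vitali_covering_theorem_cballs[OF K(1) GK])
  have CK: "0 < snd i" "cball (fst i) (snd i) \<subseteq> G" "2 * snd i \<le> \<delta>" if "i \<in> C" for i
    using K[of i] C(2) that by auto
  let ?V = "\<Union>i\<in>C. cball (fst i) (snd i)"
  have V: "?V \<in> sets borel" using C(1) by (intro sets.countable_UN') auto
  have "emeasure lborel (G - ?V) = 0"
    using C(4) V G by (simp add: negligible_iff_null_sets null_sets_completion_iff null_sets_def)
  have "hausdorff_pre 2 \<delta> (plane ` G) \<le> hausdorff_pre 2 \<delta> (plane ` ?V \<union> plane ` (G - ?V))"
    by (intro hausdorff_pre_mono) auto
  also have "\<dots> \<le> hausdorff_pre 2 \<delta> (plane ` ?V) + hausdorff_pre 2 \<delta> (plane ` (G - ?V))"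
    using \<delta> by (intro hausdorff_pre_Un) auto
  also have "hausdorff_pre 2 \<delta> (plane ` (G - ?V)) = 0"
    using \<open>emeasure lborel (G - ?V) = 0\<close> V G \<delta> by (intro hausdorff_pre_plane_null) auto
  also have "hausdorff_pre 2 \<delta> (plane ` ?V) \<le> emeasure lborel ?V"
    using hausdorff_pre_plane_cballs[of C fst snd 1 \<delta>, OF C(1,3)] CK \<delta> by (simp add: less_imp_le)
  also have "emeasure lborel ?V \<le> emeasure lborel G"
  proof (rule emeasure_mono)
    show "?V \<subseteq> G" using CK(2) by (rule UN_least)
  qed (use G in auto)
  finally show ?thesis by simp
qed

lemma hausdorff_outer_plane:
  assumes B: "B \<in> sets borel"
  shows "hausdorff_outer 2 (plane ` B) = emeasure lborel B"
proof (rule antisym)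
  have "hausdorff_pre 2 \<delta> (plane ` B) \<le> emeasure lborel B" if \<delta>: "\<delta> > 0" for \<delta>
  proof (rule ennreal_le_epsilon)
    fix e :: real assume "e > 0"
    then obtain U where U: "open U" "B \<subseteq> U" "emeasure lborel (U - B) < ennreal e"
      using outer_regular_lborel[OF B] by auto
    have "hausdorff_pre 2 \<delta> (plane ` B) \<le> hausdorff_pre 2 \<delta> (plane ` U)"
      using U by (intro hausdorff_pre_mono image_mono)
    also have "\<dots> \<le> emeasure lborel U" by (rule hausdorff_pre_plane_open[OF U(1) \<delta>])
    also have "\<dots> \<le> emeasure lborel B + emeasure lborel (U - B)"
      using emeasure_subadditive[of B lborel "U - B"] U B by (simp add: Un_absorb1)
    also have "\<dots> \<le> emeasure lborel B + ennreal e" using U(3) by (intro add_left_mono) simp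
    finally show "hausdorff_pre 2 \<delta> (plane ` B) \<le> emeasure lborel B + ennreal e" .
  qed
  then show "hausdorff_outer 2 (plane ` B) \<le> emeasure lborel B"
    unfolding hausdorff_outer_def by (intro SUP_least) auto
qed (rule emeasure_le_hausdorff_outer[OF B])

section \<open>Surface measure of the half-space\<close>

lemma frontier_halfspace: "frontier {x :: real ^ 3. x $ 3 > 0} = range plane"
proof -
  have e: "x $ 3 = axis 3 1 \<bullet> x" for x :: "real ^ 3"
    by (simp add: inner_axis' )
  have "axis 3 1 \<noteq> (0 :: real ^ 3)" by (simp add: axis_eq_0_iff)
  then show ?thesis
    using frontier_halfspace_gt[of "axis 3 1 :: real ^ 3" 0] by (simp add: range_plane e)
qed

text \<open>Turns every integral over the boundary into a Lebesgue integral over the plane.\<close>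

lemma surface_measure_halfspace:
  "surface_measure {x :: real ^ 3. x $ 3 > 0} = distr lborel (restrict_space borel (range plane)) plane"
  unfolding surface_measure_def frontier_halfspace
proof (rule measure_eqI)
  let ?H = "restrict_space (hausdorff_measure (DIM(real ^ 3) - 1)) (range plane) :: (real ^ 3) measure"
  let ?D = "distr lborel (restrict_space borel (range plane)) plane"
  have cl: "range plane \<in> sets borel"
    unfolding range_plane by measurable
  show "sets ?H = sets ?D" by (simp add: sets_restrict_space)
  fix A assume "A \<in> sets ?H"
  then have A: "A \<subseteq> range plane" "A \<in> sets borel"
    using cl by (auto simp: sets_restrict_space)
  have mp: "plane \<in> lborel \<rightarrow>\<^sub>M restrict_space borel (range plane)"
    by (auto intro!: measurable_restrict_space2)
  have "emeasure ?H A = hausdorff_outer 2 A"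
    using A cl by (subst emeasure_restrict_space) (auto simp: emeasure_hausdorff_measure)
  also have "hausdorff_outer 2 A = hausdorff_outer 2 (plane ` (plane -` A))"
    using A by (simp add: image_vimage_eq Int_absorb2)
  also have "\<dots> = emeasure lborel (plane -` A)"
    using measurable_sets[OF measurable_plane A(2)] by (intro hausdorff_outer_plane) simp
  also have "\<dots> = emeasure ?D A"
    using A cl mp by (subst emeasure_distr) (auto simp: sets_restrict_space)
  finally show "emeasure ?H A = emeasure ?D A" .
qed

section \<open>Measure-preserving coordinates and shears\<close>

lemma borel_measurable_fst_snd [measurable]:
  fixes f :: "'c \<Rightarrow> 'a::second_countable_topology \<times> 'b::second_countable_topology"
  assumes "f \<in> borel_measurable M"
  shows "(\<lambda>x. fst (f x)) \<in> borel_measurable M" "(\<lambda>x. snd (f x)) \<in> borel_measurable M"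
  using measurable_compose[OF assms[folded borel_prod] measurable_fst]
    measurable_compose[OF assms[folded borel_prod] measurable_snd] by simp_all

declare borel_measurable_Pair [measurable (raw)]

text \<open>Covers permutations of coordinates, also between differently nested product types. The
  preimage of a box is a box with the same side lengths in another order.\<close>

lemma lborel_distr_Basis:
  fixes F :: "'a::euclidean_space \<Rightarrow> 'b::euclidean_space"
  assumes lin: "linear F" and bij: "bij_betw F Basis Basis"
  shows "distr lborel borel F = lborel"
proof (rule lborel_eqI[symmetric])
  have F[measurable]: "F \<in> borel_measurable borel"
    using lin by (intro borel_measurable_continuous_onI linear_continuous_on linear_conv_bounded_linear[THEN iffD1])
  have inner: "F x \<bullet> F b = x \<bullet> b" if b: "b \<in> Basis" for x b
  proof -
    have "F x = F (\<Sum>b'\<in>Basis. (x \<bullet> b') *\<^sub>R b')" by (simp add: euclidean_representation)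
    also have "\<dots> = (\<Sum>b'\<in>Basis. (x \<bullet> b') *\<^sub>R F b')"
      by (simp add: linear_sum[OF lin] linear_scale[OF lin])
    finally have "F x \<bullet> F b = (\<Sum>b'\<in>Basis. (x \<bullet> b') * (F b' \<bullet> F b))"
      by (simp add: inner_sum_left)
    also have "\<dots> = (\<Sum>b'\<in>Basis. if b' = b then x \<bullet> b else 0)"
    proof (rule sum.cong)
      fix b' :: 'a assume b': "b' \<in> Basis"
      have "F b' \<in> Basis" "F b \<in> Basis" "F b' = F b \<longleftrightarrow> b' = b"
        using bij b b' by (auto simp: bij_betw_def inj_on_def)
      then show "(x \<bullet> b') * (F b' \<bullet> F b) = (if b' = b then x \<bullet> b else 0)"
        by (auto simp: inner_Basis)
    qed simp
    finally show ?thesis using b by simp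
  qed
  fix l u :: 'b assume lu: "\<And>b. b \<in> Basis \<Longrightarrow> l \<bullet> b \<le> u \<bullet> b"
  define pull where "pull y = (\<Sum>b\<in>Basis. (y \<bullet> F b) *\<^sub>R b)" for y :: 'b
  have pull: "pull y \<bullet> b = y \<bullet> F b" if "b \<in> Basis" for y b
    using that by (simp add: pull_def)
  have img: "F ` Basis = Basis" using bij by (simp add: bij_betw_def)
  have "F -` box l u = box (pull l) (pull u)"
  proof (rule set_eqI)
    fix x
    have "x \<in> F -` box l u \<longleftrightarrow> (\<forall>b\<in>F ` Basis. l \<bullet> b < F x \<bullet> b \<and> F x \<bullet> b < u \<bullet> b)"
      by (simp add: mem_box img)
    also have "\<dots> \<longleftrightarrow> x \<in> box (pull l) (pull u)" by (simp add: mem_box inner pull)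
    finally show "x \<in> F -` box l u \<longleftrightarrow> x \<in> box (pull l) (pull u)" .
  qed
  then have "emeasure (distr lborel borel F) (box l u) = emeasure lborel (box (pull l) (pull u))"
    by (simp add: emeasure_distr)
  also have "\<dots> = (\<Prod>b\<in>Basis. (pull u - pull l) \<bullet> b)"
    using lu img by (intro emeasure_lborel_box) (auto simp: pull)
  also have "\<dots> = (\<Prod>b\<in>Basis. (u - l) \<bullet> F b)"
    by (intro arg_cong[where f = ennreal] prod.cong) (auto simp: pull inner_diff_left)
  also have "\<dots> = (\<Prod>b\<in>Basis. (u - l) \<bullet> b)"
    using prod.reindex_bij_betw[OF bij, of "\<lambda>b. (u - l) \<bullet> b"] by simp
  finally show "emeasure (distr lborel borel F) (box l u) = (\<Prod>b\<in>Basis. (u - l) \<bullet> b)" .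
qed simp

text \<open>Fubini, and translation invariance on each fibre. Measurability of \<open>a\<close> is
  enough, so shears with a discontinuous speed are included.\<close>

lemma lborel_distr_shear:
  fixes a :: "'a::euclidean_space \<Rightarrow> 'b::euclidean_space"
  assumes a[measurable]: "a \<in> borel_measurable borel"
  shows "distr lborel borel (\<lambda>z. (fst z, snd z + a (fst z))) = (lborel :: ('a \<times> 'b) measure)"
proof (rule measure_eqI)
  let ?S = "\<lambda>z. (fst z, snd z + a (fst z)) :: 'a \<times> 'b"
  have S[measurable]: "?S \<in> borel_measurable borel"
    by measurable
  fix A assume "A \<in> sets (distr lborel borel ?S)"
  then have A: "A \<in> sets borel" by simp
  then have A2: "A \<in> sets (lborel \<Otimes>\<^sub>M lborel)" unfolding lborel_prod by simp
  have SA: "?S -` A \<in> sets (lborel \<Otimes>\<^sub>M lborel)"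
    using measurable_sets[OF S A] unfolding lborel_prod by simp
  have "emeasure (distr lborel borel ?S) A = emeasure (lborel \<Otimes>\<^sub>M lborel) (?S -` A)"
    using A unfolding lborel_prod by (simp add: emeasure_distr)
  also have "\<dots> = (\<integral>\<^sup>+ x. emeasure lborel (Pair x -` ?S -` A) \<partial>lborel)"
    by (rule lborel.emeasure_pair_measure_alt[OF SA])
  also have "\<dots> = (\<integral>\<^sup>+ x. emeasure lborel (Pair x -` A) \<partial>lborel)"
  proof (rule nn_integral_cong)
    fix x :: 'a
    have m: "Pair x -` A \<in> sets borel" using sets_Pair1[OF A2, of x] by simp
    have "emeasure lborel (Pair x -` A) = emeasure (distr lborel borel ((+) (a x))) (Pair x -` A)"
      by (simp add: lborel_distr_plus)
    also have "\<dots> = emeasure lborel ((+) (a x) -` Pair x -` A)"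
      using m by (simp add: emeasure_distr)
    also have "(+) (a x) -` Pair x -` A = Pair x -` ?S -` A" by (auto simp: add.commute)
    finally show "emeasure lborel (Pair x -` ?S -` A) = emeasure lborel (Pair x -` A)" ..
  qed
  also have "\<dots> = emeasure (lborel \<Otimes>\<^sub>M lborel) A"
    by (rule lborel.emeasure_pair_measure_alt[OF A2, symmetric])
  finally show "emeasure (distr lborel borel ?S) A = emeasure lborel A" by (simp add: lborel_prod)
qed simp

lemma integral_lborel_preserving:
  fixes f :: "'b::euclidean_space \<Rightarrow> real" and F :: "'a::euclidean_space \<Rightarrow> 'b"
  assumes "distr lborel borel F = lborel" "F \<in> borel_measurable borel" "f \<in> borel_measurable borel"
  shows "(\<integral>x. f (F x) \<partial>lborel) = (\<integral>y. f y \<partial>lborel)"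
    and "integrable lborel (\<lambda>x. f (F x)) \<longleftrightarrow> integrable lborel f"
  using integral_distr[of F lborel borel f] integrable_distr_eq[of F lborel borel f] assms by auto

lemma integrable_bounded_support:
  fixes f :: "'a::euclidean_space \<Rightarrow> real"
  assumes "f \<in> borel_measurable borel" "\<And>x. \<bar>f x\<bar> \<le> C" "\<And>x. norm x > M \<Longrightarrow> f x = 0"
  shows "integrable lborel f"
proof (rule Bochner_Integration.integrable_bound)
  have "integrable lborel (indicator (cball 0 M) :: 'a \<Rightarrow> real)"
    by (rule integrable_real_indicator) (simp, rule emeasure_bounded_finite, simp)
  then show "integrable lborel (\<lambda>x :: 'a. C * indicator (cball 0 M) x)"
    by simp
  show "AE x in lborel. norm (f x) \<le> norm (C * indicator (cball 0 M) x)"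
  proof (rule AE_I2)
    fix x show "norm (f x) \<le> norm (C * indicator (cball 0 M) x)"
    proof (cases "norm x > M")
      case False
      then show ?thesis using assms(2)[of x] by (simp add: indicator_def)
    qed (simp add: assms(3))
  qed
qed (use assms in simp)

text \<open>The gauge integral supplies the value, boundedness of \<open>g'\<close> the Lebesgue
  integrability. The interval is half-open because layers and grid cells have to tile the
  line.\<close>

lemma integral_FTC_Ico:
  fixes g g' :: "real \<Rightarrow> real"
  assumes ab: "a \<le> b" and g': "g' \<in> borel_measurable borel" "\<And>x. \<bar>g' x\<bar> \<le> C"
    and der: "\<And>x. a \<le> x \<Longrightarrow> x \<le> b \<Longrightarrow> (g has_real_derivative g' x) (at x)"
  shows "(\<integral>x. indicator {a..<b} x * g' x \<partial>lborel) = g b - g a"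
proof -
  have "(g' has_integral (g b - g a)) {a..b}"
  proof (rule fundamental_theorem_of_calculus[OF ab])
    fix x assume "x \<in> {a..b}"
    then show "(g has_vector_derivative g' x) (at x within {a..b})"
      unfolding has_real_derivative_iff_has_vector_derivative[symmetric]
      by (intro has_field_derivative_at_within[OF der]) auto
  qed
  moreover have "set_integrable lborel {a..b} g'"
    unfolding set_integrable_def
    by (rule integrable_bounded_support[where C = C and M = "max \<bar>a\<bar> \<bar>b\<bar>"])
      (use g' order_trans[OF abs_ge_zero g'(2)] in \<open>auto simp: indicator_def\<close>)
  ultimately have "(LINT x:{a..b}|lborel. g' x) = g b - g a"
    by (simp add: set_borel_integral_eq_integral(2) integral_unique)
  moreover have "(LINT x:{a..b}|lborel. g' x) = (\<integral>x. indicator {a..<b} x * g' x \<partial>lborel)"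
    unfolding set_lebesgue_integral_def
  proof (rule integral_cong_AE)
    show "AE x in lborel. indicator {a..b} x *\<^sub>R g' x = indicator {a..<b} x * g' x"
      using AE_lborel_singleton[of b] by eventually_elim (auto simp: indicator_def)
  qed (use g' in measurable)
  ultimately show ?thesis by simp
qed

lemma integral_lborel_fst:
  fixes f :: "'a::euclidean_space \<times> 'b::euclidean_space \<Rightarrow> real"
  assumes "integrable lborel f"
  shows "(\<integral>x. (\<integral>y. f (x, y) \<partial>lborel) \<partial>lborel) = (\<integral>z. f z \<partial>lborel)"
  using lborel_pair.integral_fst'[of f] assms by (simp add: lborel_prod)

text \<open>Integration along the characteristics of one layer, in coordinates
  \<open>((a, s), (b, t))\<close> with height \<open>s\<close> and with \<open>b\<close> moving at
  speed \<open>c a\<close>. The density \<open>R * Q\<close> and the front condition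
  \<open>t > s\<close> are constant along a characteristic, and \<open>D\<close> is the derivative
  of \<open>\<psi>\<close> in its direction; only the values of \<open>\<psi>\<close> at the top and
  at the bottom remain.\<close>

lemma layer_integral:
  fixes \<psi> D :: "(real \<times> real) \<times> real \<times> real \<Rightarrow> real" and R Q c :: "real \<Rightarrow> real"
  assumes w: "0 \<le> w"
    and meas[measurable]: "\<psi> \<in> borel_measurable borel" "D \<in> borel_measurable borel" "R \<in> borel_measurable borel"
      "Q \<in> borel_measurable borel" "c \<in> borel_measurable borel"
    and bnd: "\<And>x. \<bar>R x\<bar> \<le> 1" "\<And>x. \<bar>Q x\<bar> \<le> 1" "\<And>z. \<bar>D z\<bar> \<le> C" "\<And>z. \<bar>\<psi> z\<bar> \<le> C"
    and supp: "\<And>z. norm z > M \<Longrightarrow> D z = 0" "\<And>z. norm z > M \<Longrightarrow> \<psi> z = 0"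
    and der: "\<And>a b \<tau> s. \<lbrakk>w \<le> s; s \<le> 2 * w; \<tau> > 0\<rbrakk> \<Longrightarrow>
      ((\<lambda>\<sigma>. \<psi> ((a, \<sigma>), (b + c a * (\<sigma> - w), \<tau> + \<sigma>))) has_real_derivative
        D ((a, s), (b + c a * (s - w), \<tau> + s))) (at s)"
  shows "(\<integral>z. indicator {w..<2 * w} (snd (fst z)) * indicator {0<..} (snd (snd z) - snd (fst z)) *
           (R (fst (snd z) - c (fst (fst z)) * (snd (fst z) - w)) * Q (fst (fst z)) * D z) \<partial>lborel)
    = (\<integral>p. indicator {0<..} (snd (snd p)) *
           (R (fst (snd p) - c (fst p) * w) * Q (fst p) * \<psi> ((fst p, 2 * w), (fst (snd p), snd (snd p) + 2 * w))) \<partial>lborel)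
    - (\<integral>p. indicator {0<..} (snd (snd p)) *
           (R (fst (snd p)) * Q (fst p) * \<psi> ((fst p, w), (fst (snd p), snd (snd p) + w))) \<partial>lborel)"
proof -
  have C0: "C \<ge> 0" using bnd(3) abs_ge_zero order_trans by blast
  define f where "f z = indicator {w..<2 * w} (snd (fst z)) * indicator {0<..} (snd (snd z) - snd (fst z)) *
           (R (fst (snd z) - c (fst (fst z)) * (snd (fst z) - w)) * Q (fst (fst z)) * D z)" for z
  have [measurable]: "f \<in> borel_measurable borel"
    unfolding f_def by measurable
  have prod_bnd: "\<bar>r * q * d\<bar> \<le> C" if "\<bar>r\<bar> \<le> 1" "\<bar>q\<bar> \<le> 1" "\<bar>d\<bar> \<le> C" for r q d :: real
  proof -
    have "\<bar>r * q\<bar> \<le> 1" using that(1,2) by (simp add: abs_mult mult_le_one)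
    then have "\<bar>r * q\<bar> * \<bar>d\<bar> \<le> 1 * C" using that(3) by (intro mult_mono) auto
    then show ?thesis by (simp add: abs_mult)
  qed
  have f_int: "integrable lborel f"
  proof (rule integrable_bounded_support[where C = C and M = M])
    show "\<bar>f z\<bar> \<le> C" for z
      using prod_bnd[OF bnd(1,2,3)] C0 by (simp add: f_def indicator_def)
  qed (use supp in \<open>auto simp: f_def\<close>)
  define G where "G = (\<lambda>(p :: real \<times> real \<times> real, s :: real). ((fst p, s), snd p))"
  \<comment> \<open>\<open>S\<close> straightens the characteristics: the new second pair is the
    position of \<open>b\<close> at the bottom of the layer and the delay \<open>t - s\<close>
    behind the front. \<open>G\<close> makes the height the inner variable of integration.\<close>
  define S where "S = (\<lambda>z :: (real \<times> real) \<times> real \<times> real. (fst z, snd z + (c (fst (fst z)) * (snd (fst z) - w), snd (fst z))))"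
  have G: "distr lborel borel G = lborel"
  proof (rule lborel_distr_Basis)
    show "linear G" by (auto intro!: linearI simp: G_def)
    show "bij_betw G Basis Basis"
      unfolding bij_betw_def by (auto simp: G_def inj_on_def Basis_prod_def image_Un image_image zero_prod_def)
  qed
  have [measurable]: "G \<in> borel_measurable borel"
    unfolding G_def case_prod_unfold by measurable
  have S: "distr lborel borel S = lborel"
    unfolding S_def by (rule lborel_distr_shear[where a = "\<lambda>p. (c (fst p) * (snd p - w), snd p)"])
      measurable
  have [measurable]: "S \<in> borel_measurable borel"
    unfolding S_def by measurable
  have SG: "f (S (G (p, s))) = indicator {0<..} (snd (snd p)) * (R (fst (snd p)) * Q (fst p)) *
      (indicator {w..<2 * w} s * D ((fst p, s), (fst (snd p) + c (fst p) * (s - w), snd (snd p) + s)))" for p s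
    by (cases p) (simp add: f_def S_def G_def indicator_def)
  have "(\<integral>z. f z \<partial>lborel) = (\<integral>z. f (S z) \<partial>lborel)"
    by (rule integral_lborel_preserving(1)[OF S, symmetric]) measurable
  also have "\<dots> = (\<integral>z. f (S (G z)) \<partial>lborel)"
    by (rule integral_lborel_preserving(1)[OF G, symmetric]) measurable
  also have "\<dots> = (\<integral>p. (\<integral>s. f (S (G (p, s))) \<partial>lborel) \<partial>lborel)"
  proof (rule integral_lborel_fst[symmetric])
    have "integrable lborel (\<lambda>z. f (S z))"
      using f_int by (subst integral_lborel_preserving(2)[OF S]) measurable
    then show "integrable lborel (\<lambda>z. f (S (G z)))"
      by (subst integral_lborel_preserving(2)[OF G, of "\<lambda>z. f (S z)"]) measurable
  qed
  finally have "(\<integral>z. f z \<partial>lborel) = (\<integral>p. (\<integral>s. f (S (G (p, s))) \<partial>lborel) \<partial>lborel)" .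
  moreover
  define X2 where "X2 p = indicator {0<..} (snd (snd p)) *
           (R (fst (snd p)) * Q (fst p) * \<psi> ((fst p, w), (fst (snd p), snd (snd p) + w)))" for p :: "real \<times> real \<times> real"
  define X1 where "X1 p = indicator {0<..} (snd (snd p)) *
           (R (fst (snd p) - c (fst p) * w) * Q (fst p) * \<psi> ((fst p, 2 * w), (fst (snd p), snd (snd p) + 2 * w)))"
           for p :: "real \<times> real \<times> real"
  \<comment> \<open>At the top the label of a characteristic and the current position of
    \<open>b\<close> differ by the full displacement \<open>c * w\<close>; \<open>T\<close> passes
    from one to the other.\<close>
  define T where "T p = (fst p, snd p + (c (fst p) * w, 0))" for p :: "real \<times> real \<times> real"
  have "(\<integral>s. f (S (G (p, s))) \<partial>lborel) = X1 (T p) - X2 p" for p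
  proof (cases "snd (snd p) > 0")
    case True
    have "(\<integral>s. indicator {w..<2 * w} s * D ((fst p, s), (fst (snd p) + c (fst p) * (s - w), snd (snd p) + s)) \<partial>lborel)
      = \<psi> ((fst p, 2 * w), (fst (snd p) + c (fst p) * (2 * w - w), snd (snd p) + 2 * w))
        - \<psi> ((fst p, w), (fst (snd p) + c (fst p) * (w - w), snd (snd p) + w))"
    proof (rule integral_FTC_Ico[where g = "\<lambda>\<sigma>. \<psi> ((fst p, \<sigma>), (fst (snd p) + c (fst p) * (\<sigma> - w), snd (snd p) + \<sigma>))"])
      show "(\<lambda>s. D ((fst p, s), (fst (snd p) + c (fst p) * (s - w), snd (snd p) + s))) \<in> borel_measurable borel"
        by (rule measurable_compose[OF _ meas(2)], rule borel_measurable_continuous_onI) (intro continuous_intros)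
    qed (use w bnd der True in auto)
    then show ?thesis
      using True by (simp add: SG X1_def X2_def T_def right_diff_distrib)
  next
    case False
    then show ?thesis by (simp add: SG X1_def X2_def T_def)
  qed
  moreover have X: "integrable lborel (\<lambda>p :: real \<times> real \<times> real. indicator {0<..} (snd (snd p)) *
           (r p * Q (fst p) * \<psi> ((fst p, s), (fst (snd p), snd (snd p) + s))))"
    if r[measurable]: "r \<in> borel_measurable borel" and r1: "\<And>p. \<bar>r p\<bar> \<le> 1" for r s
  proof (rule integrable_bounded_support[where C = C and M = "3 * M + \<bar>s\<bar>"])
    show "(\<lambda>p :: real \<times> real \<times> real. indicator {0<..} (snd (snd p)) *
           (r p * Q (fst p) * \<psi> ((fst p, s), (fst (snd p), snd (snd p) + s)))) \<in> borel_measurable borel"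
      by measurable
    fix p :: "real \<times> real \<times> real"
    show "\<bar>indicator {0<..} (snd (snd p)) * (r p * Q (fst p) * \<psi> ((fst p, s), (fst (snd p), snd (snd p) + s)))\<bar> \<le> C"
      using prod_bnd[OF r1 bnd(2,4)] C0 by (simp add: indicator_def)
    assume p: "3 * M + \<bar>s\<bar> < norm p"
    let ?z = "((fst p, s), (fst (snd p), snd (snd p) + s))"
    have "\<not> norm ?z \<le> M"
    proof
      assume z: "norm ?z \<le> M"
      have "norm (fst z) \<le> norm z" "norm (snd z) \<le> norm z" for z :: "'u::real_normed_vector \<times> 'v::real_normed_vector"
        using norm_fst_le[of "fst z" "snd z"] norm_snd_le[of "snd z" "fst z"] by simp_all
      from this[of ?z] this[of "fst ?z"] this[of "snd ?z"]
      have "\<bar>fst p\<bar> \<le> M" "\<bar>fst (snd p)\<bar> \<le> M" "\<bar>snd (snd p) + s\<bar> \<le> M" using z by auto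
      moreover have "norm p \<le> norm (fst p) + (norm (fst (snd p)) + norm (snd (snd p)))"
        using norm_Pair_le[of "fst p" "snd p"] norm_Pair_le[of "fst (snd p)" "snd (snd p)"] by simp
      ultimately show False using p by simp
    qed
    then show "indicator {0<..} (snd (snd p)) * (r p * Q (fst p) * \<psi> ?z) = 0"
      using supp(2)[of ?z] by simp
  qed
  have X2: "integrable lborel X2"
    unfolding X2_def by (rule X[of "\<lambda>p. R (fst (snd p))"]) (measurable, use bnd in auto)
  have X1: "integrable lborel X1"
    unfolding X1_def by (rule X[of "\<lambda>p. R (fst (snd p) - c (fst p) * w)"]) (measurable, use bnd in auto)
  have T: "distr lborel borel T = lborel"
    unfolding T_def by (rule lborel_distr_shear[where a = "\<lambda>a. (c a * w, 0)"]) measurable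
  have Tm: "T \<in> borel_measurable borel"
    unfolding T_def by measurable
  have X1T: "integrable lborel (\<lambda>p. X1 (T p))" "(\<integral>p. X1 (T p) \<partial>lborel) = (\<integral>p. X1 p \<partial>lborel)"
    using X1 integral_lborel_preserving[OF T Tm, of X1] by (auto dest: borel_measurable_integrable)
  ultimately have "(\<integral>z. f z \<partial>lborel) = (\<integral>p. X1 p \<partial>lborel) - (\<integral>p. X2 p \<partial>lborel)"
    using X2 by simp
  then show ?thesis by (simp add: f_def X1_def X2_def)
qed

section \<open>The velocity field and the density\<close>

definition vec3 :: "real \<Rightarrow> real \<Rightarrow> real \<Rightarrow> real ^ 3" where
  "vec3 x y z = vector [x, y, z]"

lemma vec3_nth [simp]: "vec3 x y z $ 1 = x" "vec3 x y z $ 2 = y" "vec3 x y z $ 3 = z"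
  by (simp_all add: vec3_def)

lemma vec3_eq_iff [simp]: "vec3 x y z = vec3 x' y' z' \<longleftrightarrow> x = x' \<and> y = y' \<and> z = z'"
  by (auto simp: vec_eq_iff forall_3)

lemma vec3_arith:
  "vec3 x y z + vec3 x' y' z' = vec3 (x + x') (y + y') (z + z')"
  "c *\<^sub>R vec3 x y z = vec3 (c * x) (c * y) (c * z)"
  by (simp_all add: vec_eq_iff forall_3)

lemma Basis_real3: "(Basis :: (real ^ 3) set) = {vec3 1 0 0, vec3 0 1 0, vec3 0 0 1}"
proof -
  have "axis 1 1 = vec3 1 0 0" "axis 2 1 = vec3 0 1 0" "axis 3 1 = vec3 0 0 1"
    by (simp_all add: vec_eq_iff forall_3 axis_def)
  moreover have "(Basis :: (real ^ 3) set) = (\<lambda>i. axis i 1) ` UNIV"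
    by (auto simp: Basis_vec_def)
  ultimately show ?thesis by (simp add: UNIV_3)
qed

lemma inner_vec3: "x \<bullet> vec3 a b c = x $ 1 * a + x $ 2 * b + x $ 3 * c"
  by (simp add: inner_vec_def sum_3)

lemma borel_measurable_nth3 [measurable]:
  "f \<in> borel_measurable M \<Longrightarrow> (\<lambda>x. f x $ i) \<in> borel_measurable M" for f :: "'a \<Rightarrow> real ^ 3"
  by (rule measurable_compose[of f M borel "\<lambda>x. x $ i"])
    (auto intro!: borel_measurable_continuous_onI continuous_intros)

lemma borel_measurable_vec3 [measurable (raw)]:
  assumes "f \<in> borel_measurable M" "g \<in> borel_measurable M" "h \<in> borel_measurable M"
  shows "(\<lambda>x. vec3 (f x) (g x) (h x)) \<in> borel_measurable M"
  by (subst borel_measurable_euclidean_space) (use assms in \<open>auto simp: Basis_real3 inner_vec3\<close>)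

lemma norm_le_3: "norm x \<le> \<bar>x $ 1\<bar> + \<bar>x $ 2\<bar> + \<bar>x $ 3\<bar>" for x :: "real ^ 3"
  using norm_le_l1_cart[of x] by (simp add: sum_3)

section \<open>Dyadic square waves and the shears built from them\<close>

definition width :: "nat \<Rightarrow> real" where "width m = (1 / 2) ^ m"

lemma width_pos [simp]: "width m > 0" "width m \<ge> 0" and width_Suc: "width m = 2 * width (Suc m)" and width_le_1: "width m \<le> 1" and width_0 [simp]: "width 0 = 1"
  by (simp_all add: width_def power_le_one)

lemma width_antimono: "m \<le> n \<Longrightarrow> width n \<le> width m"
  unfolding width_def by (rule power_decreasing) auto

lemma width_tendsto: "width \<longlonglongrightarrow> 0"
  unfolding width_def by (rule LIMSEQ_power_zero) simp

definition square_wave :: "nat \<Rightarrow> real \<Rightarrow> real" where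
  "square_wave m x = (if even \<lfloor>x / width m\<rfloor> then 1 else - 1)"

lemma square_wave_cases: "square_wave m x = 1 \<or> square_wave m x = - 1"
  by (simp add: square_wave_def)

lemma abs_square_wave [simp]: "\<bar>square_wave m x\<bar> = 1"
  by (simp add: square_wave_def)

lemma square_wave_shift: "square_wave m (x + width m) = - square_wave m x"
proof -
  have "(x + width m) / width m = x / width m + 1" by (simp add: add_divide_distrib less_imp_neq[symmetric])
  then show ?thesis by (simp add: square_wave_def)
qed

lemma square_wave_shift': "square_wave m (x - width m) = - square_wave m x"
  using square_wave_shift[of m "x - width m"] by simp

lemma borel_measurable_square_wave [measurable]: "square_wave m \<in> borel_measurable borel"
proof -
  have "(\<lambda>x. (if even k then 1 else - 1 :: real)) \<in> borel_measurable borel" for k :: int by simp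
  then show ?thesis unfolding square_wave_def[abs_def]
    by (rule measurable_compose_countable[where g = "\<lambda>x. \<lfloor>x / width m\<rfloor>"]) measurable
qed

definition shear_speed :: "nat \<Rightarrow> real \<Rightarrow> real" where
  "shear_speed n a = (1 - square_wave n a * square_wave (n + 2) a) / 2"

lemma shear_speed_cases: "shear_speed n a = 0 \<or> shear_speed n a = 1"
  using square_wave_cases[of n a] square_wave_cases[of "n + 2" a] by (auto simp: shear_speed_def)

lemma borel_measurable_shear_speed [measurable]: "shear_speed m \<in> borel_measurable borel"
  unfolding shear_speed_def[abs_def] by measurable

text \<open>The shift flips the wave in \<open>b\<close> exactly where the two waves in
  \<open>a\<close> have opposite signs. The sign thus produced is the product of these two waves, so
  the fine wave cancels and the coarse one appears. This is the unmixing step.\<close>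

lemma square_wave_shear_shift: "square_wave (n + 1) (b - shear_speed n a * width (n + 1)) * square_wave (n + 2) a = square_wave (n + 1) b * square_wave n a"
  using square_wave_cases[of n a] square_wave_cases[of "n + 2" a] square_wave_shift'[of "n + 1" b] by (auto simp: shear_speed_def)

text \<open>Meaningful only for \<open>0 < s < 1\<close>.\<close>
definition layer_of :: "real \<Rightarrow> nat" where "layer_of s = (LEAST n. width (n + 1) \<le> s)"

lemma layer_of_eq: "width (n + 1) \<le> s \<Longrightarrow> s < width n \<Longrightarrow> layer_of s = n"
  unfolding layer_of_def
proof (rule Least_equality)
  fix m assume "s < width n" "width (m + 1) \<le> s"
  then show "n \<le> m" using width_antimono[of "m + 1" n] by (cases "n \<le> m") auto
qed

lemma layer_of_bounds:
  assumes "0 < s" "s < 1"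
  shows "width (layer_of s + 1) \<le> s" "s < width (layer_of s)"
proof -
  obtain n where "width n < s"
    using order_tendstoD(2)[OF width_tendsto assms(1)] by (auto simp: eventually_sequentially)
  then have "width (n + 1) \<le> s" using width_antimono[of n "n + 1"] by simp
  then show "width (layer_of s + 1) \<le> s" unfolding layer_of_def by (rule LeastI[of "\<lambda>n. width (n + 1) \<le> s"])
  show "s < width (layer_of s)"
  proof (cases "layer_of s")
    case (Suc m)
    then have "\<not> width (m + 1) \<le> s"
      unfolding layer_of_def by (intro not_less_Least) simp
    then show ?thesis using Suc by simp
  qed (use assms in simp)
qed

lemma measurable_layer_of [measurable]: "layer_of \<in> measurable borel (count_space UNIV)"
  unfolding layer_of_def[abs_def] by measurable

lemma borel_measurable_layer_of:
  fixes g :: "nat \<Rightarrow> real ^ 3 \<Rightarrow> 'b::topological_space"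
  assumes "\<And>n. g n \<in> borel_measurable borel"
  shows "(\<lambda>x. g (layer_of (x $ 3)) x) \<in> borel_measurable borel"
  by (rule measurable_compose_countable[where g = "\<lambda>x. layer_of (x $ 3)", OF assms]) measurable

text \<open>From height 1 upwards the field is vertical: the density, cut off at the front, does not
  get there before time 1.\<close>

definition vel :: "real ^ 3 \<Rightarrow> real ^ 3" where
  "vel x = vec3
     (if x $ 3 < 1 \<and> odd (layer_of (x $ 3)) then shear_speed (layer_of (x $ 3)) (x $ 2) else 0)
     (if x $ 3 < 1 \<and> even (layer_of (x $ 3)) then shear_speed (layer_of (x $ 3)) (x $ 1) else 0) 1"

text \<open>The subtracted term traces \<open>x\<close> back along its characteristic to the bottom
  of the layer, at height \<open>width (n + 1)\<close>, where the value is read off a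
  checkerboard.\<close>

definition layer_density :: "nat \<Rightarrow> real ^ 3 \<Rightarrow> real" where
  "layer_density n x = (if even n
     then square_wave (n + 1) (x $ 2 - shear_speed n (x $ 1) * (x $ 3 - width (n + 1))) * square_wave (n + 2) (x $ 1)
     else square_wave (n + 1) (x $ 1 - shear_speed n (x $ 2) * (x $ 3 - width (n + 1))) * square_wave (n + 2) (x $ 2))"

definition rho :: "(real ^ 3) \<times> real \<Rightarrow> real" where
  "rho z = (if 0 < fst z $ 3 \<and> fst z $ 3 < snd z then layer_density (layer_of (fst z $ 3)) (fst z) else 0)"

lemma borel_measurable_vel [measurable]: "vel \<in> borel_measurable borel"
  unfolding vel_def[abs_def] by (rule borel_measurable_layer_of) measurable

lemma borel_measurable_layer_density [measurable]: "layer_density n \<in> borel_measurable borel"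
  unfolding layer_density_def[abs_def] by measurable

lemma borel_measurable_rho [measurable]: "rho \<in> borel_measurable borel"
proof -
  have [measurable]: "(\<lambda>x. layer_density (layer_of (x $ 3)) x) \<in> borel_measurable borel"
    by (rule borel_measurable_layer_of) measurable
  show ?thesis unfolding rho_def[abs_def]
    by (rule measurable_If, rule measurable_compose[of fst borel borel]) measurable
qed

lemma abs_layer_density [simp]: "\<bar>layer_density n x\<bar> = 1"
  by (simp add: layer_density_def abs_mult)

lemma abs_rho_le: "\<bar>rho z\<bar> \<le> 1"
  by (simp add: rho_def)

lemma vel_nth3 [simp]: "vel x $ 3 = 1"
  by (simp add: vel_def)

lemma vel_bound: "\<bar>vel x $ i\<bar> \<le> 1"
proof -
  have c: "\<bar>shear_speed n a\<bar> \<le> 1" for n a using shear_speed_cases[of n a] by auto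
  have "\<forall>i. \<bar>vel x $ i\<bar> \<le> 1" by (simp add: forall_3 vel_def c)
  then show ?thesis by blast
qed

lemma norm_vel: "norm (vel x) \<le> 3"
  using norm_le_3[of "vel x"] vel_bound[of x 1] vel_bound[of x 2] by simp

text \<open>The density at height \<open>width n\<close>. The roles of the coordinates alternate so
  that, for \<open>n > 0\<close>, this is both the density leaving layer \<open>n\<close> and the
  one entering layer \<open>n - 1\<close>.\<close>

definition checker :: "nat \<Rightarrow> real \<Rightarrow> real \<Rightarrow> real" where
  "checker n x y = (if even n then square_wave n x * square_wave (n + 1) y else square_wave n y * square_wave (n + 1) x)"

lemma abs_checker [simp]: "\<bar>checker n x y\<bar> = 1"
  by (simp add: checker_def abs_mult)

lemma borel_measurable_checker [measurable (raw)]: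
  assumes [measurable]: "f \<in> borel_measurable M" "g \<in> borel_measurable M"
  shows "(\<lambda>x. checker n (f x) (g x)) \<in> borel_measurable M"
  unfolding checker_def by measurable

section \<open>Gradients, and extension of test functions by zero\<close>

lemma grad_eqI: "(f has_derivative (\<lambda>h. h \<bullet> D)) (at x) \<Longrightarrow> grad f x = D"
proof -
  assume f: "(f has_derivative (\<lambda>h. h \<bullet> D)) (at x)"
  have "D' = D" if "(f has_derivative (\<lambda>h. h \<bullet> D')) (at x)" for D'
    proof -
    have "(\<lambda>h. h \<bullet> D) = (\<lambda>h. h \<bullet> D')" by (rule has_derivative_unique[OF f that])
    then have "\<forall>h. h \<bullet> D' = h \<bullet> D" by (simp add: fun_eq_iff)
    then show ?thesis by (simp only: vector_eq_ldot)
  qed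
  with f show "grad f x = D"
    unfolding grad_def gderiv_def by (rule the_equality[of "\<lambda>D. (f has_derivative (\<lambda>h. h \<bullet> D)) (at x)"])
qed

text \<open>Extension by zero lets all integrals run over the whole space. On the boundary and at
  time 0 the derivative is only one-sided, so differentiability is asserted at positive height and
  time. This includes times from 1 on, because the compact support stays away from time 1.\<close>

lemma C1c_extend:
  assumes \<phi>: "\<phi> \<in> C1c ({x :: real ^ 3. 0 \<le> x $ 3} \<times> {0..<1 :: real})"
  obtains \<psi> D C M where
    "\<And>z. 0 < fst z $ 3 \<Longrightarrow> 0 < snd z \<Longrightarrow> (\<psi> has_derivative (\<lambda>h. h \<bullet> D z)) (at z)"
    "\<psi> \<in> borel_measurable borel" "D \<in> borel_measurable borel"
    "\<And>z. norm (D z) \<le> C" "\<And>z. \<bar>\<psi> z\<bar> \<le> C"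
    "\<And>z. norm z > M \<Longrightarrow> D z = 0" "\<And>z. norm z > M \<Longrightarrow> \<psi> z = 0"
    "\<And>z. snd z \<ge> 1 \<Longrightarrow> \<psi> z = 0"
    "\<And>z. z \<in> cylinder {x. 0 < x $ 3} \<Longrightarrow> grad \<phi> z = D z"
    "\<And>z. z \<notin> cylinder {x. 0 < x $ 3} \<Longrightarrow> D z = 0"
proof -
  define S where "S = {x :: real ^ 3. 0 \<le> x $ 3} \<times> {0..<1 :: real}"
  define Q where "Q = cylinder {x :: real ^ 3. 0 < x $ 3}"
  obtain D0 K where D0: "continuous_on S D0" "\<And>z. z \<in> S \<Longrightarrow> (\<phi> has_derivative (\<lambda>h. h \<bullet> D0 z)) (at z within S)"
    and K: "compact K" "K \<subseteq> S" "\<And>z. z \<in> S - K \<Longrightarrow> \<phi> z = 0"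
    using \<phi> unfolding C1c_def S_def by auto
  have Q: "open Q" "Q \<subseteq> S"
    unfolding Q_def cylinder_def S_def
    by (auto intro!: open_Times open_Collect_less continuous_intros)
  have Kc: "closed K" using K(1) by (rule compact_imp_closed)
  have dQ: "(\<phi> has_derivative (\<lambda>h. h \<bullet> D0 z)) (at z)" if "z \<in> Q" for z
    using has_derivative_subset[OF D0(2) Q(2)] Q that by (metis at_within_open subsetD)
  have zero: "D0 z = 0" if z: "z \<in> Q" "z \<notin> K" for z
  proof -
    have "(\<phi> has_derivative (\<lambda>h. 0)) (at z)"
      by (rule has_derivative_transform_within_open[of "\<lambda>_. 0" _ _ _ "Q - K"])
        (use z Q K Kc in \<open>auto intro: open_Diff\<close>)
    from has_derivative_unique[OF this dQ[OF z(1)]] have "D0 z \<bullet> D0 z = 0" by metis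
    then show ?thesis by simp
  qed
  define \<psi> where "\<psi> z = indicator S z *\<^sub>R \<phi> z" for z
  define D where "D z = indicator Q z *\<^sub>R D0 z" for z
  have contS: "continuous_on S \<phi>"
    using D0(2) by (intro has_derivative_continuous_on) 
  have "bounded (D0 ` K)" "bounded (\<phi> ` K)"
    using K contS D0(1) by (auto intro!: compact_imp_bounded compact_continuous_image elim: continuous_on_subset)
  then obtain C1 C2 where C1: "\<And>z. z \<in> K \<Longrightarrow> norm (D0 z) \<le> C1" and C2: "\<And>z. z \<in> K \<Longrightarrow> norm (\<phi> z) \<le> C2"
    unfolding bounded_iff by auto
  obtain M where M: "\<And>z. z \<in> K \<Longrightarrow> norm z \<le> M"
    using compact_imp_bounded[OF K(1)] unfolding bounded_iff by auto
  have \<psi>K: "\<psi> z = 0" if "z \<notin> K" for z using that K(3)[of z] by (simp add: \<psi>_def indicator_def)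
  have DK: "D z = 0" if "z \<notin> K" for z using that zero[of z] by (simp add: D_def indicator_def)
  define C where "C = max 0 (max C1 C2)"
  show thesis
  proof (rule that)
    fix z :: "(real ^ 3) \<times> real" assume z: "0 < fst z $ 3" "0 < snd z"
    show "(\<psi> has_derivative (\<lambda>h. h \<bullet> D z)) (at z)"
    proof (cases "snd z < 1")
      case True
      then have zQ: "z \<in> Q" using z by (cases z) (simp add: Q_def cylinder_def)
      then have "(\<phi> has_derivative (\<lambda>h. h \<bullet> D z)) (at z)" using dQ by (simp add: D_def)
      then show ?thesis
        by (rule has_derivative_transform_within_open[OF _ Q(1) zQ]) (use Q(2) in \<open>auto simp: \<psi>_def\<close>)
    next
      case False
      then have zK: "z \<notin> K" using K(2) by (cases z) (auto simp: S_def)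
      have "(\<psi> has_derivative (\<lambda>h. 0)) (at z)"
        by (rule has_derivative_transform_within_open[of "\<lambda>_. 0" _ _ _ "- K"])
          (use zK Kc \<psi>K in auto)
      then show ?thesis using DK[OF zK] by simp
    qed
  next
    have S: "S \<in> sets borel" unfolding S_def by (intro borel_Times) auto
    then show "\<psi> \<in> borel_measurable borel"
      unfolding \<psi>_def by (rule borel_measurable_continuous_on_indicator[OF _ contS])
    show "D \<in> borel_measurable borel"
      unfolding D_def using Q D0(1)
      by (intro borel_measurable_continuous_on_indicator) (auto elim: continuous_on_subset)
    show "norm (D z) \<le> C" for z
      using C1[of z] DK[of z] by (cases "z \<in> K") (auto simp: C_def D_def indicator_def)
    show "\<bar>\<psi> z\<bar> \<le> C" for z
      using C2[of z] \<psi>K[of z] by (cases "z \<in> K") (auto simp: C_def \<psi>_def indicator_def)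
    show "D z = 0" "\<psi> z = 0" if "norm z > M" for z
      using M[of z] that DK[of z] \<psi>K[of z] by force+
    show "\<psi> z = 0" if "snd z \<ge> 1" for z
      using that by (cases z) (simp add: \<psi>_def S_def)
    show "grad \<phi> z = D z" if "z \<in> cylinder {x. 0 < x $ 3}" for z
      using grad_eqI[OF dQ, of z] that by (simp add: Q_def D_def)
    show "D z = 0" if "z \<notin> cylinder {x. 0 < x $ 3}" for z
      using that by (simp add: Q_def D_def)
  qed
qed

section \<open>Transport of the density\<close>

lemma norm_fst_snd_le:
  fixes z :: "'u::real_normed_vector \<times> 'v::real_normed_vector"
  shows "norm (fst z) \<le> norm z" "norm (snd z) \<le> norm z" "norm z \<le> norm (fst z) + norm (snd z)"
  using norm_fst_le[of "fst z" "snd z"] norm_snd_le[of "snd z" "fst z"] norm_Pair_le[of "fst z" "snd z"]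
  by simp_all

text \<open>In the coordinates \<open>((a, s), (b, t))\<close> the shear moves \<open>b\<close> with a speed depending on \<open>a\<close>. The flag is the parity
  of the layer: it says whether \<open>b\<close> is the second or the first horizontal coordinate.\<close>
definition place :: "bool \<Rightarrow> (real \<times> real) \<times> real \<times> real \<Rightarrow> (real ^ 3) \<times> real" where
  "place e z = ((if e then vec3 (fst (fst z)) (fst (snd z)) (snd (fst z))
                 else vec3 (fst (snd z)) (fst (fst z)) (snd (fst z))), snd (snd z))"

lemma linear_place: "linear (place e)"
  by (rule linearI) (auto simp: place_def vec3_arith)

lemma borel_measurable_place [measurable]: "place e \<in> borel_measurable borel"
  unfolding place_def by measurable

lemma distr_place: "distr lborel borel (place e) = lborel"
proof (rule lborel_distr_Basis[OF linear_place])
  have z: "0 = vec3 0 0 0" by (simp add: vec_eq_iff forall_3)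
  show "bij_betw (place e) Basis Basis"
    unfolding bij_betw_def
    by (cases e) (auto simp: place_def inj_on_def Basis_prod_def Basis_real3 image_Un image_image z)
qed

lemma norm_place: "norm (place e z) = norm z"
  by (simp add: place_def norm_prod_def norm_vec_def L2_set_def sum_3 power2_eq_square[symmetric] add_ac)

lemma distr_rotate:
  "distr lborel borel (\<lambda>p :: real \<times> real \<times> real. (fst (snd p), fst p, snd (snd p))) = lborel"
proof (rule lborel_distr_Basis)
  show "linear (\<lambda>p :: real \<times> real \<times> real. (fst (snd p), fst p, snd (snd p)))" by (rule linearI) auto
  show "bij_betw (\<lambda>p :: real \<times> real \<times> real. (fst (snd p), fst p, snd (snd p))) Basis Basis"
    unfolding bij_betw_def by (auto simp: inj_on_def Basis_prod_def image_Un image_image zero_prod_def)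
qed

section \<open>Flux balance layer by layer\<close>

locale transport_test =
  fixes \<psi> :: "(real ^ 3) \<times> real \<Rightarrow> real" and D :: "(real ^ 3) \<times> real \<Rightarrow> (real ^ 3) \<times> real" and C M :: real
  assumes der: "\<And>z. 0 < fst z $ 3 \<Longrightarrow> 0 < snd z \<Longrightarrow> (\<psi> has_derivative (\<lambda>h. h \<bullet> D z)) (at z)"
    and meas [measurable]: "\<psi> \<in> borel_measurable borel" "D \<in> borel_measurable borel"
    and D_bound: "\<And>z. norm (D z) \<le> C" and \<psi>_bound: "\<And>z. \<bar>\<psi> z\<bar> \<le> C"
    and D_supp: "\<And>z. norm z > M \<Longrightarrow> D z = 0" and \<psi>_supp: "\<And>z. norm z > M \<Longrightarrow> \<psi> z = 0"
    and D_late: "\<And>z. snd z \<ge> 1 \<Longrightarrow> D z = 0" and \<psi>_late: "\<And>z. snd z \<ge> 1 \<Longrightarrow> \<psi> z = 0"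
begin

lemma C_nonneg: "0 \<le> C"
  using order_trans[OF norm_ge_zero D_bound] .

definition flux :: "(real ^ 3) \<times> real \<Rightarrow> real" where
  "flux z = rho z * ((vel (fst z), 1) \<bullet> D z)"

text \<open>The last coordinate of \<open>p\<close> is the time elapsed since the front passed
  height \<open>width n\<close>; the indicator is the cut-off at the front.\<close>

definition slice :: "nat \<Rightarrow> real \<times> real \<times> real \<Rightarrow> real" where
  "slice n p = indicator {0<..} (snd (snd p)) * \<psi> (vec3 (fst p) (fst (snd p)) (width n), snd (snd p) + width n)"

text \<open>The flux of the density, weighted with \<open>\<psi>\<close>, through the plane at
  height \<open>width n\<close>; the vertical component of the field is 1.\<close>

definition level :: "nat \<Rightarrow> real" where
  "level n = (\<integral>p. checker n (fst p) (fst (snd p)) * slice n p \<partial>lborel)"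

lemma borel_measurable_flux [measurable]: "flux \<in> borel_measurable borel"
  unfolding flux_def[abs_def] by measurable

lemma flux_bound: "\<bar>flux z\<bar> \<le> 4 * C"
proof -
  have "norm (vel (fst z), 1 :: real) \<le> 4"
    using norm_Pair_le[of "vel (fst z)" "1 :: real"] norm_vel[of "fst z"] by simp
  then have "\<bar>(vel (fst z), 1) \<bullet> D z\<bar> \<le> 4 * C"
    using Cauchy_Schwarz_ineq2[of "(vel (fst z), 1 :: real)" "D z"] D_bound[of z]
    by (meson mult_mono norm_ge_zero order_trans zero_le_numeral)
  then have "\<bar>rho z\<bar> * \<bar>(vel (fst z), 1) \<bullet> D z\<bar> \<le> 1 * (4 * C)"
    using abs_rho_le[of z] by (intro mult_mono) auto
  then show ?thesis by (simp add: flux_def abs_mult)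
qed

lemma integrable_flux: "integrable lborel flux"
  by (rule integrable_bounded_support[where C = "4 * C" and M = M])
    (auto simp: flux_bound, simp add: flux_def D_supp)

lemma slice_supp: "norm p > 3 * M + 1 \<Longrightarrow> slice n p = 0"
proof -
  assume p: "norm p > 3 * M + 1"
  let ?x = "vec3 (fst p) (fst (snd p)) (width n)"
  let ?z = "(?x, snd (snd p) + width n)"
  have "\<not> norm ?z \<le> M"
  proof
    assume z: "norm ?z \<le> M"
    have "norm ?x \<le> M" "\<bar>snd (snd p) + width n\<bar> \<le> M"
      using norm_fst_snd_le(1,2)[of ?z] z by auto
    moreover have "\<bar>fst p\<bar> \<le> norm ?x" "\<bar>fst (snd p)\<bar> \<le> norm ?x"
      using component_le_norm_cart[of ?x 1] component_le_norm_cart[of ?x 2] by auto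
    moreover have "norm p \<le> \<bar>fst p\<bar> + (\<bar>fst (snd p)\<bar> + \<bar>snd (snd p)\<bar>)"
      using norm_fst_snd_le(3)[of p] norm_fst_snd_le(3)[of "snd p"] by simp
    ultimately show False using p width_le_1[of n] width_pos(1)[of n] by linarith
  qed
  then show "slice n p = 0" using \<psi>_supp[of ?z] by (simp add: slice_def)
qed

lemma borel_measurable_slice [measurable]: "slice n \<in> borel_measurable borel"
  unfolding slice_def[abs_def] by measurable

lemma slice_bound: "\<bar>slice n p\<bar> \<le> C"
  using \<psi>_bound C_nonneg by (simp add: slice_def indicator_def)

lemma integrable_level: "integrable lborel (\<lambda>p. checker n (fst p) (fst (snd p)) * slice n p)"
  by (rule integrable_bounded_support[where C = C and M = "3 * M + 1"])
    (measurable, simp_all add: abs_mult slice_bound slice_supp)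

text \<open>The chain rule along a characteristic: \<open>place e ((0, 1), (c, 1))\<close> is the
  space-time velocity in a layer where the shear has speed \<open>c\<close>.\<close>

lemma place_derivative:
  assumes "0 < s" "0 < \<tau>"
  shows "((\<lambda>\<sigma>. \<psi> (place e ((a, \<sigma>), (b + c * (\<sigma> - w), \<tau> + \<sigma>)))) has_real_derivative
     place e ((0, 1), (c, 1)) \<bullet> D (place e ((a, s), (b + c * (s - w), \<tau> + s)))) (at s)"
proof -
  let ?g = "\<lambda>\<sigma>. place e ((a, \<sigma>), (b + c * (\<sigma> - w), \<tau> + \<sigma>))"
  let ?E = "place e ((0, 1), (c, 1))"
  have g: "?g \<sigma> = place e ((a, 0), (b - c * w, \<tau>)) + \<sigma> *\<^sub>R ?E" for \<sigma>
    by (auto simp: place_def vec3_arith algebra_simps)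
  have "(?g has_derivative (\<lambda>h. h *\<^sub>R ?E)) (at s)"
    unfolding g by (auto intro!: derivative_eq_intros)
  moreover have "(\<psi> has_derivative (\<lambda>h. h \<bullet> D (?g s))) (at (?g s))"
    by (rule der) (use assms in \<open>auto simp: place_def\<close>)
  ultimately have "((\<lambda>\<sigma>. \<psi> (?g \<sigma>)) has_derivative (\<lambda>h. (h *\<^sub>R ?E) \<bullet> D (?g s))) (at s)"
    by (rule has_derivative_compose)
  then show ?thesis
    by (simp add: has_field_derivative_def mult.commute[of _ "_ \<bullet> _"] inner_commute fun_eq_iff)
qed

text \<open>The density is transported inside the layer, so only fluxes through top and bottom are
  left. At the bottom the checkerboard is there by construction; at the top
  \<open>square_wave_shear_shift\<close> identifies the sheared density with the next coarser
  one.\<close>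

lemma flux_layer:
  "(\<integral>z. indicator {width (n + 1)..<width n} (fst z $ 3) * flux z \<partial>lborel) = level n - level (n + 1)"
proof -
  let ?e = "even n"
  define w where "w = width (n + 1)"
  have w: "0 < w" "width n = 2 * w" using width_Suc[of n] by (simp_all add: w_def)
  define D' where "D' z = place ?e ((0, 1), (shear_speed n (fst (fst z)), 1)) \<bullet> D (place ?e z)" for z
  define R where "R = square_wave (n + 1)"
  define Q where "Q = square_wave (n + 2)"
  \<comment> \<open>In odd layers \<open>place\<close> lists the horizontal coordinates in reverse
    order; \<open>r\<close> restores the order used by \<open>slice\<close> and
    \<open>checker\<close>.\<close>
  define r where "r = (\<lambda>p :: real \<times> real \<times> real. if ?e then p else (fst (snd p), fst p, snd (snd p)))"
  have rd: "distr lborel borel r = lborel" and [measurable]: "r \<in> borel_measurable borel"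
    using distr_rotate by (cases "even n"; simp add: r_def distr_id2)+
  have [measurable]: "R \<in> borel_measurable borel" "Q \<in> borel_measurable borel" "D' \<in> borel_measurable borel"
    unfolding R_def Q_def D'_def[abs_def] place_def by measurable
  have pE: "norm (place ?e ((0, 1), (shear_speed n a, 1))) \<le> 3" for a
    using norm_fst_snd_le(3)[of "((0, 1), (shear_speed n a, 1)) :: (real \<times> real) \<times> real \<times> real"]
      norm_fst_snd_le(3)[of "(0, 1) :: real \<times> real"] norm_fst_snd_le(3)[of "(shear_speed n a, 1) :: real \<times> real"]
      shear_speed_cases[of n a] by (auto simp: norm_place)
  have "(\<integral>z. indicator {w..<2 * w} (fst z $ 3) * flux z \<partial>lborel)
     = (\<integral>z. indicator {w..<2 * w} (fst (place ?e z) $ 3) * flux (place ?e z) \<partial>lborel)"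
    by (rule integral_lborel_preserving(1)[OF distr_place, symmetric]) measurable
  also have "\<dots> = (\<integral>z. indicator {w..<2 * w} (snd (fst z)) * indicator {0<..} (snd (snd z) - snd (fst z)) *
           (R (fst (snd z) - shear_speed n (fst (fst z)) * (snd (fst z) - w)) * Q (fst (fst z)) * D' z) \<partial>lborel)"
  proof (rule Bochner_Integration.integral_cong[OF refl])
    fix z :: "(real \<times> real) \<times> real \<times> real"
    obtain a s b t where z: "z = ((a, s), (b, t))" by (metis surj_pair)
    show "indicator {w..<2 * w} (fst (place ?e z) $ 3) * flux (place ?e z)
      = indicator {w..<2 * w} (snd (fst z)) * indicator {0<..} (snd (snd z) - snd (fst z)) *
           (R (fst (snd z) - shear_speed n (fst (fst z)) * (snd (fst z) - w)) * Q (fst (fst z)) * D' z)"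
    proof (cases "w \<le> s \<and> s < 2 * w")
      case True
      then have l: "layer_of s = n" "s < 1" "0 < s"
        using w layer_of_eq[of n s] width_le_1[of n] by (auto simp: w_def)
      then show ?thesis
        by (auto simp: z flux_def rho_def D'_def R_def Q_def place_def vel_def layer_density_def indicator_def w_def)
    qed (auto simp: z place_def indicator_def)
  qed
  also have "\<dots> = (\<integral>p. indicator {0<..} (snd (snd p)) *
           (R (fst (snd p) - shear_speed n (fst p) * w) * Q (fst p) * \<psi> (place ?e ((fst p, 2 * w), (fst (snd p), snd (snd p) + 2 * w)))) \<partial>lborel)
    - (\<integral>p. indicator {0<..} (snd (snd p)) *
           (R (fst (snd p)) * Q (fst p) * \<psi> (place ?e ((fst p, w), (fst (snd p), snd (snd p) + w)))) \<partial>lborel)"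
  proof (rule layer_integral[where C = "3 * C" and M = M])
    show "\<bar>D' z\<bar> \<le> 3 * C" for z
    proof -
      have "\<bar>D' z\<bar> \<le> norm (place ?e ((0, 1), (shear_speed n (fst (fst z)), 1))) * norm (D (place ?e z))"
        unfolding D'_def by (rule Cauchy_Schwarz_ineq2)
      also have "\<dots> \<le> 3 * C" by (intro mult_mono pE D_bound) auto
      finally show ?thesis .
    qed
    show "\<bar>\<psi> (place ?e z)\<bar> \<le> 3 * C" for z
      using \<psi>_bound[of "place ?e z"] C_nonneg by simp
    show "D' z = 0" "\<psi> (place ?e z) = 0" if "norm z > M" for z
      using that by (simp_all add: D'_def D_supp \<psi>_supp norm_place)
    fix a b \<tau> s assume "w \<le> s" "s \<le> 2 * w" "(\<tau> :: real) > 0"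
    then show "((\<lambda>\<sigma>. \<psi> (place ?e ((a, \<sigma>), (b + shear_speed n a * (\<sigma> - w), \<tau> + \<sigma>)))) has_real_derivative
        D' ((a, s), (b + shear_speed n a * (s - w), \<tau> + s))) (at s)"
      using place_derivative[of s \<tau> ?e a b "shear_speed n a" w] w by (simp add: D'_def)
  qed (use w in \<open>auto simp: R_def Q_def\<close>)
  also have "(\<integral>p. indicator {0<..} (snd (snd p)) *
           (R (fst (snd p) - shear_speed n (fst p) * w) * Q (fst p) * \<psi> (place ?e ((fst p, 2 * w), (fst (snd p), snd (snd p) + 2 * w)))) \<partial>lborel)
     = (\<integral>p. checker n (fst (r p)) (fst (snd (r p))) * slice n (r p) \<partial>lborel)"
    unfolding R_def Q_def w_def square_wave_shear_shift
    by (rule Bochner_Integration.integral_cong[OF refl])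
      (auto simp: r_def checker_def slice_def place_def width_Suc[of n] indicator_def)
  also have "\<dots> = level n"
    unfolding level_def by (rule integral_lborel_preserving(1)[OF rd]) measurable
  also have "(\<integral>p. indicator {0<..} (snd (snd p)) *
           (R (fst (snd p)) * Q (fst p) * \<psi> (place ?e ((fst p, w), (fst (snd p), snd (snd p) + w)))) \<partial>lborel)
     = (\<integral>p. checker (n + 1) (fst (r p)) (fst (snd (r p))) * slice (n + 1) (r p) \<partial>lborel)"
    unfolding R_def Q_def w_def
    by (rule Bochner_Integration.integral_cong[OF refl])
      (auto simp: r_def checker_def slice_def place_def indicator_def)
  also have "\<dots> = level (n + 1)"
    unfolding level_def by (rule integral_lborel_preserving(1)[OF rd]) measurable
  finally show ?thesis unfolding w(2) by (simp add: w_def)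
qed

text \<open>Behind the front the height \<open>width 0 = 1\<close> is seen only at times beyond 1,
  where \<open>\<psi>\<close> vanishes.\<close>

lemma level_0: "level 0 = 0"
proof -
  have "slice 0 p = 0" for p
    using \<psi>_late[of "(vec3 (fst p) (fst (snd p)) 1, snd (snd p) + 1)"] by (simp add: slice_def indicator_def)
  then show ?thesis by (simp add: level_def)
qed

lemma \<psi>_Lipschitz:
  assumes "0 < fst y $ 3" "0 < snd y" "0 < fst z $ 3" "0 < snd z"
  shows "\<bar>\<psi> y - \<psi> z\<bar> \<le> C * norm (y - z)"
proof -
  let ?H = "{x :: real ^ 3. 0 < x $ 3} \<times> {0 :: real<..}"
  have "convex {x :: real ^ 3. 0 < x $ 3}"
    using convex_halfspace_gt[of 0 "vec3 0 0 1"] by (simp add: inner_commute[of "vec3 _ _ _"] inner_vec3)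
  then have "convex ?H" by (intro convex_Times) auto
  moreover have "(\<psi> has_derivative (\<lambda>h. h \<bullet> D x)) (at x within ?H)" if "x \<in> ?H" for x
    using der[of x] that by (auto intro: has_derivative_at_withinI)
  moreover have "onorm (\<lambda>h. h \<bullet> D x) \<le> C" for x
  proof (rule onorm_le)
    fix h
    have "\<bar>h \<bullet> D x\<bar> \<le> norm h * norm (D x)" by (rule Cauchy_Schwarz_ineq2)
    also have "\<dots> \<le> norm h * C" by (intro mult_left_mono D_bound) simp
    finally show "norm (h \<bullet> D x) \<le> C * norm h" by (simp add: mult.commute)
  qed
  ultimately show ?thesis
    using differentiable_bound[of ?H \<psi> "\<lambda>x h. h \<bullet> D x" C y z] assms by (cases y; cases z) auto
qed

text \<open>A translation by the half-period \<open>width n\<close> changes the sign of the checkerboard, but changes the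
  slice of the test function only by \<open>O(width n)\<close>.\<close>
lemma level_tendsto: "level \<longlonglongrightarrow> 0"
proof -
  \<comment> \<open>A ball that contains the support of a slice, of radius \<open>3 * M + 1\<close>,
    and that of its translate by a vector of length at most 1.\<close>
  define B where "B = measure lborel (cball (0 :: real \<times> real \<times> real) (3 * M + 2))"
  have "\<bar>level n\<bar> \<le> (C * width n * B) / 2" for n
  proof -
    \<comment> \<open>The translation is along the coordinate of the coarser factor, whose
      half-period is \<open>width n\<close>; the other factor does not see it.\<close>
    define e :: "real \<times> real \<times> real" where "e = (if even n then (width n, 0, 0) else (0, width n, 0))"
    define S where "S p = checker n (fst p) (fst (snd p))" for p :: "real \<times> real \<times> real"
    have ne: "norm e = width n" by (simp add: e_def norm_Pair)
    have Se: "S (e + p) = - S p" for p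
      by (auto simp: S_def e_def checker_def square_wave_shift add.commute[of "width n"])
    have S1: "\<bar>S p\<bar> = 1" for p by (simp add: S_def)
    have [measurable]: "S \<in> borel_measurable borel" unfolding S_def[abs_def] by measurable
    have t: "distr lborel borel ((+) e) = lborel" by (simp add: lborel_distr_plus)
    have "level n = (\<integral>p. S (e + p) * slice n (e + p) \<partial>lborel)"
      unfolding level_def S_def[symmetric]
      by (rule integral_lborel_preserving(1)[OF t, symmetric]) measurable
    also have "\<dots> = - (\<integral>p. S p * slice n (e + p) \<partial>lborel)" by (simp add: Se)
    finally have l: "level n = - (\<integral>p. S p * slice n (e + p) \<partial>lborel)" .
    have i1: "integrable lborel (\<lambda>p. S p * slice n p)"
      using integrable_level[of n] by (simp add: S_def)
    have "integrable lborel (\<lambda>p. S (e + p) * slice n (e + p))"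
      by (subst integral_lborel_preserving(2)[OF t, of "\<lambda>p. S p * slice n p"]) (measurable, rule i1)
    then have i2: "integrable lborel (\<lambda>p. S p * slice n (e + p))" by (simp add: Se)
    \<comment> \<open>Adding the two expressions for \<open>level n\<close> produces a difference of
      slices, to which the Lipschitz bound applies.\<close>
    have "2 * level n = (\<integral>p. S p * slice n p \<partial>lborel) - (\<integral>p. S p * slice n (e + p) \<partial>lborel)"
      using l by (simp add: level_def S_def)
    also have "\<dots> = (\<integral>p. S p * slice n p - S p * slice n (e + p) \<partial>lborel)"
      using i1 i2 by simp
    finally have "\<bar>2 * level n\<bar> = \<bar>\<integral>p. S p * slice n p - S p * slice n (e + p) \<partial>lborel\<bar>" by simp
    also have "\<dots> \<le> (\<integral>p. \<bar>S p * slice n p - S p * slice n (e + p)\<bar> \<partial>lborel)"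
      by (rule integral_abs_bound)
    also have "\<dots> \<le> (\<integral>p. C * width n * indicator (cball (0 :: real \<times> real \<times> real) (3 * M + 2)) p \<partial>lborel)"
    proof (rule Bochner_Integration.integral_mono)
      show "integrable lborel (\<lambda>p. \<bar>S p * slice n p - S p * slice n (e + p)\<bar>)" using i1 i2 by simp
      have "integrable lborel (indicator (cball 0 (3 * M + 2)) :: real \<times> real \<times> real \<Rightarrow> real)"
        by (rule integrable_real_indicator) (simp, rule emeasure_bounded_finite, simp)
      then show "integrable lborel (\<lambda>p :: real \<times> real \<times> real. C * width n * indicator (cball 0 (3 * M + 2)) p)"
        by simp
      fix p :: "real \<times> real \<times> real"
      have "\<bar>S p * slice n p - S p * slice n (e + p)\<bar> = \<bar>slice n p - slice n (e + p)\<bar>"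
        using S1[of p] by (simp add: abs_mult flip: right_diff_distrib)
      also have "\<dots> \<le> C * width n * indicator (cball 0 (3 * M + 2)) p"
      proof (cases "norm p \<le> 3 * M + 2")
        case True
        have "\<bar>slice n p - slice n (e + p)\<bar> \<le> C * width n"
        proof (cases "snd (snd p) > 0")
          case True
          let ?z = "\<lambda>p. (vec3 (fst p) (fst (snd p)) (width n), snd (snd p) + width n)"
          have tt: "snd (snd (e + p)) = snd (snd p)" by (simp add: e_def)
          have "norm (?z p - ?z (e + p)) = width n"
            by (simp add: e_def norm_prod_def norm_vec_def L2_set_def sum_3)
          moreover have "\<bar>\<psi> (?z p) - \<psi> (?z (e + p))\<bar> \<le> C * norm (?z p - ?z (e + p))"
            by (rule \<psi>_Lipschitz) (use True tt in \<open>auto simp del: snd_add fst_add intro: add_pos_pos\<close>)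
          ultimately show ?thesis using True tt by (simp add: slice_def)
        next
          case False
          then have "slice n p = 0" "slice n (e + p) = 0" by (simp_all add: slice_def e_def)
          then show ?thesis using C_nonneg by simp
        qed
        then show ?thesis using True by simp
      next
        case False
        moreover have "norm p \<le> norm (e + p) + norm e"
          using norm_triangle_ineq4[of "e + p" e] by simp
        ultimately have "norm (e + p) > 3 * M + 1" using ne width_le_1[of n] by simp
        then show ?thesis using slice_supp False by simp
      qed
      finally show "\<bar>S p * slice n p - S p * slice n (e + p)\<bar> \<le> C * width n * indicator (cball 0 (3 * M + 2)) p" .
    qed
    also have "\<dots> = C * width n * B" by (simp add: B_def)
    finally show ?thesis by simp
  qed
  then have "\<forall>\<^sub>F n in sequentially. norm (level n) \<le> C * width n * B / 2" by simp
  moreover have "(\<lambda>n. C * width n * B / 2) \<longlonglongrightarrow> 0"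
    using tendsto_mult[OF tendsto_mult[OF tendsto_const width_tendsto, of C] tendsto_const[of "B / 2"]] by simp
  ultimately show ?thesis
    by (rule Lim_null_comparison)
qed

text \<open>The layer balances telescope downwards from height 1.\<close>

lemma flux_above: "(\<integral>z. indicator {width N..<1} (fst z $ 3) * flux z \<partial>lborel) = - level N"
proof (induction N)
  case 0
  then show ?case by (simp add: level_0)
next
  case (Suc N)
  have i: "integrable lborel (\<lambda>z. indicator A (fst z $ 3) * flux z)" if "A \<in> sets borel" for A
    by (rule Bochner_Integration.integrable_bound[OF integrable_flux]) (use that in \<open>auto simp: indicator_def\<close>)
  have "(\<integral>z. indicator {width (Suc N)..<1} (fst z $ 3) * flux z \<partial>lborel)
    = (\<integral>z. indicator {width (N + 1)..<width N} (fst z $ 3) * flux z + indicator {width N..<1} (fst z $ 3) * flux z \<partial>lborel)"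
    using width_antimono[of N "Suc N"] width_le_1[of N]
    by (intro Bochner_Integration.integral_cong) (auto simp: indicator_def)
  also have "\<dots> = (level N - level (N + 1)) - level N"
    using flux_layer[of N] Suc i by simp
  finally show ?case by simp
qed

text \<open>Lowering the height to 0 leaves no boundary term, since \<open>level\<close> tends to 0.
  This is where the weak convergence of the density to 0 at the boundary enters.\<close>

lemma integral_flux: "(\<integral>z. flux z \<partial>lborel) = 0"
proof -
  have "(\<lambda>N. \<integral>z. indicator {width N..<1} (fst z $ 3) * flux z \<partial>lborel) \<longlonglongrightarrow> (\<integral>z. indicator {0<..<1} (fst z $ 3) * flux z \<partial>lborel)"
  proof (rule integral_dominated_convergence[where w = "\<lambda>z. \<bar>flux z\<bar>"])
    show "AE z in lborel. (\<lambda>N. indicator {width N..<1} (fst z $ 3) * flux z) \<longlonglongrightarrow> indicator {0<..<1} (fst z $ 3) * flux z"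
    proof (rule AE_I2)
      fix z :: "(real ^ 3) \<times> real"
      have "\<forall>\<^sub>F N in sequentially. indicator {width N..<1} (fst z $ 3) = (indicator {0<..<1} (fst z $ 3) :: real)"
      proof (cases "fst z $ 3 > 0")
        case True
        have "\<forall>\<^sub>F N in sequentially. width N < fst z $ 3" by (rule order_tendstoD(2)[OF width_tendsto True])
        then show ?thesis by eventually_elim (use True in \<open>simp add: indicator_def\<close>)
      next
        case False
        then have "\<not> width N \<le> fst z $ 3" for N using width_pos(1)[of N] by linarith
        then show ?thesis using False by simp
      qed
      then show "(\<lambda>N. indicator {width N..<1} (fst z $ 3) * flux z) \<longlonglongrightarrow> indicator {0<..<1} (fst z $ 3) * flux z"
        by (intro tendsto_mult tendsto_const tendsto_eventually)
    qed
  qed (use integrable_flux in \<open>auto simp: indicator_def\<close>)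
  moreover have "(\<lambda>N. \<integral>z. indicator {width N..<1} (fst z $ 3) * flux z \<partial>lborel) \<longlonglongrightarrow> 0"
    unfolding flux_above using tendsto_minus[OF level_tendsto] by simp
  ultimately have "(\<integral>z. indicator {0<..<1} (fst z $ 3) * flux z \<partial>lborel) = 0"
    by (rule LIMSEQ_unique)
  \<comment> \<open>At heights from 1 on the density is nonzero only at times beyond 1, where
    \<open>D\<close> vanishes.\<close>
  moreover have "indicator {0<..<1} (fst z $ 3) * flux z = flux z" for z
    using D_late[of z] by (auto simp: indicator_def flux_def rho_def)
  ultimately show ?thesis by simp
qed

end

section \<open>Weak solutions\<close>

lemma closure_halfspace: "closure {x :: real ^ 3. 0 < x $ 3} = {x. 0 \<le> x $ 3}"
proof -
  have "vec3 0 0 1 \<noteq> 0" by (metis vec3_nth(3) zero_index zero_neq_one)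
  then show ?thesis
    using closure_halfspace_gt[of "vec3 0 0 1" 0] by (simp add: inner_commute[of "vec3 _ _ _"] inner_vec3)
qed

lemma integral_lebesgue_on:
  fixes f :: "'a::euclidean_space \<Rightarrow> real"
  assumes "S \<in> sets borel" "f \<in> borel_measurable borel" "\<And>x. x \<in> S \<Longrightarrow> g x = f x" "\<And>x. x \<notin> S \<Longrightarrow> f x = 0"
  shows "(LINT x|lebesgue_on S. g x) = (LINT x|lborel. f x)"
proof -
  have "(LINT x|lebesgue_on S. g x) = (LINT x|lebesgue_on S. f x)"
    by (rule Bochner_Integration.integral_cong) (use assms in \<open>auto simp: space_restrict_space\<close>)
  also have "\<dots> = (LINT x|lebesgue. indicator S x *\<^sub>R f x)"
    using assms(1) by (subst integral_restrict_space) auto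
  also have "\<dots> = (LINT x|lebesgue. f x)"
    by (rule Bochner_Integration.integral_cong) (use assms(4) in \<open>auto simp: indicator_def\<close>)
  also have "\<dots> = (LINT x|lborel. f x)"
    using assms(2) by (intro integral_completion) simp
  finally show ?thesis .
qed

lemma open_cylinder: "open (cylinder {x :: real ^ 3. 0 < x $ 3})"
  unfolding cylinder_def by (intro open_Times open_Collect_less continuous_intros open_greaterThanLessThan)

text \<open>The test functions may be nonzero on the boundary and at time 0, so a vanishing integral
  expresses zero boundary and initial data at once.\<close>

lemma weak_formulation:
  assumes "\<phi> \<in> C1c ({x :: real ^ 3. 0 \<le> x $ 3} \<times> {0..<1 :: real})"
  shows "(LINT z|lebesgue_on (cylinder {x. 0 < x $ 3}). spacetime_field vel (\<lambda>z. c * rho z) z \<bullet> grad \<phi> z) = 0"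
proof -
  obtain \<psi> D C M where *:
    "\<And>z. 0 < fst z $ 3 \<Longrightarrow> 0 < snd z \<Longrightarrow> (\<psi> has_derivative (\<lambda>h. h \<bullet> D z)) (at z)"
    "\<psi> \<in> borel_measurable borel" "D \<in> borel_measurable borel"
    "\<And>z. norm (D z) \<le> C" "\<And>z. \<bar>\<psi> z\<bar> \<le> C"
    "\<And>z. norm z > M \<Longrightarrow> D z = 0" "\<And>z. norm z > M \<Longrightarrow> \<psi> z = 0"
    "\<And>z. snd z \<ge> 1 \<Longrightarrow> \<psi> z = 0"
    "\<And>z. z \<in> cylinder {x. 0 < x $ 3} \<Longrightarrow> grad \<phi> z = D z"
    "\<And>z. z \<notin> cylinder {x. 0 < x $ 3} \<Longrightarrow> D z = 0"
    by (rule C1c_extend[OF assms]) blast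
  interpret transport_test \<psi> D C M
    by unfold_locales (use * in \<open>auto simp: cylinder_def\<close>)
  have "(LINT z|lebesgue_on (cylinder {x. 0 < x $ 3}). spacetime_field vel (\<lambda>z. c * rho z) z \<bullet> grad \<phi> z)
      = (LINT z|lborel. c * flux z)"
  proof (rule integral_lebesgue_on)
    show "cylinder {x :: real ^ 3. 0 < x $ 3} \<in> sets borel" using open_cylinder by (rule borel_open)
    show "(\<lambda>z. c * flux z) \<in> borel_measurable borel" by measurable
    show "spacetime_field vel (\<lambda>z. c * rho z) z \<bullet> grad \<phi> z = c * flux z" if "z \<in> cylinder {x. 0 < x $ 3}" for z
      by (simp add: *(9)[OF that] flux_def spacetime_field_def case_prod_unfold inner_prod_def algebra_simps)
    show "c * flux z = 0" if "z \<notin> cylinder {x. 0 < x $ 3}" for z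
      by (simp add: flux_def *(10)[OF that])
  qed
  then show ?thesis by (simp add: integral_flux)
qed

text \<open>\<open>times_differentiable\<close> gives continuity of each directional derivative
  separately; the gradient is assembled from those along the basis.\<close>

lemma test_function_C1:
  assumes "test_function W \<phi>"
  obtains D where "continuous_on UNIV D" "\<And>z. (\<phi> has_derivative (\<lambda>h. h \<bullet> D z)) (at z)"
proof
  define D where "D z = (\<Sum>b\<in>Basis. frechet_derivative \<phi> (at z) b *\<^sub>R b)" for z
  have "times_differentiable (Suc 0) \<phi>" using assms unfolding test_function_def by blast
  \<comment> \<open>Here \<open>width\<close> is a bound variable, the direction of differentiation,
    and not the dyadic constant.\<close>
  then have d: "\<phi> differentiable (at z)" and c: "continuous_on UNIV (\<lambda>z. frechet_derivative \<phi> (at z) width)" for z width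
    by auto
  show "continuous_on UNIV D" unfolding D_def by (intro continuous_intros c)
  fix z
  let ?f = "frechet_derivative \<phi> (at z)"
  have f: "(\<phi> has_derivative ?f) (at z)" using d frechet_derivative_works by blast
  then have lin: "linear ?f" using has_derivative_linear by blast
  have "?f h = h \<bullet> D z" for h
  proof -
    have "?f h = ?f (\<Sum>b\<in>Basis. (h \<bullet> b) *\<^sub>R b)" by (simp add: euclidean_representation)
    also have "\<dots> = (\<Sum>b\<in>Basis. (h \<bullet> b) * ?f b)"
      by (simp add: linear_sum[OF lin] linear_scale[OF lin])
    also have "\<dots> = h \<bullet> D z" by (simp add: D_def inner_sum_right mult.commute)
    finally show ?thesis .
  qed
  then have "?f = (\<lambda>h. h \<bullet> D z)" by (rule ext)
  with f show "(\<phi> has_derivative (\<lambda>h. h \<bullet> D z)) (at z)" by simp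
qed

text \<open>Reduces the lateral trace and the space-time divergence to
  \<open>weak_formulation\<close>. The support may cross the boundary plane, so only its part in the
  closed half-space serves as the compact set.\<close>

lemma test_function_slab_C1c:
  assumes "test_function (UNIV \<times> {0<..<1}) \<phi>"
  shows "\<phi> \<in> C1c ({x :: real ^ 3. 0 \<le> x $ 3} \<times> {0..<1 :: real})"
proof -
  let ?S = "{x :: real ^ 3. 0 \<le> x $ 3} \<times> {0..<1 :: real}"
  let ?K = "closure {z. \<phi> z \<noteq> 0} \<inter> ({x. 0 \<le> x $ 3} \<times> UNIV)"
  obtain D where D: "continuous_on UNIV D" "\<And>z. (\<phi> has_derivative (\<lambda>h. h \<bullet> D z)) (at z)"
    by (rule test_function_C1[OF assms]) blast
  have supp: "compact (closure {z. \<phi> z \<noteq> 0})" "closure {z. \<phi> z \<noteq> 0} \<subseteq> UNIV \<times> {0<..<1}"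
    using assms by (auto simp: test_function_def)
  have "closed ({x :: real ^ 3. 0 \<le> x $ 3} \<times> (UNIV :: real set))"
    by (intro closed_Times closed_Collect_le continuous_intros closed_UNIV)
  then have "compact ?K" using supp(1) by (rule compact_Int_closed[rotated])
  moreover have "?K \<subseteq> ?S"
  proof
    fix z assume "z \<in> ?K"
    then have "z \<in> UNIV \<times> {0<..<1}" "0 \<le> fst z $ 3" using supp(2) by auto
    then show "z \<in> ?S" by (simp add: mem_Times_iff)
  qed
  moreover have "\<phi> z = 0" if "z \<in> ?S - ?K" for z
  proof (rule ccontr)
    assume "\<phi> z \<noteq> 0"
    then have "z \<in> closure {z. \<phi> z \<noteq> 0}" by (intro subsetD[OF closure_subset]) simp
    then show False using that by (simp add: mem_Times_iff)
  qed
  moreover have "continuous_on ?S D" using D(1) continuous_on_subset by blast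
  moreover have "(\<phi> has_derivative (\<lambda>h. h \<bullet> D z)) (at z within ?S)" for z
    using D(2) by (rule has_derivative_at_withinI)
  ultimately show ?thesis
    unfolding C1c_def mem_Collect_eq by (intro conjI exI[of _ D] exI[of _ ?K] ballI)
qed

text \<open>The lateral trace is 0, so the condition on entering characteristics holds whatever
  representative \<open>g\<close> is taken.\<close>

lemma rho_weak_solution:
  fixes \<Omega> :: "(real ^ 3) set"
  defines "\<Omega> \<equiv> {x. 0 < x $ 3}"
  assumes g: "has_normal_trace \<Omega> vel g"
  shows "weak_solution \<Omega> vel (\<lambda>z. c * rho z)"
proof -
  let ?I = "\<lambda>\<phi>. LINT z|lebesgue_on (cylinder \<Omega>). spacetime_field vel (\<lambda>z. c * rho z) z \<bullet> grad \<phi> z"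
  have slab: "?I \<phi> = 0" if "test_function (UNIV \<times> {0<..<1}) \<phi>" for \<phi>
    using weak_formulation[OF test_function_slab_C1c[OF that]] by (simp add: \<Omega>_def)
  have "(\<lambda>z. c * rho z) \<in> Linfty (lebesgue_on (cylinder \<Omega>))"
  proof -
    have "(\<lambda>z. c * rho z) \<in> borel_measurable borel" by measurable
    then have "(\<lambda>z. c * rho z) \<in> borel_measurable (lebesgue_on (cylinder \<Omega>))"
      by (intro measurable_restrict_space1 measurable_completion) simp
    moreover have "norm (c * rho z) \<le> \<bar>c\<bar>" for z
      using abs_rho_le[of z] by (simp add: abs_mult mult_left_le)
    ultimately show ?thesis unfolding Linfty_def by (auto intro!: exI[of _ "\<bar>c\<bar>"])
  qed
  moreover have "weakly_divergence_free (cylinder \<Omega>) (spacetime_field vel (\<lambda>z. c * rho z))"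
    unfolding weakly_divergence_free_def
  proof (intro allI impI)
    fix \<phi> :: "(real ^ 3) \<times> real \<Rightarrow> real" assume "test_function (cylinder \<Omega>) \<phi>"
    then have "test_function (UNIV \<times> {0<..<1}) \<phi>"
      unfolding test_function_def cylinder_def by auto
    then show "?I \<phi> = 0" by (rule slab)
  qed
  moreover have "has_lateral_trace \<Omega> vel (\<lambda>z. c * rho z) (\<lambda>_. 0)"
    unfolding has_lateral_trace_def normal_trace_def using slab
    by (auto simp: Linfty_def intro: exI[of _ 0])
  moreover have "?I \<phi> = 0" if "\<phi> \<in> C1c (closure \<Omega> \<times> {0..<1})" for \<phi>
    using weak_formulation[of \<phi>] that by (simp add: \<Omega>_def closure_halfspace)
  ultimately show ?thesis
    unfolding weak_solution_def using g by (intro conjI exI[of _ g] exI[of _ "\<lambda>_. 0"] ballI) simp_all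
qed

text \<open>Distinct multiples differ at every point of the wedge \<open>W\<close> between boundary
  and front: it is open and nonempty, and the density has modulus 1 there. Hence they lie in
  distinct classes.\<close>

lemma infinite_weak_solutions:
  fixes \<Omega> :: "(real ^ 3) set"
  defines "\<Omega> \<equiv> {x. 0 < x $ 3}"
  assumes g: "has_normal_trace \<Omega> vel g"
  shows "infinite ({\<rho>. weak_solution \<Omega> vel \<rho>} // ae_equal (lebesgue_on (cylinder \<Omega>)))"
proof -
  let ?M = "lebesgue_on (cylinder \<Omega>)"
  define W where "W = {z :: (real ^ 3) \<times> real. 0 < fst z $ 3 \<and> fst z $ 3 < snd z \<and> snd z < 1}"
  have "open W" unfolding W_def by (intro open_Collect_conj open_Collect_less continuous_intros)
  moreover have "(vec3 0 0 (1/4), 1/2) \<in> W" by (simp add: W_def)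
  ultimately have W: "\<not> negligible W" using open_not_negligible by blast
  have inj: "inj (\<lambda>c. ae_equal ?M `` {\<lambda>z. c * rho z})"
  proof (rule injI, rule ccontr)
    fix c c' :: real assume eq: "ae_equal ?M `` {\<lambda>z. c * rho z} = ae_equal ?M `` {\<lambda>z. c' * rho z}" and ne: "c \<noteq> c'"
    have "(\<lambda>z. c' * rho z) \<in> ae_equal ?M `` {\<lambda>z. c' * rho z}" by (simp add: ae_equal_def)
    then have "AE z in ?M. c * rho z = c' * rho z" unfolding eq[symmetric] by (simp add: ae_equal_def)
    then have "AE z in ?M. rho z = 0" by eventually_elim (use ne in auto)
    then have "AE z in lebesgue. z \<in> cylinder \<Omega> \<longrightarrow> rho z = 0"
      using open_cylinder by (subst (asm) AE_restrict_space_iff) (auto simp: \<Omega>_def)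
    then have "AE z in lebesgue. z \<notin> W"
    proof eventually_elim
      case (elim z)
      have "\<bar>rho z\<bar> = 1" "z \<in> cylinder \<Omega>" if "z \<in> W"
        using that by (simp_all add: W_def cylinder_def \<Omega>_def rho_def mem_Times_iff)
      then show ?case using elim by force
    qed
    then have "W \<in> null_sets lebesgue" using \<open>open W\<close> by (subst (asm) AE_iff_null_sets[symmetric]) auto
    then show False using W by (simp add: negligible_iff_null_sets)
  qed
  have "range (\<lambda>c. ae_equal ?M `` {\<lambda>z. c * rho z}) \<subseteq> {\<rho>. weak_solution \<Omega> vel \<rho>} // ae_equal ?M"
    using rho_weak_solution[of g] g unfolding \<Omega>_def by (auto intro!: quotientI)
  moreover have "infinite (range (\<lambda>c :: real. ae_equal ?M `` {\<lambda>z. c * rho z}))"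
    using finite_imageD[OF _ inj] infinite_UNIV_char_0 by blast
  ultimately show ?thesis by (rule infinite_super)
qed

section \<open>Normal traces\<close>

definition insert_coord :: "3 \<Rightarrow> (real \<times> real) \<times> real \<Rightarrow> real ^ 3" where
  "insert_coord k z = (if k = 1 then vec3 (snd z) (fst (fst z)) (snd (fst z))
    else if k = 2 then vec3 (fst (fst z)) (snd z) (snd (fst z))
    else vec3 (fst (fst z)) (snd (fst z)) (snd z))"

lemma insert_coord_cases:
  obtains "k = 1" "insert_coord k = (\<lambda>z. vec3 (snd z) (fst (fst z)) (snd (fst z)))"
  | "k = 2" "insert_coord k = (\<lambda>z. vec3 (fst (fst z)) (snd z) (snd (fst z)))"
  | "k = 3" "insert_coord k = (\<lambda>z. vec3 (fst (fst z)) (snd (fst z)) (snd z))"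
  using exhaust_3[of k] by (auto simp: insert_coord_def[abs_def])

lemma linear_insert_coord: "linear (insert_coord k)"
  by (rule linearI) (auto simp: insert_coord_def vec3_arith)

lemma borel_measurable_insert_coord [measurable]: "insert_coord k \<in> borel_measurable borel"
proof (cases k rule: insert_coord_cases)
  case 1
  show ?thesis unfolding 1(2) by measurable
next
  case 2
  show ?thesis unfolding 2(2) by measurable
next
  case 3
  show ?thesis unfolding 3(2) by measurable
qed

lemma distr_insert_coord: "distr lborel borel (insert_coord k) = lborel"
proof (rule lborel_distr_Basis[OF linear_insert_coord])
  show "bij_betw (insert_coord k) Basis Basis"
    unfolding bij_betw_def
    by (cases k rule: insert_coord_cases) (auto simp: inj_on_def Basis_prod_def Basis_real3 image_Un image_image zero_prod_def)
qed

lemma norm_insert_coord: "norm (insert_coord k z) = norm z"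
  by (simp add: insert_coord_def norm_prod_def norm_vec_def L2_set_def sum_3 power2_eq_square[symmetric] add_ac)

lemma insert_coord_nth [simp]: "insert_coord k (p, t) $ k = t"
  using exhaust_3[of k] by (auto simp: insert_coord_def)

lemma insert_coord_line: "insert_coord k (p, t) = insert_coord k (p, 0) + t *\<^sub>R insert_coord k (0, 1)"
  by (auto simp: insert_coord_def vec3_arith zero_prod_def)

lemma inner_insert_coord: "x \<bullet> insert_coord k (0, 1) = x $ k"
  using exhaust_3[of k] by (auto simp: insert_coord_def inner_vec3)

lemma integral_insert_coord:
  fixes G :: "real ^ 3 \<Rightarrow> real"
  assumes "integrable lborel G"
  shows "(\<integral>x. G x \<partial>lborel) = (\<integral>p. (\<integral>t. G (insert_coord k (p, t)) \<partial>lborel) \<partial>lborel)"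
proof -
  have m: "G \<in> borel_measurable borel" using borel_measurable_integrable[OF assms] by simp
  have "(\<integral>x. G x \<partial>lborel) = (\<integral>z. G (insert_coord k z) \<partial>lborel)"
    by (rule integral_lborel_preserving(1)[OF distr_insert_coord borel_measurable_insert_coord m, symmetric])
  also have "\<dots> = (\<integral>p. (\<integral>t. G (insert_coord k (p, t)) \<partial>lborel) \<partial>lborel)"
    using integral_lborel_preserving(2)[OF distr_insert_coord borel_measurable_insert_coord m, of k] assms
    by (intro integral_lborel_fst[symmetric]) simp
  finally show ?thesis .
qed

section \<open>Integrals of derivatives along lines parallel to the axes\<close>

locale compact_C1 =
  fixes g :: "real ^ 3 \<Rightarrow> real" and D :: "real ^ 3 \<Rightarrow> real ^ 3" and C M :: real
  assumes der: "\<And>x. (g has_derivative (\<lambda>h. h \<bullet> D x)) (at x)"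
    and meas [measurable]: "D \<in> borel_measurable borel"
    and D_bound: "\<And>x. norm (D x) \<le> C"
    and D_supp: "\<And>x. norm x > M \<Longrightarrow> D x = 0" and g_supp: "\<And>x. norm x > M \<Longrightarrow> g x = 0"
begin

lemma der_insert_coord: "((\<lambda>t. g (insert_coord k (p, t))) has_real_derivative D (insert_coord k (p, t)) $ k) (at t)"
proof -
  have "((\<lambda>t. insert_coord k (p, t)) has_derivative (\<lambda>h. h *\<^sub>R insert_coord k (0, 1))) (at t)"
    by (subst insert_coord_line) (auto intro!: derivative_eq_intros)
  from has_derivative_compose[OF this der]
  show ?thesis by (simp add: has_field_derivative_def inner_commute[of "insert_coord _ _"] inner_insert_coord mult_commute_abs)
qed

lemma D_nth_bound: "\<bar>D x $ k\<bar> \<le> C"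
  using component_le_norm_cart[of "D x" k] D_bound[of x] by simp

lemma insert_coord_supp: "\<bar>t\<bar> > M \<Longrightarrow> D (insert_coord k (p, t)) = 0" "\<bar>t\<bar> > M \<Longrightarrow> g (insert_coord k (p, t)) = 0"
  "norm p > M \<Longrightarrow> D (insert_coord k (p, t)) = 0" "norm p > M \<Longrightarrow> g (insert_coord k (p, t)) = 0"
  using norm_fst_snd_le(1,2)[of "(p, t)"] by (auto intro!: D_supp g_supp simp: norm_insert_coord)

lemma borel_measurable_line: "(\<lambda>t. D (insert_coord k (p, t)) $ k) \<in> borel_measurable borel"
  by measurable

lemma integrable_mult_D:
  assumes "f \<in> borel_measurable borel" "\<And>x. \<bar>f x\<bar> \<le> 1"
  shows "integrable lborel (\<lambda>x. f x * D x $ k)"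
proof (rule integrable_bounded_support[where C = C and M = M])
  show "(\<lambda>x. f x * D x $ k) \<in> borel_measurable borel" using assms(1) by measurable
  show "\<bar>f x * D x $ k\<bar> \<le> C" for x
    using mult_mono[OF assms(2)[of x] D_nth_bound[of x k]] by (simp add: abs_mult)
qed (simp add: D_supp)

lemma integral_line: "(\<integral>t. D (insert_coord k (p, t)) $ k \<partial>lborel) = 0"
proof -
  define m where "m = \<bar>M\<bar> + 1"
  have "(\<integral>t. D (insert_coord k (p, t)) $ k \<partial>lborel) = (\<integral>t. indicator {- m..<m} t * D (insert_coord k (p, t)) $ k \<partial>lborel)"
  proof (rule Bochner_Integration.integral_cong[OF refl])
    fix t show "D (insert_coord k (p, t)) $ k = indicator {- m..<m} t * D (insert_coord k (p, t)) $ k"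
      using insert_coord_supp(1)[of t k p] by (cases "t \<in> {- m..<m}") (auto simp: m_def)
  qed
  also have "\<dots> = g (insert_coord k (p, m)) - g (insert_coord k (p, - m))"
    by (rule integral_FTC_Ico[OF _ borel_measurable_line D_nth_bound der_insert_coord]) (simp add: m_def)
  also have "\<dots> = 0" using insert_coord_supp(2)[of m k p] insert_coord_supp(2)[of "- m" k p] by (simp add: m_def)
  finally show ?thesis .
qed

text \<open>Applied to the horizontal components of the field, each of which is independent of its
  own coordinate: on every line the integral of the derivative of a compactly supported function is
  0.\<close>

lemma integral_independent:
  assumes "f \<in> borel_measurable borel" "\<And>x. \<bar>f x\<bar> \<le> 1"
    and indep: "\<And>p t. f (insert_coord k (p, t)) = f (insert_coord k (p, 0))"
  shows "(\<integral>x. f x * D x $ k \<partial>lborel) = 0"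
  unfolding integral_insert_coord[OF integrable_mult_D[OF assms(1,2)], of k k]
  by (subst indep) (simp add: integral_line)

lemma integral_halfspace:
  "(\<integral>x. indicator {0<..} (x $ 3) * D x $ 3 \<partial>lborel) = - (\<integral>p. g (plane p) \<partial>lborel)"
proof -
  define m where "m = \<bar>M\<bar> + 1"
  have "integrable lborel (\<lambda>x. indicator {0<..} (x $ 3) * D x $ 3)"
  proof (rule integrable_mult_D)
    show "(\<lambda>x :: real ^ 3. indicator {0<..} (x $ 3) :: real) \<in> borel_measurable borel"
      by (rule measurable_compose[of "\<lambda>x. x $ 3" borel borel]) measurable
  qed (simp add: indicator_def)
  from integral_insert_coord[OF this, of 3]
  have "(\<integral>x. indicator {0<..} (x $ 3) * D x $ 3 \<partial>lborel)
    = (\<integral>p. (\<integral>t. indicator {0<..} t * D (insert_coord 3 (p, t)) $ 3 \<partial>lborel) \<partial>lborel)" by simp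
  also have "\<dots> = (\<integral>p. - g (plane p) \<partial>lborel)"
  proof (rule Bochner_Integration.integral_cong[OF refl])
    fix p :: "real \<times> real"
    have "(\<integral>t. indicator {0<..} t * D (insert_coord 3 (p, t)) $ 3 \<partial>lborel)
      = (\<integral>t. indicator {0..<m} t * D (insert_coord 3 (p, t)) $ 3 \<partial>lborel)"
    proof (rule integral_cong_AE)
      show "AE t in lborel. indicator {0<..} t * D (insert_coord 3 (p, t)) $ 3 = indicator {0..<m} t * D (insert_coord 3 (p, t)) $ 3"
        using AE_lborel_singleton[of 0]
      proof eventually_elim
        case (elim t)
        then show ?case
          using insert_coord_supp(1)[of t 3 p] by (cases "\<bar>t\<bar> > M") (auto simp: indicator_def m_def)
      qed
    qed measurable
    also have "\<dots> = g (insert_coord 3 (p, m)) - g (insert_coord 3 (p, 0))"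
      by (rule integral_FTC_Ico[OF _ borel_measurable_line D_nth_bound der_insert_coord]) (simp add: m_def)
    also have "g (insert_coord 3 (p, m)) = 0" using insert_coord_supp(2)[of m 3 p] by (simp add: m_def)
    also have "insert_coord 3 (p, 0) = plane p" by (simp add: insert_coord_def plane_def vec3_def)
    finally show "(\<integral>t. indicator {0<..} t * D (insert_coord 3 (p, t)) $ 3 \<partial>lborel) = - g (plane p)" by simp
  qed
  finally show ?thesis by simp
qed

end

lemma compact_C1_test_function:
  fixes \<phi> :: "real ^ 3 \<Rightarrow> real"
  assumes \<phi>: "test_function UNIV \<phi>"
  obtains D C M where "compact_C1 \<phi> D C M" "\<And>x. grad \<phi> x = D x"
proof -
  define K where "K = closure {x. \<phi> x \<noteq> 0}"
  have K: "compact K" "open (- K)" using \<phi> by (auto simp: test_function_def K_def)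
  obtain D where D: "continuous_on UNIV D" "\<And>x. (\<phi> has_derivative (\<lambda>h. h \<bullet> D x)) (at x)"
    by (rule test_function_C1[OF \<phi>]) blast
  have \<phi>0: "\<phi> x = 0" if "x \<notin> K" for x
    using that subsetD[OF closure_subset, of x "{x. \<phi> x \<noteq> 0}"] unfolding K_def by auto
  have D0: "D x = 0" if x: "x \<notin> K" for x
  proof -
    have "(\<phi> has_derivative (\<lambda>h. 0)) (at x)"
    proof (rule has_derivative_transform_within_open[of "\<lambda>_. 0" _ _ _ "- K"])
      show "0 = \<phi> z" if "z \<in> - K" for z using \<phi>0[of z] that by simp
    qed (use x K(2) in simp_all)
    from has_derivative_unique[OF this D(2)] have "D x \<bullet> D x = 0" by (simp add: fun_eq_iff)
    then show ?thesis by simp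
  qed
  obtain M where M: "\<And>x. x \<in> K \<Longrightarrow> norm x \<le> M"
    using compact_imp_bounded[OF K(1)] unfolding bounded_iff by auto
  have "bounded (D ` K)"
    by (intro compact_imp_bounded compact_continuous_image K(1)) (rule continuous_on_subset[OF D(1) subset_UNIV])
  then obtain C where C: "\<And>x. x \<in> K \<Longrightarrow> norm (D x) \<le> C" unfolding bounded_iff by auto
  show thesis
  proof (rule that[of D "max 0 C" M])
    show "compact_C1 \<phi> D (max 0 C) M"
    proof
      show "norm (D x) \<le> max 0 C" for x using C[of x] D0[of x] by (cases "x \<in> K") auto
      have "x \<notin> K" if "norm x > M" for x using M[of x] that by linarith
      then show "D x = 0" "\<phi> x = 0" if "norm x > M" for x
        using D0[of x] \<phi>0[of x] that by simp_all
    qed (use D in \<open>simp_all add: borel_measurable_continuous_onI\<close>)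
    show "grad \<phi> x = D x" for x by (rule grad_eqI[OF D(2)])
  qed
qed

lemma finite_surface_compact:
  assumes "compact K" "K \<subseteq> range plane"
  shows "emeasure (surface_measure {x :: real ^ 3. 0 < x $ 3}) K < \<infinity>"
proof -
  have cl: "range plane \<in> sets borel" unfolding range_plane by measurable
  have K: "K \<in> sets borel" using assms(1) by (simp add: borel_compact)
  have mp: "plane \<in> lborel \<rightarrow>\<^sub>M restrict_space borel (range plane)"
    by (auto intro!: measurable_restrict_space2)
  have "emeasure (surface_measure {x :: real ^ 3. 0 < x $ 3}) K = emeasure lborel (plane -` K)"
    unfolding surface_measure_halfspace using K assms(2) cl mp
    by (subst emeasure_distr) (auto simp: sets_restrict_space)
  also have "\<dots> < \<infinity>"
  proof (rule emeasure_bounded_finite)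
    obtain e where "\<forall>x\<in>K. \<forall>y\<in>K. dist x y \<le> e"
      using compact_imp_bounded[OF assms(1)] unfolding bounded_two_points by blast
    then show "bounded (plane -` K)"
      unfolding bounded_two_points by (intro exI[of _ e]) (auto simp flip: dist_plane)
  qed
  finally show ?thesis .
qed

lemma space_surface: "space (surface_measure {x :: real ^ 3. 0 < x $ 3}) = range plane"
  unfolding surface_measure_halfspace by (simp add: space_restrict_space)

text \<open>The horizontal components contribute nothing, as they do not depend on their own
  coordinate. The vertical component is 1, and the fundamental theorem on each vertical half-line
  produces the boundary value with sign \<open>- 1\<close>.\<close>

lemma vel_normal_trace: "has_normal_trace {x :: real ^ 3. 0 < x $ 3} vel (\<lambda>_. - 1)"
  unfolding has_normal_trace_def
proof (intro conjI allI impI)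
  let ?\<Omega> = "{x :: real ^ 3. 0 < x $ 3}"
  show "(\<lambda>_. - 1) \<in> Linfty (surface_measure ?\<Omega>)" by (auto simp: Linfty_def)
  fix \<phi> :: "real ^ 3 \<Rightarrow> real" assume \<phi>: "test_function UNIV \<phi>"
  obtain D C M where "compact_C1 \<phi> D C M" and grad: "\<And>x. grad \<phi> x = D x"
    by (rule compact_C1_test_function[OF \<phi>]) blast
  then interpret compact_C1 \<phi> D C M by simp
  define f where "f k x = indicator {0<..} (x $ 3) * vel x $ k" for k :: 3 and x :: "real ^ 3"
  have f [measurable]: "f k \<in> borel_measurable borel" for k unfolding f_def[abs_def] by measurable
  have f1: "\<bar>f k x\<bar> \<le> 1" for k x using vel_bound[of x k] by (simp add: f_def indicator_def)
  have "normal_trace ?\<Omega> vel \<phi> = (\<integral>x. indicator {0<..} (x $ 3) * (vel x \<bullet> D x) \<partial>lborel)"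
    unfolding normal_trace_def
    by (rule integral_lebesgue_on) (auto simp: grad indicator_def)
  also have "\<dots> = (\<integral>x. f 1 x * D x $ 1 + f 2 x * D x $ 2 + f 3 x * D x $ 3 \<partial>lborel)"
    by (rule Bochner_Integration.integral_cong[OF refl])
      (simp add: f_def inner_vec_def sum_3 algebra_simps)
  also have "\<dots> = (\<integral>x. f 1 x * D x $ 1 \<partial>lborel) + (\<integral>x. f 2 x * D x $ 2 \<partial>lborel) + (\<integral>x. f 3 x * D x $ 3 \<partial>lborel)"
    by (simp add: integrable_mult_D[OF f f1])
  also have "(\<integral>x. f 1 x * D x $ 1 \<partial>lborel) = 0"
    by (rule integral_independent[OF f f1]) (simp add: f_def insert_coord_def vel_def)
  also have "(\<integral>x. f 2 x * D x $ 2 \<partial>lborel) = 0"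
    by (rule integral_independent[OF f f1]) (simp add: f_def insert_coord_def vel_def)
  also have "(\<integral>x. f 3 x * D x $ 3 \<partial>lborel) = - (\<integral>p. \<phi> (plane p) \<partial>lborel)"
    using integral_halfspace by (simp add: f_def)
  also have "0 + 0 + - (\<integral>p. \<phi> (plane p) \<partial>lborel) = (\<integral>p. - 1 * \<phi> (plane p) \<partial>lborel)" by simp
  also have "\<dots> = (LINT x|surface_measure ?\<Omega>. - 1 * \<phi> x)"
  proof -
    have "\<phi> \<in> borel_measurable borel"
      by (intro borel_measurable_continuous_onI has_derivative_continuous_on[of _ _ "\<lambda>x h. h \<bullet> D x"])
        (simp add: der)
    then show ?thesis unfolding surface_measure_halfspace
      by (subst integral_distr) (auto intro!: measurable_restrict_space1 measurable_restrict_space2)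
  qed
  finally show "normal_trace ?\<Omega> vel \<phi> = (LINT x|surface_measure ?\<Omega>. - 1 * \<phi> x)" .
qed

text \<open>A special case of the trace formula: a test function supported in the open half-space
  vanishes on the boundary.\<close>

lemma weakly_divergence_free_vel: "weakly_divergence_free {x :: real ^ 3. 0 < x $ 3} vel"
  unfolding weakly_divergence_free_def
proof (intro allI impI)
  let ?\<Omega> = "{x :: real ^ 3. 0 < x $ 3}"
  fix \<phi> :: "real ^ 3 \<Rightarrow> real" assume \<phi>: "test_function ?\<Omega> \<phi>"
  then have "test_function UNIV \<phi>" by (simp add: test_function_def)
  then have "normal_trace ?\<Omega> vel \<phi> = (LINT x|surface_measure ?\<Omega>. - 1 * \<phi> x)"
    using vel_normal_trace by (simp add: has_normal_trace_def)
  also have "\<dots> = (LINT x|surface_measure ?\<Omega>. 0)"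
  proof (rule Bochner_Integration.integral_cong[OF refl])
    fix x assume "x \<in> space (surface_measure ?\<Omega>)"
    then have "x \<notin> ?\<Omega>" by (auto simp: space_surface range_plane)
    then have "x \<notin> closure {x. \<phi> x \<noteq> 0}" using \<phi> by (auto simp: test_function_def)
    then show "- 1 * \<phi> x = 0" using subsetD[OF closure_subset, of x "{x. \<phi> x \<noteq> 0}"] by auto
  qed
  finally show "(LINT y|lebesgue_on ?\<Omega>. vel y \<bullet> grad \<phi> y) = 0" by (simp add: normal_trace_def)
qed

section \<open>The normal Lebesgue trace\<close>

lemma infdist_plane:
  assumes "0 \<le> z $ 3"
  shows "infdist z (range plane) = z $ 3"
proof (rule antisym)
  let ?q = "plane (z $ 1, z $ 2)"
  have "dist z ?q = z $ 3"
    using assms by (simp add: dist_vec_def L2_set_def sum_3 plane_def dist_real_def)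
  then show "infdist z (range plane) \<le> z $ 3"
    using infdist_le[of ?q "range plane" z] by simp
  show "z $ 3 \<le> infdist z (range plane)"
  proof (subst infdist_notempty, simp, rule cINF_greatest)
    fix q assume "q \<in> range plane"
    then have "q $ 3 = 0" by (simp add: range_plane)
    then show "z $ 3 \<le> dist z q"
      using component_le_norm_cart[of "z - q" 3] by (simp add: dist_norm)
  qed simp
qed

text \<open>In the half-space the gradient of the distance is the vertical unit vector and the
  vertical component of the field is 1, so the integrand is identically 0 for every centre and
  radius.\<close>

lemma vel_Lebesgue_trace: "has_outward_Lebesgue_trace {x :: real ^ 3. 0 < x $ 3} vel (\<lambda>_. - 1)"
  unfolding has_outward_Lebesgue_trace_def has_inward_Lebesgue_trace_def
proof (intro conjI allI impI AE_I2)
  let ?\<Omega> = "{x :: real ^ 3. 0 < x $ 3}"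
  show "(\<lambda>x. - (- 1)) \<in> L1_loc (surface_measure ?\<Omega>)"
    unfolding L1_loc_def
  proof (clarsimp simp: space_surface)
    fix K assume K: "compact K" "K \<subseteq> range plane"
    have "K \<in> sets (surface_measure ?\<Omega>)"
      unfolding surface_measure_halfspace using K by (auto simp: sets_restrict_space borel_compact intro!: image_eqI[of _ _ K])
    then show "set_integrable (surface_measure ?\<Omega>) K (\<lambda>x. 1 :: real)"
      unfolding set_integrable_def using finite_surface_compact[OF K] by simp
  qed
  fix r :: "nat \<Rightarrow> real" and x :: "real ^ 3"
  have g: "grad (\<lambda>z. infdist z (frontier ?\<Omega>)) y = vec3 0 0 1" if y: "y \<in> ?\<Omega>" for y
  proof (rule grad_eqI)
    have "((\<lambda>z :: real ^ 3. z \<bullet> vec3 0 0 1) has_derivative (\<lambda>h. h \<bullet> vec3 0 0 1)) (at y)"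
      by (auto intro!: derivative_eq_intros)
    then show "((\<lambda>z. infdist z (frontier ?\<Omega>)) has_derivative (\<lambda>h. h \<bullet> vec3 0 0 1)) (at y)"
    proof (rule has_derivative_transform_within_open[of _ _ _ _ ?\<Omega>])
      show "open ?\<Omega>" by (intro open_Collect_less continuous_intros)
      show "z \<bullet> vec3 0 0 1 = infdist z (frontier ?\<Omega>)" if "z \<in> ?\<Omega>" for z
        using that by (simp add: inner_vec3 frontier_halfspace infdist_plane)
    qed (rule y)
  qed
  have "(LINT y|lebesgue_on (ball x (r k) \<inter> ?\<Omega>).
      \<bar>vel y \<bullet> grad (\<lambda>z. infdist z (frontier ?\<Omega>)) y - (- (- 1))\<bar>) = (LINT y|lebesgue_on (ball x (r k) \<inter> ?\<Omega>). 0)" for k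
    by (rule Bochner_Integration.integral_cong[OF refl]) (auto simp: space_restrict_space g inner_vec3)
  then show "(\<lambda>k. (1 / r k ^ DIM(real ^ 3)) * (LINT y|lebesgue_on (ball x (r k) \<inter> ?\<Omega>).
      \<bar>vel y \<bullet> grad (\<lambda>z. infdist z (frontier ?\<Omega>)) y - (- (- 1))\<bar>)) \<longlonglongrightarrow> 0" by simp
qed

section \<open>Local bounded variation\<close>

definition snap :: "real \<Rightarrow> real \<Rightarrow> real" where
  "snap h x = h * of_int \<lfloor>x / h\<rfloor>"

lemma le_snap_iff: "h > 0 \<Longrightarrow> h * of_int i \<le> snap h x \<longleftrightarrow> h * of_int i \<le> x"
proof -
  assume h: "h > 0"
  have "h * of_int i \<le> snap h x \<longleftrightarrow> i \<le> \<lfloor>x / h\<rfloor>" using h by (simp add: snap_def)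
  also have "\<dots> \<longleftrightarrow> h * of_int i \<le> x" using h by (simp add: le_floor_iff field_simps)
  finally show ?thesis .
qed

lemma snap_le: "h > 0 \<Longrightarrow> snap h x \<le> x"
  using le_snap_iff[of h "\<lfloor>x / h\<rfloor>" x] by (simp add: snap_def)

lemma snap_idem: "h > 0 \<Longrightarrow> snap h (snap h x) = snap h x"
  by (simp add: snap_def)

lemma borel_measurable_snap [measurable]: "snap h \<in> borel_measurable borel"
  unfolding snap_def[abs_def] by measurable

lemma width_multiple: "m \<le> n \<Longrightarrow> width m = width n * of_int (2 ^ (n - m))"
  by (auto simp: width_def power_add power_one_over dest!: le_Suc_ex)

text \<open>Rounding down to a dyadic grid does not affect comparisons with multiples of coarser
  mesh sizes, and the field depends on its argument only through such comparisons.\<close>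

lemma width_le_snap_iff:
  assumes "m \<le> n"
  shows "of_int k * width m \<le> snap (width n) x \<longleftrightarrow> of_int k * width m \<le> x"
  using le_snap_iff[of "width n" "k * 2 ^ (n - m)" x] width_multiple[OF assms] by (simp add: mult_ac)

lemma square_wave_snap:
  assumes "m \<le> n"
  shows "square_wave m (snap (width n) x) = square_wave m x"
proof -
  have "k \<le> \<lfloor>snap (width n) x / width m\<rfloor> \<longleftrightarrow> k \<le> \<lfloor>x / width m\<rfloor>" for k
    using width_le_snap_iff[OF assms, of k x] by (simp add: le_floor_iff pos_le_divide_eq)
  then have "\<lfloor>snap (width n) x / width m\<rfloor> = \<lfloor>x / width m\<rfloor>" by (meson order_antisym order_refl)
  then show ?thesis by (simp add: square_wave_def)
qed

lemma shear_speed_snap: "m + 2 \<le> n \<Longrightarrow> shear_speed m (snap (width n) x) = shear_speed m x"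
  by (simp add: shear_speed_def square_wave_snap)

definition corner :: "real \<Rightarrow> real ^ 3 \<Rightarrow> real ^ 3" where
  "corner h x = vec3 (snap h (x $ 1)) (snap h (x $ 2)) (snap h (x $ 3))"

lemma borel_measurable_corner [measurable]: "corner h \<in> borel_measurable borel"
  unfolding corner_def[abs_def] by measurable

text \<open>Above height \<open>width N\<close> only layers \<open>n\<close> with
  \<open>n + 1 \<le> N\<close> occur. Their shears involve \<open>square_wave (n + 2)\<close> at the
  finest, hence the mesh \<open>width (N + 1)\<close>.\<close>

lemma vel_corner:
  assumes "width N \<le> x $ 3"
  shows "vel (corner (width (N + 1)) x) = vel x"
proof -
  let ?h = "width (N + 1)"
  let ?s = "x $ 3"
  have one: "1 \<le> snap ?h ?s \<longleftrightarrow> 1 \<le> ?s"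
    using width_le_snap_iff[of 0 "N + 1" 1 ?s] by simp
  have pos: "0 < ?s" using assms width_pos(1)[of N] by linarith
  have "layer_of (snap ?h ?s) = layer_of ?s" "layer_of ?s + 2 \<le> N + 1" if "?s < 1"
  proof -
    note b = layer_of_bounds[OF pos that]
    have "width N < width (layer_of ?s)" using assms b by simp
    then have l: "layer_of ?s + 1 \<le> N" using width_antimono[of N "layer_of ?s"] by (cases "layer_of ?s + 1 \<le> N") auto
    then show "layer_of ?s + 2 \<le> N + 1" by simp
    have "width (layer_of ?s + 1) \<le> snap ?h ?s"
      using width_le_snap_iff[of "layer_of ?s + 1" "N + 1" 1 ?s] l b by simp
    moreover have "snap ?h ?s < width (layer_of ?s)" using snap_le[of ?h ?s] b by simp
    ultimately show "layer_of (snap ?h ?s) = layer_of ?s" by (rule layer_of_eq)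
  qed
  then show ?thesis
    using one by (cases "?s < 1") (auto simp: vel_def corner_def shear_speed_snap not_less)
qed

text \<open>On each of the \<open>2 * J\<close> cells covering the support the integral of
  \<open>g'\<close> is an increment of \<open>g\<close>, of modulus at most 2. The bound is
  independent of the size of \<open>g'\<close>, as bounded variation requires.\<close>

lemma step_integral_bound:
  fixes e g g' :: "real \<Rightarrow> real"
  assumes h: "h > 0" and J: "M < real J * h"
    and e: "\<And>t. e t = e (snap h t)" "\<And>t. \<bar>e t\<bar> \<le> 1"
    and g: "\<And>t. (g has_real_derivative g' t) (at t)" "\<And>t. \<bar>g t\<bar> \<le> 1"
    and g': "g' \<in> borel_measurable borel" "\<And>t. \<bar>g' t\<bar> \<le> C" "\<And>t. \<bar>t\<bar> > M \<Longrightarrow> g' t = 0"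
  shows "\<bar>\<integral>t. e t * g' t \<partial>lborel\<bar> \<le> 4 * real J"
proof -
  let ?I = "{- int J..<int J}"
  define c where "c j t = indicator {h * of_int j..<h * of_int (j + 1)} t * g' t" for j t
  have C0: "0 \<le> C" using order_trans[OF abs_ge_zero g'(2)] .
  have cell: "t \<in> {h * of_int j..<h * of_int (j + 1)} \<longleftrightarrow> j = \<lfloor>t / h\<rfloor>" for j t
  proof -
    have "t \<in> {h * of_int j..<h * of_int (j + 1)} \<longleftrightarrow> of_int j \<le> t / h \<and> t / h < of_int j + 1"
      using h by (simp add: pos_le_divide_eq pos_divide_less_eq mult.commute)
    also have "\<dots> \<longleftrightarrow> j = \<lfloor>t / h\<rfloor>" using floor_eq_iff[of "t / h" j] by auto
    finally show ?thesis .
  qed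
  have ci: "integrable lborel (c j)" for j
    unfolding c_def
  proof (rule integrable_bounded_support[where C = C and M = M])
    show "\<bar>indicator {h * of_int j..<h * of_int (j + 1)} t * g' t\<bar> \<le> C" for t
      using g'(2)[of t] C0 by (simp add: indicator_def)
  qed (use g' in \<open>simp_all\<close>)
  have "e t * g' t = (\<Sum>j\<in>?I. e (h * of_int j) * c j t)" for t
  proof (cases "\<bar>t\<bar> > M")
    case True
    then show ?thesis using g'(3) by (simp add: c_def)
  next
    case False
    then have "\<bar>t\<bar> < h * real J" using J by (simp add: mult.commute)
    then have "- real J \<le> t / h" "t / h < real J"
      using h by (simp_all add: pos_le_divide_eq pos_divide_less_eq abs_less_iff mult.commute)
    then have I: "\<lfloor>t / h\<rfloor> \<in> ?I" by (simp add: le_floor_iff floor_less_iff)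
    have "(\<Sum>j\<in>?I. e (h * of_int j) * c j t) = (\<Sum>j\<in>?I. if j = \<lfloor>t / h\<rfloor> then e (h * of_int j) * g' t else 0)"
      by (intro sum.cong refl) (auto simp: c_def cell[symmetric] indicator_def)
    also have "\<dots> = e (snap h t) * g' t" using I by (simp add: snap_def)
    finally show ?thesis using e(1)[of t] by simp
  qed
  then have "(\<integral>t. e t * g' t \<partial>lborel) = (\<Sum>j\<in>?I. e (h * of_int j) * (\<integral>t. c j t \<partial>lborel))"
    using ci by simp
  also have "\<bar>\<dots>\<bar> \<le> (\<Sum>j\<in>?I. 2)"
  proof (rule order_trans[OF sum_abs sum_mono])
    fix j
    have "(\<integral>t. c j t \<partial>lborel) = g (h * of_int (j + 1)) - g (h * of_int j)"
      unfolding c_def by (rule integral_FTC_Ico[OF _ g'(1,2) g(1)]) (use h in simp)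
    then have "\<bar>\<integral>t. c j t \<partial>lborel\<bar> \<le> 2"
      using g(2)[of "h * of_int (j + 1)"] g(2)[of "h * of_int j"] by linarith
    then have "\<bar>e (h * of_int j)\<bar> * \<bar>\<integral>t. c j t \<partial>lborel\<bar> \<le> 1 * 2"
      using e(2) by (intro mult_mono) auto
    then show "\<bar>e (h * of_int j) * (\<integral>t. c j t \<partial>lborel)\<bar> \<le> 2" by (simp add: abs_mult)
  qed
  also have "(\<Sum>j\<in>?I. 2 :: real) = 4 * real J" by simp
  finally show ?thesis .
qed

context compact_C1
begin

text \<open>The one-dimensional bound on every line in direction \<open>k\<close>, integrated over
  the lines that can meet the support.\<close>

lemma corner_integral_bound:
  assumes h: "h > 0" and J: "M < real J * h"
    and f: "f \<in> borel_measurable borel" "\<And>x. \<bar>f x\<bar> \<le> 1" "\<And>x. f (corner h x) = f x"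
    and g1: "\<And>x. \<bar>g x\<bar> \<le> 1"
  shows "\<bar>\<integral>x. f x * D x $ k \<partial>lborel\<bar> \<le> 4 * real J * measure lborel (cball (0 :: real \<times> real) M)"
proof -
  define E where "E p = (\<integral>t. f (insert_coord k (p, t)) * D (insert_coord k (p, t)) $ k \<partial>lborel)" for p
  have E: "\<bar>E p\<bar> \<le> 4 * real J * indicator (cball 0 M) p" for p
  proof (cases "norm p > M")
    case True
    then show ?thesis using insert_coord_supp(3)[of p k] by (simp add: E_def)
  next
    case False
    have "\<bar>E p\<bar> \<le> 4 * real J"
      unfolding E_def
    proof (rule step_integral_bound[OF h J _ _ der_insert_coord])
      fix t
      have "corner h (insert_coord k (p, snap h t)) = corner h (insert_coord k (p, t))"
        using h by (auto simp: corner_def insert_coord_def snap_idem)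
      then show "f (insert_coord k (p, t)) = f (insert_coord k (p, snap h t))" using f(3) by metis
      show "D (insert_coord k (p, t)) $ k = 0" if "\<bar>t\<bar> > M" using insert_coord_supp(1)[OF that] by simp
    qed (auto intro: f(2) g1 D_nth_bound borel_measurable_line)
    then show ?thesis using False by simp
  qed
  have Ei: "integrable lborel (\<lambda>p. \<bar>E p\<bar>)"
  proof (rule integrable_abs)
    note i = integrable_mult_D[OF f(1,2), of k]
    have m: "(\<lambda>x. f x * D x $ k) \<in> borel_measurable borel"
      using borel_measurable_integrable[OF i] by simp
    have "integrable (lborel \<Otimes>\<^sub>M lborel) (\<lambda>z. f (insert_coord k z) * D (insert_coord k z) $ k)"
      using integral_lborel_preserving(2)[OF distr_insert_coord borel_measurable_insert_coord m, of k] i by (simp add: lborel_prod)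
    then show "integrable lborel E"
      unfolding E_def by (rule lborel_pair.integrable_fst')
  qed
  have "(\<integral>x. f x * D x $ k \<partial>lborel) = (\<integral>p. E p \<partial>lborel)"
    unfolding E_def by (rule integral_insert_coord[OF integrable_mult_D[OF f(1,2)]])
  also have "\<bar>\<dots>\<bar> \<le> (\<integral>p. \<bar>E p\<bar> \<partial>lborel)" by (rule integral_abs_bound)
  also have "\<dots> \<le> (\<integral>p. 4 * real J * indicator (cball (0 :: real \<times> real) M) p \<partial>lborel)"
  proof (rule Bochner_Integration.integral_mono[OF Ei _ E])
    have "integrable lborel (indicator (cball 0 M) :: real \<times> real \<Rightarrow> real)"
      by (rule integrable_real_indicator) (simp, rule emeasure_bounded_finite, simp)
    then show "integrable lborel (\<lambda>p :: real \<times> real. 4 * real J * indicator (cball 0 M) p)" by simp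
  qed
  also have "\<dots> = 4 * real J * measure lborel (cball (0 :: real \<times> real) M)" by simp
  finally show ?thesis .
qed

end

lemma C1c_open_extend:
  fixes \<phi> :: "real ^ 3 \<Rightarrow> real"
  assumes V: "open V" "V \<subseteq> cball 0 M" and \<phi>: "\<phi> \<in> C1c V" "\<And>x. x \<in> V \<Longrightarrow> \<bar>\<phi> x\<bar> \<le> 1"
  obtains g D C where "compact_C1 g D C M" "\<And>x. \<bar>g x\<bar> \<le> 1"
    "\<And>x. x \<in> V \<Longrightarrow> grad \<phi> x = D x" "\<And>x. x \<notin> V \<Longrightarrow> D x = 0"
proof -
  obtain D0 K where D0: "continuous_on V D0" "\<And>x. x \<in> V \<Longrightarrow> (\<phi> has_derivative (\<lambda>h. h \<bullet> D0 x)) (at x within V)"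
    and K: "compact K" "K \<subseteq> V" "\<And>x. x \<in> V - K \<Longrightarrow> \<phi> x = 0"
    using \<phi>(1) unfolding C1c_def by auto
  have Kc: "open (- K)" using K(1) by (simp add: compact_imp_closed open_Compl)
  define g where "g x = indicator V x * \<phi> x" for x
  define D where "D x = indicator V x *\<^sub>R D0 x" for x
  have dV: "(\<phi> has_derivative (\<lambda>h. h \<bullet> D0 x)) (at x)" if "x \<in> V" for x
    using D0(2)[OF that] unfolding at_within_open[OF that V(1)] .
  have gK: "g x = 0" if "x \<notin> K" for x using that K(3)[of x] by (simp add: g_def indicator_def)
  have gV: "(g has_derivative (\<lambda>h. h \<bullet> D0 x)) (at x)" if "x \<in> V" for x
    by (rule has_derivative_transform_within_open[OF dV[OF that] V(1) that]) (simp add: g_def)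
  have g0: "(g has_derivative (\<lambda>h. 0)) (at x)" if "x \<notin> K" for x
  proof (rule has_derivative_transform_within_open[of "\<lambda>_. 0" _ _ _ "- K"])
    show "0 = g z" if "z \<in> - K" for z using gK[of z] that by simp
  qed (use that Kc in simp_all)
  have DK: "D x = 0" if x: "x \<notin> K" for x
  proof (cases "x \<in> V")
    case True
    from has_derivative_unique[OF g0[OF x] gV[OF True]] have "D0 x \<bullet> D0 x = 0" by (simp add: fun_eq_iff)
    then show ?thesis by (simp add: D_def)
  qed (simp add: D_def)
  have "bounded (D0 ` K)"
    by (intro compact_imp_bounded compact_continuous_image K(1)) (rule continuous_on_subset[OF D0(1) K(2)])
  then obtain C where C: "\<And>x. x \<in> K \<Longrightarrow> norm (D0 x) \<le> C" unfolding bounded_iff by auto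
  show thesis
  proof (rule that[of g D "max 0 C"])
    show "compact_C1 g D (max 0 C) M"
    proof
      show "(g has_derivative (\<lambda>h. h \<bullet> D x)) (at x)" for x
      proof (cases "x \<in> V")
        case True
        then show ?thesis using gV[OF True] by (simp add: D_def)
      next
        case False
        then have "x \<notin> K" using K(2) by auto
        from g0[OF this] DK[OF this] show ?thesis by simp
      qed
      show "D \<in> borel_measurable borel"
        unfolding D_def[abs_def] using V(1) D0(1)
        by (intro borel_measurable_continuous_on_indicator) simp_all
      show "norm (D x) \<le> max 0 C" for x
        using C[of x] DK[of x] by (cases "x \<in> K") (auto simp: D_def indicator_def)
      have "x \<notin> K" if "norm x > M" for x using that subsetD[OF K(2), of x] subsetD[OF V(2), of x] by auto
      then show "D x = 0" "g x = 0" if "norm x > M" for x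
        using DK[of x] gK[of x] that by simp_all
    qed
    show "\<bar>g x\<bar> \<le> 1" for x using \<phi>(2)[of x] by (simp add: g_def indicator_def)
    show "grad \<phi> x = D x" if "x \<in> V" for x using grad_eqI[OF dV[OF that]] that by (simp add: D_def)
    show "D x = 0" if "x \<notin> V" for x using that by (simp add: D_def)
  qed
qed

lemma vel_L1_loc: "(\<lambda>x. vel x $ i) \<in> L1_loc (lebesgue_on {x :: real ^ 3. 0 < x $ 3})"
  unfolding L1_loc_def
proof (safe)
  let ?\<Omega> = "{x :: real ^ 3. 0 < x $ 3}"
  have m: "(\<lambda>x. vel x $ i) \<in> borel_measurable borel" by measurable
  then show "(\<lambda>x. vel x $ i) \<in> borel_measurable (lebesgue_on ?\<Omega>)"
    by (intro measurable_restrict_space1 measurable_completion) simp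
  fix K :: "(real ^ 3) set" assume K: "compact K"
  obtain M where M: "\<And>x. x \<in> K \<Longrightarrow> norm x \<le> M"
    using compact_imp_bounded[OF K] unfolding bounded_iff by auto
  have KB: "K \<in> sets borel" using K by (rule borel_compact)
  have "integrable lborel (\<lambda>x. indicator (K \<inter> ?\<Omega>) x * vel x $ i)"
  proof (rule integrable_bounded_support[where C = 1 and M = M])
    show "(\<lambda>x. indicator (K \<inter> ?\<Omega>) x * vel x $ i) \<in> borel_measurable borel"
      using m KB by measurable
    show "\<bar>indicator (K \<inter> ?\<Omega>) x * vel x $ i\<bar> \<le> 1" for x
      using vel_bound[of x i] by (simp add: indicator_def)
    show "indicator (K \<inter> ?\<Omega>) x * vel x $ i = 0" if "norm x > M" for x
      using M[of x] that by (auto simp: indicator_def)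
  qed
  then have "integrable lebesgue (\<lambda>x. indicator (K \<inter> ?\<Omega>) x * vel x $ i)"
    by (rule integrable_completion[THEN iffD2, rotated]) (use m KB in measurable)
  then show "set_integrable (lebesgue_on ?\<Omega>) K (\<lambda>x. vel x $ i)"
    unfolding set_integrable_def
    by (subst integrable_restrict_space) (auto simp: indicator_inter_arith mult_ac)
qed

text \<open>A relatively compact \<open>V\<close> stays above some height \<open>width N\<close>,
  where the field is constant on cubes of one fixed mesh; each of the three terms of the divergence
  is then bounded by \<open>B\<close>.\<close>

lemma vel_BV_loc: "(\<lambda>x. vel x $ i) \<in> BV_loc {x :: real ^ 3. 0 < x $ 3}"
  unfolding BV_loc_def
proof (intro CollectI conjI allI impI vel_L1_loc, elim conjE)
  let ?\<Omega> = "{x :: real ^ 3. 0 < x $ 3}"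
  fix V :: "(real ^ 3) set" assume V: "open V" "compact (closure V)" "closure V \<subseteq> ?\<Omega>"
  obtain M where "\<And>x. x \<in> closure V \<Longrightarrow> norm x \<le> M"
    using compact_imp_bounded[OF V(2)] unfolding bounded_iff by auto
  then have M: "V \<subseteq> cball 0 M"
    using closure_subset[of V] by auto
  have "\<exists>N. \<forall>x\<in>V. width N \<le> x $ 3"
  proof (cases "V = {}")
    case False
    have "continuous_on (closure V) (\<lambda>x. x $ 3)" by (intro continuous_intros)
    moreover have "closure V \<noteq> {}" using False by simp
    ultimately obtain x0 where x0: "x0 \<in> closure V" "\<And>x. x \<in> closure V \<Longrightarrow> x0 $ 3 \<le> x $ 3"
      using continuous_attains_inf[OF V(2)] by blast
    then have "0 < x0 $ 3" using V(3) by auto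
    then obtain N where "width N < x0 $ 3"
      using order_tendstoD(2)[OF width_tendsto] by (auto simp: eventually_sequentially)
    then have "width N \<le> x $ 3" if "x \<in> V" for x
      using x0(2)[OF subsetD[OF closure_subset that]] by linarith
    then have "\<forall>x\<in>V. width N \<le> x $ 3" by blast
    then show ?thesis ..
  qed simp
  then obtain N where N: "\<And>x. x \<in> V \<Longrightarrow> width N \<le> x $ 3" by blast
  define h where "h = width (N + 1)"
  have h: "h > 0" by (simp add: h_def)
  obtain J :: nat where J: "M < real J * h" using reals_Archimedean3[OF h] by blast
  define B where "B = 4 * real J * measure lborel (cball (0 :: real \<times> real) M)"
  \<comment> \<open>\<open>f\<close> agrees with the field on \<open>V\<close> but is constant on
    grid cubes everywhere, also near the boundary where the field oscillates faster; it can
    therefore be integrated over the whole space.\<close>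
  define f where "f x = vel (corner h x) $ i" for x
  have f: "f \<in> borel_measurable borel" "\<And>x. \<bar>f x\<bar> \<le> 1" "\<And>x. f (corner h x) = f x"
    using h by (auto simp: f_def[abs_def] vel_bound corner_def snap_idem)
  show "bdd_above {LINT x|lebesgue_on V. vel x $ i * divergence \<Phi> x |\<Phi>.
      (\<forall>b\<in>Basis. (\<lambda>x. \<Phi> x \<bullet> b) \<in> C1c V) \<and> (\<forall>x\<in>V. norm (\<Phi> x) \<le> 1)}"
  proof (rule bdd_aboveI[of _ "3 * B"], clarify)
    fix \<Phi> :: "real ^ 3 \<Rightarrow> real ^ 3"
    assume \<Phi>: "\<forall>b\<in>Basis. (\<lambda>x. \<Phi> x \<bullet> b) \<in> C1c V" "\<forall>x\<in>V. norm (\<Phi> x) \<le> 1"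
    \<comment> \<open>Collects the facts from the locale for one component, so that a gradient can
      be chosen for all basis vectors simultaneously.\<close>
    define good where "good b D \<longleftrightarrow> (\<forall>x\<in>V. grad (\<lambda>y. \<Phi> y \<bullet> b) x = D x) \<and> (\<forall>x. x \<notin> V \<longrightarrow> D x = 0) \<and>
        (\<forall>k. integrable lborel (\<lambda>x. f x * D x $ k) \<and> \<bar>\<integral>x. f x * D x $ k \<partial>lborel\<bar> \<le> B) \<and> D \<in> borel_measurable borel"
      for b and D :: "real ^ 3 \<Rightarrow> real ^ 3"
    have "\<forall>b\<in>Basis. \<exists>D. good b D"
    proof
      fix b :: "real ^ 3" assume b: "b \<in> Basis"
      have "\<bar>\<Phi> x \<bullet> b\<bar> \<le> 1" if "x \<in> V" for x
        using Basis_le_norm[OF b, of "\<Phi> x"] \<Phi>(2) that by force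
      with \<Phi>(1) b obtain g D C where gD: "compact_C1 g D C M" "\<And>x. \<bar>g x\<bar> \<le> 1"
        "\<And>x. x \<in> V \<Longrightarrow> grad (\<lambda>y. \<Phi> y \<bullet> b) x = D x" "\<And>x. x \<notin> V \<Longrightarrow> D x = 0"
        using C1c_open_extend[OF V(1) M, of "\<lambda>y. \<Phi> y \<bullet> b"] by blast
      interpret compact_C1 g D C M by (rule gD(1))
      show "\<exists>D. good b D"
        using gD(3,4) integrable_mult_D[OF f(1,2)] corner_integral_bound[OF h J f gD(2)] meas
        unfolding good_def B_def by (intro exI[of _ D]) simp
    qed
    from bchoice[OF this] obtain D where "\<forall>b\<in>Basis. good b (D b)" ..
    then have D: "\<And>b x. b \<in> Basis \<Longrightarrow> x \<in> V \<Longrightarrow> grad (\<lambda>y. \<Phi> y \<bullet> b) x = D b x"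
      "\<And>b x. b \<in> Basis \<Longrightarrow> x \<notin> V \<Longrightarrow> D b x = 0"
      "\<And>b k. b \<in> Basis \<Longrightarrow> integrable lborel (\<lambda>x. f x * D b x $ k)"
      "\<And>b k. b \<in> Basis \<Longrightarrow> \<bar>\<integral>x. f x * D b x $ k \<partial>lborel\<bar> \<le> B"
      "\<And>b. b \<in> Basis \<Longrightarrow> D b \<in> borel_measurable borel"
      by (simp_all add: good_def)
    define e1 e2 e3 where "e1 = vec3 1 0 0" and "e2 = vec3 0 1 0" and "e3 = vec3 0 0 1"
    have e: "e1 \<in> Basis" "e2 \<in> Basis" "e3 \<in> Basis" by (simp_all add: Basis_real3 e1_def e2_def e3_def)
    have div: "divergence \<Phi> x = D e1 x $ 1 + D e2 x $ 2 + D e3 x $ 3" if "x \<in> V" for x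
    proof -
      have "divergence \<Phi> x = D e1 x \<bullet> e1 + (D e2 x \<bullet> e2 + D e3 x \<bullet> e3)"
        unfolding divergence_def Basis_real3 e1_def[symmetric] e2_def[symmetric] e3_def[symmetric]
        using D(1)[OF e(1) that] D(1)[OF e(2) that] D(1)[OF e(3) that]
        by (simp add: e1_def e2_def e3_def)
      then show ?thesis by (simp add: e1_def e2_def e3_def inner_vec3)
    qed
    have [measurable]: "D e1 \<in> borel_measurable borel" "D e2 \<in> borel_measurable borel" "D e3 \<in> borel_measurable borel"
      using D(5) e by auto
    note [measurable] = f(1)
    have "(LINT x|lebesgue_on V. vel x $ i * divergence \<Phi> x)
      = (\<integral>x. f x * D e1 x $ 1 + f x * D e2 x $ 2 + f x * D e3 x $ 3 \<partial>lborel)"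
    proof (rule integral_lebesgue_on)
      show "V \<in> sets borel" using V(1) by simp
      show "vel x $ i * divergence \<Phi> x = f x * D e1 x $ 1 + f x * D e2 x $ 2 + f x * D e3 x $ 3" if "x \<in> V" for x
        using vel_corner[OF N[OF that]] by (simp add: div[OF that] f_def h_def algebra_simps)
      show "f x * D e1 x $ 1 + f x * D e2 x $ 2 + f x * D e3 x $ 3 = 0" if "x \<notin> V" for x
        using D(2)[OF e(1) that] D(2)[OF e(2) that] D(2)[OF e(3) that] by simp
    qed measurable
    also have "\<dots> = (\<integral>x. f x * D e1 x $ 1 \<partial>lborel) + (\<integral>x. f x * D e2 x $ 2 \<partial>lborel) + (\<integral>x. f x * D e3 x $ 3 \<partial>lborel)"
      using D(3) e by simp
    also have "\<dots> \<le> 3 * B"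
      using D(4)[OF e(1), of 1] D(4)[OF e(2), of 2] D(4)[OF e(3), of 3] by linarith
    finally show "(LINT x|lebesgue_on V. vel x $ i * divergence \<Phi> x) \<le> 3 * B" .
  qed
qed

theorem proposition1p8:
  fixes \<Omega> :: "(real ^ 3) set"
  assumes "\<Omega> = {x. x $ 3 > 0}"
  shows "\<exists>u :: real ^ 3 \<Rightarrow> real ^ 3.
    weakly_divergence_free \<Omega> u \<and>
    u \<in> Linfty (lebesgue_on \<Omega>) \<and>
    u \<in> BV_loc_field \<Omega> \<and>
    has_normal_trace \<Omega> u (\<lambda>_. - 1) \<and>
    has_outward_Lebesgue_trace \<Omega> u (\<lambda>_. - 1) \<and>
    infinite ({\<rho>. weak_solution \<Omega> u \<rho>} // ae_equal (lebesgue_on (cylinder \<Omega>)))"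
proof (intro exI[of _ vel] conjI)
  have \<Omega>: "\<Omega> = {x. 0 < x $ 3}" using assms by simp
  show "weakly_divergence_free \<Omega> vel" "has_normal_trace \<Omega> vel (\<lambda>_. - 1)"
    "has_outward_Lebesgue_trace \<Omega> vel (\<lambda>_. - 1)"
    unfolding \<Omega> by (rule weakly_divergence_free_vel vel_normal_trace vel_Lebesgue_trace)+
  show "infinite ({\<rho>. weak_solution \<Omega> vel \<rho>} // ae_equal (lebesgue_on (cylinder \<Omega>)))"
    unfolding \<Omega> by (rule infinite_weak_solutions[OF vel_normal_trace])
  have "vel \<in> borel_measurable (lebesgue_on \<Omega>)"
    by (intro measurable_restrict_space1 measurable_completion) simp
  then show "vel \<in> Linfty (lebesgue_on \<Omega>)"
    unfolding Linfty_def using norm_vel by auto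
  show "vel \<in> BV_loc_field \<Omega>"
    unfolding BV_loc_field_def \<Omega> using vel_BV_loc[of 1] vel_BV_loc[of 2] vel_BV_loc[of 3]
    by (auto simp: Basis_real3 inner_vec3)
qed

end
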